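(* Let $A$ be a PAJ generated by a set $X=X'\cup X''$ of primitive axes, where $X'$ consists of the axes of $X$ of type $(\lambda,\delta)$ and $X''$ of those of type $(\delta,\lambda)$, with $\lambda+\delta=1$ and $\lambda\neq\delta$. Set $A'=\langle\langle X'\rangle\rangle$, $A''=\langle\langle X''\rangle\rangle$ and let $Z=\sum_{x'\in X',\,x''\in X''}\mathbb F\,x'x''$. Let $a,a'\in A$ be two primitive axes of type $(\lambda,\delta)$ and $b\in A$ a primitive axis of type $(\delta,\lambda)$. (i) $A'$ is a direct product of algebras of the form $\mathbb U_{E_i}(\lambda)$ (for various sets $E_i$), and $A''$ is a direct product of algebras of the form $\mathbb U_{E_j}(\delta)$ (for various sets $E_j$). (ii) $ab,ba\in A_{\lambda,\delta}(a')$ if $aa'\neq0$, while $ab,ba\in A_0(a')$ if $aa'=0$. In particular, if $x'\in A$ is a primitive axis of type $(\lambda,\delta)$ with $a'x'\neq0$, then $A_0(a')\cap Z=A_0(x')\cap Z$ and $A_{\lambda,\delta}(a')\cap Z=A_{\lambda,\delta}(x')\cap Z$. (iii) $Z$ is an ideal of $A$ with $Z^2=0$, so $A=A'+A''+Z$. Consequently $A$ is finite dimensional if $X$ is finite. (iv) If $w\in A_{\lambda,\delta}(a)$, then $w=v'+z'$ with $v'\in(\mathbb Fa+A')\cap A_{\lambda,\delta}(a)$ and $z'\in Z\cap A_{\lambda,\delta}(a)$. In particular, if $a\in X'$, then $A_{\lambda,\delta}(a)=A'_{\lambda,\delta}(a)+Z\cap A_{\lambda,\delta}(a)$. Hence if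 $a_1,a_2\in X'$ are in the same connected component of $X'$, then $A_{\lambda,\delta}(a_1)=A_{\lambda,\delta}(a_2)$. Furthermore $A_{\lambda,\delta}(a)^2=0$. (v) Any primitive axis in the algebra $A'$ (resp. $A''$) is a primitive axis in $A$. (vi) Suppose $X'$ is the set of all primitive axes of $A$ of type $(\lambda,\delta)$. Taking one primitive axis $a'_j$ from each connected component of $X'$, we have $Z\subseteq\sum_j A'_{\lambda,\delta}(a'_j)$. The same assertion holds with $X''$ in place of $X'$, $A''$ in place of $A'$ and $(\delta,\lambda)$ in place of $(\lambda,\delta)$. (vii) If $X'$ is connected, then $A_{\lambda,\delta}(a)=\sum_{x'\in X'}\mathbb F(x'-a)+Z$ for all $a\in X'$, so $A_{\lambda,\delta}(a)$ is an ideal of $A$, and $A/A_{\lambda,\delta}(a)\cong\mathbb F\times\overline{A''}$, where $\overline{A''}$ is the image of $A''$ in $A/Z$. (viii) Suppose $X=\chi(A)$. Taking one primitive axis $a'_j$ from each connected component of $X'$ and one primitive axis $a''_j$ from each connected component of $X''$, let $I=\sum_jA'_{\lambda,\delta}(a'_j)+\sum_jA''_{\delta,\lambda}(a''_j)$. Then $I$ is an ideal of $A$ and $A/I$ is a direct product of fields. (ix) $A$ has no nonzero annihilating element. Hence $A$ is the direct product of the subalgebras $A_i=\langle\langle X_i\rangle\rangle$, where $\{X_i\}$ are the connected components of $\operatorname{Cl}(X)$ in the axial graph.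
   Context: Algebras are not necessarily associative, commutative or unital. $\mathbb F$ is a field of characteristic $\ne 2$ and $A$ is an $\mathbb F$-algebra. $\langle\langle X\rangle\rangle$ is the subalgebra of $A$ generated by $X$. For an idempotent $a$ of an algebra $B$ put $B_0(a)=\{y\in B: ay=ya=0\}$ and $B_{\lambda,\delta}(a)=\{y\in B: ay=\lambda y,\ ya=\delta y\}$ (so $A_{\lambda,\delta}(a)$, $A'_{\lambda,\delta}(a)$, $A''_{\delta,\lambda}(a)$ are computed in $A$, $A'$, $A''$ respectively). For $\lambda,\delta\in\mathbb F\setminus\{0,1\}$, a primitive axis of type $(\lambda,\delta)$ in $A$ is a nonzero idempotent $a\in A$ with $\{y:ay=y\}=\mathbb Fa=\{y:ya=y\}$, such that $A=\mathbb Fa\oplus A_0(a)\oplus A_{\lambda,\delta}(a)$ and this is a $\mathbb Z_2$-grading with even part $\mathbb Fa\oplus A_0(a)$ and odd part $A_{\lambda,\delta}(a)$. Each primitive axis is regarded as carrying exactly one type (if $A_{\lambda,\delta}(a)=0$, a fixed choice is made); in particular $X'\cap X''=\emptyset$. A PAJ is an algebra generated by a set of primitive axes. $\chi(A)$ is the set of all primitive axes of $A$. The Miyamoto involution of a primitive axis $a$ of type $(\lambda,\delta)$ is the automorphism $\tau_a$ of $A$ that is the identity on $\mathbb Fa\oplus A_0(a)$ and $-1$ on $A_{\lambda,\delta}(a)$. $\mathcal G(X)$ is the group generated by $\{\tau_x:x\in X\}$ and $\operatorname{Cl}(X)=\{\rho(x): x\in X,\ \rho\in\mathcal G(X)\}$.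 The axial graph has vertex set $\chi(A)$, with $x',x''$ joined by an edge when $x'x''\neq0$ (equivalently $x''x'\ne0$); connectedness and connected components of a set of axes refer to the full induced subgraph. For $\lambda\neq0,1$ and a nonempty set $E$, $\mathbb U_E(\lambda)$ is the algebra having as basis the set of idempotents $E=\{e_i:i\in I\}$ with multiplication $e_ie_j=(1-\lambda)e_i+\lambda e_j$ for all $i,j\in I$. An element $y\in A$ is annihilating if $Ay=0$ (equivalently $yA=0$). "Direct product" of a family of subalgebras means that the algebra is their internal direct sum as vector spaces and that distinct factors multiply to zero; for infinitely many factors this is the restricted (finite-support) product. *)

theory Defs
  imports
    Complex_Main
    "HOL-Library.Set_Algebras"
    "HOL-Algebra.QuotRing"
    "HOL-Algebra.Module"
    "HOL-Algebra.Bij"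
    "HOL-Algebra.Generated_Groups"
begin

section \<open>Nonassociative algebras\<close>

text \<open>
  The ambient algebra is a whole type: addition and multiplication are the overloaded
  operations of that type, where \<^class>\<open>times\<close> is a purely syntactic class, and the scalar
  action of the field is an explicit parameter.  No associativity, commutativity or unit
  is assumed.
\<close>

locale nonassoc_algebra = vector_space scale
  for scale :: "'k::field \<Rightarrow> 'a::{ab_group_add,times} \<Rightarrow> 'a" +
  assumes linear_mult_right: "Vector_Spaces.linear scale scale (\<lambda>y. x * y)"
    and linear_mult_left: "Vector_Spaces.linear scale scale (\<lambda>x. x * y)"

definition subalgebra ::
  "('k::field \<Rightarrow> 'a::{ab_group_add,times} \<Rightarrow> 'a) \<Rightarrow> 'a set \<Rightarrow> bool"
where
  "subalgebra scale S \<longleftrightarrow> module.subspace scale S \<and> (\<forall>x\<in>S. \<forall>y\<in>S. x * y \<in> S)"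

definition generated_subalgebra ::
  "('k::field \<Rightarrow> 'a::{ab_group_add,times} \<Rightarrow> 'a) \<Rightarrow> 'a set \<Rightarrow> 'a set"
where
  "generated_subalgebra scale X = subalgebra scale hull X"

definition algebra_ideal ::
  "('k::field \<Rightarrow> 'a::{ab_group_add,times} \<Rightarrow> 'a) \<Rightarrow> 'a set \<Rightarrow> bool"
where
  "algebra_ideal scale J \<longleftrightarrow>
     module.subspace scale J \<and> (\<forall>x. \<forall>y\<in>J. x * y \<in> J \<and> y * x \<in> J)"

definition algebra_automorphism ::
  "('k::field \<Rightarrow> 'a::{ab_group_add,times} \<Rightarrow> 'a) \<Rightarrow> ('a \<Rightarrow> 'a) \<Rightarrow> bool"
where
  "algebra_automorphism scale f \<longleftrightarrow>
     Vector_Spaces.linear scale scale f \<and> bij f \<and> (\<forall>x y. f (x * y) = f x * f y)"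

definition annihilating :: "'a::{ab_group_add,times} \<Rightarrow> bool" where
  "annihilating y \<longleftrightarrow> (\<forall>x. x * y = 0)"


section \<open>Primitive axes\<close>

text \<open>
  The set \<open>S\<close> below is the subalgebra in which the eigenspaces and the axis property are
  taken; it is \<open>UNIV\<close> for the ambient algebra.
\<close>

definition null_part :: "'a::{ab_group_add,times} set \<Rightarrow> 'a \<Rightarrow> 'a set" where
  "null_part S a = {y \<in> S. a * y = 0 \<and> y * a = 0}"

definition eigenspace ::
  "('k::field \<Rightarrow> 'a::{ab_group_add,times} \<Rightarrow> 'a) \<Rightarrow> 'a set \<Rightarrow> 'k \<Rightarrow> 'k \<Rightarrow> 'a \<Rightarrow> 'a set"
where
  "eigenspace scale S l d a = {y \<in> S. a * y = scale l y \<and> y * a = scale d y}"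

definition even_part ::
  "('k::field \<Rightarrow> 'a::{ab_group_add,times} \<Rightarrow> 'a) \<Rightarrow> 'a set \<Rightarrow> 'a \<Rightarrow> 'a set"
where
  "even_part scale S a = module.span scale {a} + null_part S a"

definition has_axis_type ::
  "('k::field \<Rightarrow> 'a::{ab_group_add,times} \<Rightarrow> 'a) \<Rightarrow> 'a set \<Rightarrow> 'k \<Rightarrow> 'k \<Rightarrow> 'a \<Rightarrow> bool"
where
  "has_axis_type scale S l d a \<longleftrightarrow>
     l \<notin> {0, 1} \<and> d \<notin> {0, 1} \<and>
     a \<in> S \<and> a \<noteq> 0 \<and> a * a = a \<and>
     {y \<in> S. a * y = y} = module.span scale {a} \<and>
     {y \<in> S. y * a = y} = module.span scale {a} \<and>
     (\<forall>y\<in>S. \<exists>!t. t \<in> module.span scale {a} \<times> null_part S a \<times> eigenspace scale S l d a \<and>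
                y = fst t + fst (snd t) + snd (snd t)) \<and>
     (let E = even_part scale S a; D = eigenspace scale S l d a
      in E * E \<subseteq> E \<and> E * D \<subseteq> D \<and> D * E \<subseteq> D \<and> D * D \<subseteq> E)"

definition primitive_axis ::
  "('k::field \<Rightarrow> 'a::{ab_group_add,times} \<Rightarrow> 'a) \<Rightarrow> 'a set \<Rightarrow> 'a \<Rightarrow> bool"
where
  "primitive_axis scale S a \<longleftrightarrow> (\<exists>l d. has_axis_type scale S l d a)"

text \<open>
  An axis \<open>a\<close> whose odd part is zero satisfies \<^const>\<open>has_axis_type\<close> for every pair of scalars
  outside \<open>{0, 1}\<close>.  A typing \<open>ty\<close> fixes one type for each primitive axis of the ambient
  algebra; ``a primitive axis of type \<open>(l, d)\<close>'' always refers to the type so assigned.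
\<close>

definition axis_typing ::
  "('k::field \<Rightarrow> 'a::{ab_group_add,times} \<Rightarrow> 'a) \<Rightarrow> ('a \<Rightarrow> 'k \<times> 'k) \<Rightarrow> bool"
where
  "axis_typing scale ty \<longleftrightarrow>
     (\<forall>a. primitive_axis scale UNIV a \<longrightarrow>
        has_axis_type scale UNIV (fst (ty a)) (snd (ty a)) a)"

definition primitive_axes ::
  "('k::field \<Rightarrow> 'a::{ab_group_add,times} \<Rightarrow> 'a) \<Rightarrow> 'a set"
where
  "primitive_axes scale = {a. primitive_axis scale UNIV a}"

definition axes_of_type ::
  "('k::field \<Rightarrow> 'a::{ab_group_add,times} \<Rightarrow> 'a) \<Rightarrow> ('a \<Rightarrow> 'k \<times> 'k) \<Rightarrow> 'k \<Rightarrow> 'k \<Rightarrow> 'a set"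
where
  "axes_of_type scale ty l d = {a \<in> primitive_axes scale. ty a = (l, d)}"

definition miyamoto ::
  "('k::field \<Rightarrow> 'a::{ab_group_add,times} \<Rightarrow> 'a) \<Rightarrow> ('a \<Rightarrow> 'k \<times> 'k) \<Rightarrow> 'a \<Rightarrow> 'a \<Rightarrow> 'a"
where
  "miyamoto scale ty a =
     (THE f. algebra_automorphism scale f \<and>
        (\<forall>y\<in>even_part scale UNIV a. f y = y) \<and>
        (\<forall>y\<in>eigenspace scale UNIV (fst (ty a)) (snd (ty a)) a. f y = - y))"

definition miyamoto_group ::
  "('k::field \<Rightarrow> 'a::{ab_group_add,times} \<Rightarrow> 'a) \<Rightarrow> ('a \<Rightarrow> 'k \<times> 'k) \<Rightarrow> 'a set \<Rightarrow> ('a \<Rightarrow> 'a) set"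
where
  "miyamoto_group scale ty X = generate (BijGroup UNIV) (miyamoto scale ty ` X)"

definition axis_closure ::
  "('k::field \<Rightarrow> 'a::{ab_group_add,times} \<Rightarrow> 'a) \<Rightarrow> ('a \<Rightarrow> 'k \<times> 'k) \<Rightarrow> 'a set \<Rightarrow> 'a set"
where
  "axis_closure scale ty X = {g x | g x. g \<in> miyamoto_group scale ty X \<and> x \<in> X}"


section \<open>The axial graph\<close>

text \<open>
  The adjacency condition \<open>x * y \<noteq> 0\<close> is symmetric on primitive axes, so on a set of axes
  \<open>linked_in\<close> is an equivalence relation.
\<close>

definition linked_in :: "'a::{ab_group_add,times} set \<Rightarrow> ('a \<times> 'a) set" where
  "linked_in V = {(x, y) \<in> V \<times> V. x * y \<noteq> 0}\<^sup>* \<inter> V \<times> V"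

definition graph_components :: "'a::{ab_group_add,times} set \<Rightarrow> 'a set set" where
  "graph_components V = V // linked_in V"

definition graph_connected :: "'a::{ab_group_add,times} set \<Rightarrow> bool" where
  "graph_connected V \<longleftrightarrow> (\<forall>x\<in>V. \<forall>y\<in>V. (x, y) \<in> linked_in V)"

definition component_transversal :: "'a::{ab_group_add,times} set \<Rightarrow> 'a set \<Rightarrow> bool" where
  "component_transversal V T \<longleftrightarrow> T \<subseteq> V \<and> (\<forall>C\<in>graph_components V. \<exists>!x. x \<in> T \<inter> C)"


section \<open>The algebras \<open>U\<close>\<close>

text \<open>\<open>is_U scale l E\<close>: the span of \<open>E\<close> is the algebra \<open>U\<^bsub>E\<^esub>(l)\<close> with basis \<open>E\<close>.\<close>

definition is_U ::
  "('k::field \<Rightarrow> 'a::{ab_group_add,times} \<Rightarrow> 'a) \<Rightarrow> 'k \<Rightarrow> 'a set \<Rightarrow> bool"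
where
  "is_U scale l E \<longleftrightarrow>
     E \<noteq> {} \<and> \<not> module.dependent scale E \<and>
     (\<forall>e\<in>E. \<forall>f\<in>E. e * f = scale (1 - l) e + scale l f)"


section \<open>Algebras with a carrier set\<close>

text \<open>
  Subalgebras, quotients and products are compared as records of the library type
  \<^typ>\<open>('k, 'b) module\<close>; the scalars are the whole type \<open>'k\<close>.  The component \<^const>\<open>one\<close> of
  these records has no meaning for nonunital algebras and is never used, except that
  \<open>is_field_algebra\<close> replaces it by an actual unit.
\<close>

definition algebra_on ::
  "('k::field \<Rightarrow> 'a::{ab_group_add,times} \<Rightarrow> 'a) \<Rightarrow> 'a set \<Rightarrow> ('k, 'a) module"
where
  "algebra_on scale S =
     \<lparr>carrier = S, mult = (*), one = undefined, zero = 0, add = (+), smult = scale\<rparr>"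

definition base_field_algebra :: "('k::field, 'k) module" where
  "base_field_algebra =
     \<lparr>carrier = UNIV, mult = (*), one = 1, zero = 0, add = (+), smult = (*)\<rparr>"

definition quotient_algebra :: "('k, 'b) module \<Rightarrow> 'b set \<Rightarrow> ('k, 'b set) module" where
  "quotient_algebra B J =
     \<lparr>carrier = a_rcosets\<^bsub>B\<^esub> J, mult = rcoset_mult B J, one = undefined,
      zero = J, add = set_add B,
      smult = (\<lambda>c C. \<Union>x\<in>C. J +>\<^bsub>B\<^esub> (c \<odot>\<^bsub>B\<^esub> x))\<rparr>"

definition product_algebra ::
  "('k, 'b) module \<Rightarrow> ('k, 'c) module \<Rightarrow> ('k, 'b \<times> 'c) module"
where
  "product_algebra B C =
     \<lparr>carrier = carrier B \<times> carrier C,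
      mult = (\<lambda>p q. (fst p \<otimes>\<^bsub>B\<^esub> fst q, snd p \<otimes>\<^bsub>C\<^esub> snd q)),
      one = undefined,
      zero = (\<zero>\<^bsub>B\<^esub>, \<zero>\<^bsub>C\<^esub>),
      add = (\<lambda>p q. (fst p \<oplus>\<^bsub>B\<^esub> fst q, snd p \<oplus>\<^bsub>C\<^esub> snd q)),
      smult = (\<lambda>c p. (c \<odot>\<^bsub>B\<^esub> fst p, c \<odot>\<^bsub>C\<^esub> snd p))\<rparr>"

definition algebra_isomorphic :: "('k, 'b) module \<Rightarrow> ('k, 'c) module \<Rightarrow> bool" where
  "algebra_isomorphic B C \<longleftrightarrow>
     (\<exists>f. bij_betw f (carrier B) (carrier C) \<and>
        (\<forall>x\<in>carrier B. \<forall>y\<in>carrier B.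
           f (x \<oplus>\<^bsub>B\<^esub> y) = f x \<oplus>\<^bsub>C\<^esub> f y \<and> f (x \<otimes>\<^bsub>B\<^esub> y) = f x \<otimes>\<^bsub>C\<^esub> f y) \<and>
        (\<forall>c. \<forall>x\<in>carrier B. f (c \<odot>\<^bsub>B\<^esub> x) = c \<odot>\<^bsub>C\<^esub> f x))"

definition is_field_algebra :: "('k, 'b) module \<Rightarrow> bool" where
  "is_field_algebra B \<longleftrightarrow> (\<exists>u. field (B\<lparr>one := u\<rparr>))"

definition is_subalgebra_of :: "'b set \<Rightarrow> ('k, 'b) module \<Rightarrow> bool" where
  "is_subalgebra_of S B \<longleftrightarrow>
     S \<subseteq> carrier B \<and> \<zero>\<^bsub>B\<^esub> \<in> S \<and>
     (\<forall>x\<in>S. \<forall>y\<in>S. x \<oplus>\<^bsub>B\<^esub> y \<in> S \<and> x \<otimes>\<^bsub>B\<^esub> y \<in> S) \<and>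
     (\<forall>c. \<forall>x\<in>S. c \<odot>\<^bsub>B\<^esub> x \<in> S)"

text \<open>The internal (restricted) direct product of the family of subalgebras \<open>S i\<close>, \<open>i \<in> I\<close>.\<close>

definition direct_product_of :: "('k, 'b) module \<Rightarrow> 'i set \<Rightarrow> ('i \<Rightarrow> 'b set) \<Rightarrow> bool" where
  "direct_product_of B I S \<longleftrightarrow>
     (\<forall>i\<in>I. is_subalgebra_of (S i) B) \<and>
     (\<forall>i\<in>I. \<forall>j\<in>I. i \<noteq> j \<longrightarrow> (\<forall>x\<in>S i. \<forall>y\<in>S j. x \<otimes>\<^bsub>B\<^esub> y = \<zero>\<^bsub>B\<^esub>)) \<and>
     (\<forall>x\<in>carrier B. \<exists>!f.
        (\<forall>i\<in>I. f i \<in> S i) \<and> (\<forall>i. i \<notin> I \<longrightarrow> f i = \<zero>\<^bsub>B\<^esub>) \<and>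
        finite {i. f i \<noteq> \<zero>\<^bsub>B\<^esub>} \<and>
        x = finsum B f {i. f i \<noteq> \<zero>\<^bsub>B\<^esub>})"

end

theory Submission
  imports Defs
begin

text \<open>
  Two axes of the same type either annihilate each other or generate a copy of \<open>U\<close>, and the relation
  \<open>a * b \<noteq> 0\<close> is transitive on them.  For axes \<open>a\<close>, \<open>b\<close> of the two opposite types the reflection of
  \<open>a\<close> in \<open>b\<close> is \<open>a - 2 *s m\<close> with \<open>a * b = l *s m\<close>, and it is linked to \<open>a\<close>; transitivity therefore
  shows that \<open>m\<close> is an eigenvector of every axis linked to \<open>a\<close> and is annihilated by the others.  So
  linked axes act identically on the span \<open>Z\<close> of the mixed products, which forces \<open>Z * Z = 0\<close>, and the
  algebra is \<open>span X + span Y + Z\<close>.  The odd part of an axis is then a square-zero ideal, the commutator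
  with the axis is a derivation, and the coordinate along an axis of \<open>X\<close> is a homomorphism to the field.
  These facts pass to affine combinations of linked axes by linearity.
\<close>

section \<open>Bilinearity and generated subalgebras\<close>

text \<open>The even part of an axis \<open>a\<close> commutes with \<open>a\<close>, so the odd
  component of \<open>y\<close> is \<open>(a * y - y * a) / (l - d)\<close>. This formula is linear
  in \<open>a\<close> as well as in \<open>y\<close>, which lets statements about axes pass to
  combinations of axes that are not themselves axes. The conditions \<open>l + d = 1\<close> and
  \<open>l \<noteq> d\<close> give \<open>l * l - d * d = l - d\<close>, a nonzero number; this is
  what makes it possible to solve for \<open>a * b\<close> and \<open>b * a\<close> when two axes
  are decomposed with respect to each other. The main obstacle is that
  \<open>span X + span Y + Z\<close> is in general not a direct sum: reflections of members of
  \<open>X\<close> may lie in \<open>X\<close> again, and then mixed products lie in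
  \<open>span X\<close>. Instead, the part of \<open>v\<close> belonging to one class of linked axes
  is extracted from the single product \<open>r * v\<close> with a representative \<open>r\<close>,
  up to an error in \<open>Z\<close>, and uniqueness in the direct products is derived from
  nondegeneracy of the multiplication. The two types enter symmetrically: results are proved for one
  type and transferred by exchanging the scalars and the two sets of axes.\<close>

context nonassoc_algebra
begin

notation scale (infixr "*s" 75)

lemma mult_add_right: "x * (y + z) = x * y + x * z"
  and mult_diff_right: "x * (y - z) = x * y - x * z"
  and mult_scale_right [simp]: "x * (c *s y) = c *s (x * y)"
  and mult_zero_right [simp]: "x * 0 = 0"
  and mult_minus_right [simp]: "x * (- y) = - (x * y)"
  and mult_sum_right: "x * sum f F = (\<Sum>i\<in>F. x * f i)"
  using linear_mult_right[of x, THEN Vector_Spaces.linear.axioms(3)]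
  by (simp_all add: module_hom.add module_hom.diff module_hom.scale module_hom.zero
      module_hom.neg module_hom.sum)

lemma mult_add_left: "(x + y) * z = x * z + y * z"
  and mult_diff_left: "(x - y) * z = x * z - y * z"
  and mult_scale_left [simp]: "(c *s x) * z = c *s (x * z)"
  and mult_zero_left [simp]: "0 * z = 0"
proof -
  note hom = linear_mult_left[of z, THEN Vector_Spaces.linear.axioms(3)]
  show "(x + y) * z = x * z + y * z" "(x - y) * z = x * z - y * z" "(c *s x) * z = c *s (x * z)" "0 * z = 0"
    using module_hom.add[OF hom] module_hom.diff[OF hom] module_hom.scale[OF hom] module_hom.zero[OF hom] by auto
qed

lemmas bilin = mult_add_right mult_diff_right mult_add_left mult_diff_left

lemma span_bilinear:
  assumes "x \<in> span G" "y \<in> span H" "subspace W"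
    and "\<And>y. Vector_Spaces.linear scale scale (\<lambda>x. f x y)" "\<And>x. Vector_Spaces.linear scale scale (f x)"
    and base: "\<And>x y. x \<in> G \<Longrightarrow> y \<in> H \<Longrightarrow> f x y \<in> W"
  shows "f x y \<in> W"
proof -
  have "subspace {x. f x y \<in> W}" for y
    using Vector_Spaces.linear.axioms(3)[OF assms(4)] assms(3) by (rule module_hom.subspace_linear_preimage)
  moreover have "subspace {y. f x y \<in> W}" for x
    using Vector_Spaces.linear.axioms(3)[OF assms(5)] assms(3) by (rule module_hom.subspace_linear_preimage)
  ultimately show ?thesis
    using span_minimal[of G "{x. f x y \<in> W}"] span_minimal[of H "{y. f x y \<in> W}" for x] base assms(1,2)
    by blast
qed

lemma span_mult_in:
  assumes "x \<in> span G" "y \<in> span H" "subspace W" "\<And>x y. x \<in> G \<Longrightarrow> y \<in> H \<Longrightarrow> x * y \<in> W"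
  shows "x * y \<in> W"
  using assms span_bilinear[of x G y H W "(*)"] linear_mult_left linear_mult_right by blast

lemma span_mult_zero:
  assumes "x \<in> span G" "y \<in> span H" "\<And>x y. x \<in> G \<Longrightarrow> y \<in> H \<Longrightarrow> x * y = 0"
  shows "x * y = 0"
  using assms span_mult_in[of x G y H "{0}"] by auto

lemma subalgebra_Inter: "\<forall>S\<in>F. subalgebra scale S \<Longrightarrow> subalgebra scale (\<Inter>F)"
  unfolding subalgebra_def by (auto intro: subspace_Inter)

lemma subalgebra_generated: "subalgebra scale (generated_subalgebra scale X)"
  unfolding generated_subalgebra_def by (rule hull_in) (metis subalgebra_Inter)

lemma generated_superset: "X \<subseteq> generated_subalgebra scale X"
  unfolding generated_subalgebra_def by (rule hull_subset)

lemma generated_least: "subalgebra scale S \<Longrightarrow> X \<subseteq> S \<Longrightarrow> generated_subalgebra scale X \<subseteq> S"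
  unfolding generated_subalgebra_def by (rule hull_minimal)

lemma generated_eq_span:
  assumes "\<And>x y. x \<in> X \<Longrightarrow> y \<in> X \<Longrightarrow> x * y \<in> span X"
  shows "generated_subalgebra scale X = span X"
proof (rule antisym)
  show "generated_subalgebra scale X \<subseteq> span X"
    using assms by (intro generated_least) (auto simp: subalgebra_def span_superset intro: span_mult_in)
  show "span X \<subseteq> generated_subalgebra scale X"
    using subalgebra_generated generated_superset by (intro span_minimal) (auto simp: subalgebra_def)
qed

lemma span_eqI:
  assumes "Vector_Spaces.linear scale s f" "Vector_Spaces.linear scale s g" "x \<in> span G" "\<And>x. x \<in> G \<Longrightarrow> f x = g x"
  shows "f x = g x"
  using assms(3) by (induction rule: span_induct_alt)
    (use assms(1,2,4) in \<open>auto simp: linear_iff_module_hom module_hom.zero module_hom.add module_hom.scale\<close>)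

end

section \<open>Primitive axes of type $(\lambda,\delta)$ with $\lambda+\delta=1$\<close>

locale axes_of_type_sum_1 = nonassoc_algebra scale
  for scale :: "'k::field \<Rightarrow> 'a::{ab_group_add,times} \<Rightarrow> 'a" (infixr "*s" 75) +
  fixes l d :: 'k
  assumes two_neq_0: "(2::'k) \<noteq> 0" and l_neq_0: "l \<noteq> 0" and d_neq_0: "d \<noteq> 0"
    and sum_1: "l + d = 1" and l_neq_d: "l \<noteq> d"
begin

lemma swapped: "axes_of_type_sum_1 scale d l"
  using two_neq_0 l_neq_0 d_neq_0 sum_1 l_neq_d
  by unfold_locales (auto simp: add.commute)

lemma d_eq: "d = 1 - l"
  using sum_1 by (simp add: eq_diff_eq add.commute)

lemma l_neq_1: "l \<noteq> 1" and d_neq_1: "d \<noteq> 1"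
  using sum_1 l_neq_0 d_neq_0 by auto

abbreviation axis :: "'a \<Rightarrow> bool" where
  "axis a \<equiv> has_axis_type scale UNIV l d a"

abbreviation odd_part :: "'a \<Rightarrow> 'a set" where
  "odd_part a \<equiv> eigenspace scale UNIV l d a"

definition odd_proj :: "'a \<Rightarrow> 'a \<Rightarrow> 'a" where
  "odd_proj a y = inverse (l - d) *s (a * y - y * a)"

text \<open>The coefficient of \<open>a\<close> in the decomposition of \<open>y\<close> with
  respect to \<open>a\<close>. Removing the odd contribution from \<open>a * y\<close> leaves a
  multiple of \<open>a\<close> when \<open>a\<close> is an axis, and the factor is unique because
  \<open>a\<close> is nonzero.\<close>

definition coord :: "'a \<Rightarrow> 'a \<Rightarrow> 'k" where
  "coord a y = (THE c. a * y - l *s odd_proj a y = c *s a)"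

lemma odd_part_iff: "w \<in> odd_part a \<longleftrightarrow> a * w = l *s w \<and> w * a = d *s w"
  by (simp add: eigenspace_def)

lemma subspace_odd_part: "subspace (odd_part a)"
  by (auto simp: subspace_def odd_part_iff algebra_simps bilin)

lemma linear_odd_proj: "Vector_Spaces.linear scale scale (odd_proj a)"
  unfolding odd_proj_def Vector_Spaces.linear_iff
  by (auto simp: algebra_simps bilin intro!: vector_space_axioms)

lemma odd_proj_eqI: "a * y = u + l *s w \<Longrightarrow> y * a = u + d *s w \<Longrightarrow> odd_proj a y = w"
  using l_neq_d by (simp add: odd_proj_def scale_left_diff_distrib[symmetric])

lemma odd_proj_odd: "w \<in> odd_part a \<Longrightarrow> odd_proj a w = w"
  by (rule odd_proj_eqI[of _ _ 0]) (auto simp: odd_part_iff)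

lemma odd_proj_eq_0_iff: "odd_proj a y = 0 \<longleftrightarrow> a * y = y * a"
  using l_neq_d by (auto simp: odd_proj_def)

text \<open>Since \<open>l \<noteq> d\<close>, the even part is exactly the set of elements
  commuting with \<open>a\<close>, so decomposition and grading turn into equations. Primitivity and
  uniqueness of the decomposition follow from these equations because \<open>l\<close> and
  \<open>d\<close> are distinct and lie outside \<open>{0, 1}\<close>. The right-hand side is the
  form in which images under automorphisms and affine combinations are recognized as axes.\<close>

lemma axis_iff:
  "axis a \<longleftrightarrow> a \<noteq> 0 \<and> a * a = a \<and>
    (\<forall>y. \<exists>c w. w \<in> odd_part a \<and> a * y = c *s a + l *s w \<and> y * a = c *s a + d *s w) \<and>
    (\<forall>y z. a * y = y * a \<longrightarrow> a * z = z * a \<longrightarrow> a * (y * z) = (y * z) * a) \<and>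
    (\<forall>y. \<forall>w\<in>odd_part a. a * y = y * a \<longrightarrow> y * w \<in> odd_part a \<and> w * y \<in> odd_part a) \<and>
    (\<forall>w\<in>odd_part a. \<forall>w'\<in>odd_part a. a * (w * w') = (w * w') * a)"
  (is "_ \<longleftrightarrow> ?nz \<and> ?id \<and> ?dec \<and> ?ee \<and> ?eo \<and> ?oo")
proof -
  have even: "even_part scale UNIV a = {y. a * y = y * a}" if ?id ?dec
  proof -
    have "a * y = y * a" if y: "y \<in> even_part scale UNIV a" for y
      using y \<open>?id\<close> by (auto simp: even_part_def null_part_def set_plus_def span_singleton bilin)
    moreover have "y \<in> even_part scale UNIV a" if y: "a * y = y * a" for y
    proof -
      obtain c w where cw: "w \<in> odd_part a" "a * y = c *s a + l *s w" "y * a = c *s a + d *s w"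
        using \<open>?dec\<close> by blast
      then have "w = 0" using y odd_proj_eqI odd_proj_eq_0_iff by blast
      then have "a * (y - c *s a) = 0" "(y - c *s a) * a = 0"
        using cw \<open>?id\<close> by (auto simp: bilin)
      then have "c *s a + (y - c *s a) \<in> even_part scale UNIV a"
        unfolding even_part_def null_part_def
        by (intro set_plus_intro) (auto simp: span_singleton)
      then show ?thesis by simp
    qed
    ultimately show ?thesis by blast
  qed
  have grad: "(let E = even_part scale UNIV a; D = odd_part a
      in E * E \<subseteq> E \<and> E * D \<subseteq> D \<and> D * E \<subseteq> D \<and> D * D \<subseteq> E) \<longleftrightarrow> ?ee \<and> ?eo \<and> ?oo" if ?id ?dec
  proof -
    have sub: "P * Q \<subseteq> R \<longleftrightarrow> (\<forall>x\<in>P. \<forall>y\<in>Q. x * y \<in> R)" for P Q R :: "'a set"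
      by (auto simp: set_times_def)
    show ?thesis unfolding even[OF that] Let_def sub by blast
  qed
  show ?thesis
  proof
    assume ax: "axis a"
    then have id: ?nz ?id by (auto simp: has_axis_type_def)
    have ?dec
    proof
      fix y
      have "\<exists>!t. t \<in> span {a} \<times> null_part UNIV a \<times> odd_part a \<and> y = fst t + fst (snd t) + snd (snd t)"
        using ax by (auto simp: has_axis_type_def)
      then obtain t where t: "t \<in> span {a} \<times> null_part UNIV a \<times> odd_part a"
          "y = fst t + fst (snd t) + snd (snd t)" by blast
      have "fst t \<in> span {a}" using t(1) by auto
      then obtain c where c: "fst t = c *s a" unfolding span_singleton by blast
      show "\<exists>c w. w \<in> odd_part a \<and> a * y = c *s a + l *s w \<and> y * a = c *s a + d *s w"
        using t c id by (intro exI[of _ c] exI[of _ "snd (snd t)"])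
          (auto simp: bilin null_part_def odd_part_iff)
    qed
    then show "?nz \<and> ?id \<and> ?dec \<and> ?ee \<and> ?eo \<and> ?oo"
      using id grad ax by (simp add: has_axis_type_def)
  next
    assume as: "?nz \<and> ?id \<and> ?dec \<and> ?ee \<and> ?eo \<and> ?oo"
    then have id: "a \<noteq> 0" "a * a = a" and dec: ?dec by auto
    \<comment> \<open>A second multiplication by \<open>a\<close> turns \<open>l *s w\<close> into
      \<open>(l * l) *s w\<close>, or \<open>d *s w\<close> into \<open>(d * d) *s w\<close>. As
      \<open>y\<close> is fixed by the multiplication, \<open>w = 0\<close>.\<close>
    have one: "y \<in> span {a}" if "a * y = y \<or> y * a = y" for y
    proof -
      obtain c w where cw: "w \<in> odd_part a" "a * y = c *s a + l *s w" "y * a = c *s a + d *s w"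
        using dec by blast
      show ?thesis using that
      proof
        assume "a * y = y"
        then have "l *s w = (l * l) *s w" using cw id by (metis (no_types, lifting) add_left_cancel mult_add_right mult_scale_right odd_part_iff scale_scale)
        then have "w = 0" using l_neq_0 l_neq_1 by simp
        then show ?thesis using cw \<open>a * y = y\<close> by (auto simp: span_singleton)
      next
        assume "y * a = y"
        then have "d *s w = (d * d) *s w" using cw id by (metis (no_types, lifting) add_left_cancel mult_add_left mult_scale_left odd_part_iff scale_scale)
        then have "w = 0" using d_neq_0 d_neq_1 by simp
        then show ?thesis using cw \<open>y * a = y\<close> by (auto simp: span_singleton)
      qed
    qed
    have uni: "\<exists>!t. t \<in> span {a} \<times> null_part UNIV a \<times> odd_part a \<and> y = fst t + fst (snd t) + snd (snd t)" for y
    proof -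
      obtain c w where cw: "w \<in> odd_part a" "a * y = c *s a + l *s w" "y * a = c *s a + d *s w"
        using dec by blast
      show ?thesis
      proof (rule ex1I[of _ "(c *s a, y - c *s a - w, w)"])
        show "(c *s a, y - c *s a - w, w) \<in> span {a} \<times> null_part UNIV a \<times> odd_part a \<and>
          y = fst (c *s a, y - c *s a - w, w) + fst (snd (c *s a, y - c *s a - w, w)) + snd (snd (c *s a, y - c *s a - w, w))"
          using cw id by (auto simp: span_singleton null_part_def odd_part_iff bilin)
      next
        fix t assume t: "t \<in> span {a} \<times> null_part UNIV a \<times> odd_part a \<and> y = fst t + fst (snd t) + snd (snd t)"
        obtain p q r where [simp]: "t = (p, q, r)" by (cases t)
        have "p \<in> span {a}" using t by auto
        then obtain c' where c': "p = c' *s a" unfolding span_singleton by blast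
        have "a * y = c' *s a + l *s r" "y * a = c' *s a + d *s r"
          using t id c' by (auto simp: bilin null_part_def odd_part_iff)
        then have "r = w" using cw odd_proj_eqI by metis
        then have "p = c *s a" using cw c' \<open>a * y = c' *s a + l *s r\<close> by simp
        then show "t = (c *s a, y - c *s a - w, w)" using t \<open>r = w\<close> by auto
      qed
    qed
    have "{y. a * y = y} = span {a}" "{y. y * a = y} = span {a}"
      using one id by (auto simp: span_singleton)
    then show "axis a"
      using uni grad as l_neq_0 l_neq_1 d_neq_0 d_neq_1 by (simp add: has_axis_type_def)
  qed
qed

lemma axis_nonzero: "axis a \<Longrightarrow> a \<noteq> 0" and axis_idem: "axis a \<Longrightarrow> a * a = a"
  by (auto simp: has_axis_type_def)

lemma axis_mult:
  assumes "axis a"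
  shows "a * y = coord a y *s a + l *s odd_proj a y" (is ?l)
    and "y * a = coord a y *s a + d *s odd_proj a y" (is ?r)
    and "odd_proj a y \<in> odd_part a"
proof -
  obtain c w where cw: "w \<in> odd_part a" "a * y = c *s a + l *s w" "y * a = c *s a + d *s w"
    using assms unfolding axis_iff by blast
  have w: "odd_proj a y = w" using cw odd_proj_eqI by blast
  have "coord a y = c"
    unfolding coord_def w using cw axis_nonzero[OF assms] by auto
  with cw w show ?l ?r "odd_proj a y \<in> odd_part a" by auto
qed

lemma odd_proj_mult:
  assumes "axis a"
  shows "a * odd_proj a y = l *s odd_proj a y" "odd_proj a y * a = d *s odd_proj a y"
  using axis_mult(3)[OF assms] by (auto simp: odd_part_iff)

lemma coord_eqI:
  assumes "axis a" "a * y = c *s a + l *s odd_proj a y"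
  shows "coord a y = c"
  using axis_mult(1)[OF assms(1), of y] assms axis_nonzero[OF assms(1)] by simp

lemma coord_eqI':
  assumes "axis a" "a * y = c *s a + l *s w" "y * a = c *s a + d *s w"
  shows "coord a y = c" "odd_proj a y = w"
  using odd_proj_eqI[OF assms(2,3)] coord_eqI assms by auto

lemma linear_coord: "axis a \<Longrightarrow> Vector_Spaces.linear scale (*) (coord a)"
  unfolding Vector_Spaces.linear_iff
proof (intro conjI allI vector_space_axioms)
  assume a: "axis a"
  show "vector_space ((*) :: 'k \<Rightarrow> 'k \<Rightarrow> 'k)" by unfold_locales (auto simp: algebra_simps)
  fix x y c
  have op: "odd_proj a (x + y) = odd_proj a x + odd_proj a y" "odd_proj a (c *s x) = c *s odd_proj a x"
    using linear_odd_proj[of a] by (auto simp: Vector_Spaces.linear_iff)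
  show "coord a (x + y) = coord a x + coord a y"
    using axis_mult(1)[OF a, of x] axis_mult(1)[OF a, of y]
    by (intro coord_eqI a) (auto simp: op bilin algebra_simps)
  show "coord a (c *s x) = c * coord a x"
    using axis_mult(1)[OF a, of x]
    by (intro coord_eqI a) (auto simp: op bilin algebra_simps)
qed

lemma odd_proj_add: "odd_proj a (x + y) = odd_proj a x + odd_proj a y"
  and odd_proj_diff: "odd_proj a (x - y) = odd_proj a x - odd_proj a y"
  and odd_proj_scale: "odd_proj a (c *s x) = c *s odd_proj a x"
  using linear_odd_proj[of a] by (auto simp: linear_iff_module_hom module_hom.add module_hom.diff module_hom.scale)

lemma coord_add: "axis a \<Longrightarrow> coord a (x + y) = coord a x + coord a y"
  and coord_diff: "axis a \<Longrightarrow> coord a (x - y) = coord a x - coord a y"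
  and coord_scale: "axis a \<Longrightarrow> coord a (c *s x) = c * coord a x"
  and coord_zero: "axis a \<Longrightarrow> coord a 0 = 0"
  using linear_coord[of a]
  by (auto simp: linear_iff_module_hom module_hom.add module_hom.diff module_hom.scale module_hom.zero)

lemma coord_self: "axis a \<Longrightarrow> coord a a = 1" and odd_proj_self: "odd_proj a a = 0"
  by (intro coord_eqI) (auto simp: odd_proj_def axis_idem)

lemma coord_odd: "axis a \<Longrightarrow> w \<in> odd_part a \<Longrightarrow> coord a w = 0"
  by (intro coord_eqI) (auto simp: odd_proj_odd odd_part_iff)

lemma odd_proj_even: "axis a \<Longrightarrow> odd_proj a (y - odd_proj a y) = 0"
  by (simp add: odd_proj_diff odd_proj_odd axis_mult(3))

lemma even_even: "axis a \<Longrightarrow> odd_proj a y = 0 \<Longrightarrow> odd_proj a z = 0 \<Longrightarrow> odd_proj a (y * z) = 0"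
  and even_odd: "axis a \<Longrightarrow> odd_proj a y = 0 \<Longrightarrow> w \<in> odd_part a \<Longrightarrow> y * w \<in> odd_part a"
  and odd_even: "axis a \<Longrightarrow> odd_proj a y = 0 \<Longrightarrow> w \<in> odd_part a \<Longrightarrow> w * y \<in> odd_part a"
  and odd_odd: "axis a \<Longrightarrow> w \<in> odd_part a \<Longrightarrow> w' \<in> odd_part a \<Longrightarrow> odd_proj a (w * w') = 0"
  unfolding odd_proj_eq_0_iff axis_iff by blast+

lemma null_part_iff: 
  assumes "axis a"
  shows "y \<in> null_part UNIV a \<longleftrightarrow> coord a y = 0 \<and> odd_proj a y = 0"
proof
  assume "y \<in> null_part UNIV a"
  then have y: "a * y = 0 *s a + l *s 0" "y * a = 0 *s a + d *s 0" by (auto simp: null_part_def)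
  then show "coord a y = 0 \<and> odd_proj a y = 0"
    using coord_eqI'[OF assms y] by simp
qed (auto simp: null_part_def axis_mult[OF assms])

text \<open>Of the four products of homogeneous components, even times even and odd times odd are
  even and drop out.\<close>

lemma odd_proj_prod:
  assumes "axis a"
  shows "odd_proj a (x * y) = (x - odd_proj a x) * odd_proj a y + odd_proj a x * (y - odd_proj a y)"
proof -
  let ?p = "odd_proj a"
  have "x * y = (x - ?p x) * (y - ?p y) + (x - ?p x) * ?p y + ?p x * (y - ?p y) + ?p x * ?p y"
    by (simp add: bilin)
  moreover have "?p ((x - ?p x) * (y - ?p y)) = 0" "?p (?p x * ?p y) = 0"
    using even_even odd_odd odd_proj_even axis_mult(3) assms by auto
  moreover have "?p ((x - ?p x) * ?p y) = (x - ?p x) * ?p y" "?p (?p x * (y - ?p y)) = ?p x * (y - ?p y)"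
    using even_odd odd_even odd_proj_even axis_mult(3) assms odd_proj_odd by auto
  ultimately show ?thesis by (metis (no_types, lifting) add.right_neutral add.left_neutral odd_proj_add)
qed

section \<open>The involution of an axis and transport along automorphisms\<close>

definition involution :: "'a \<Rightarrow> 'a \<Rightarrow> 'a" where
  "involution a y = y - 2 *s odd_proj a y"

lemma linear_involution: "Vector_Spaces.linear scale scale (involution a)"
  unfolding involution_def using linear_odd_proj[of a]
  by (auto simp: Vector_Spaces.linear_iff algebra_simps)

lemma involution_involution: "axis a \<Longrightarrow> involution a (involution a y) = y"
  by (simp add: involution_def odd_proj_diff odd_proj_scale odd_proj_odd axis_mult(3) algebra_simps flip: scale_left_distrib)

text \<open>For \<open>x = x0 + x1\<close> and \<open>y = y0 + y1\<close>, split into even and odd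
  components, both sides are \<open>(x0 - x1) * (y0 - y1)\<close>. After
  \<open>odd_proj_prod\<close> this is a formal bilinear identity.\<close>

lemma involution_mult: "axis a \<Longrightarrow> involution a (x * y) = involution a x * involution a y"
proof -
  assume a: "axis a"
  have two: "(2::'k) *s z = z + z" for z by (metis one_add_one scale_left_distrib scale_one)
  show ?thesis
    unfolding involution_def odd_proj_prod[OF a] two
    by (simp add: bilin algebra_simps)
qed

lemma automorphism_involution: "axis a \<Longrightarrow> algebra_automorphism scale (involution a)"
  unfolding algebra_automorphism_def
  using linear_involution involution_mult involuntory_imp_bij[of "involution a"] involution_involution
  by blast

lemma axis_automorphism:
  assumes f: "algebra_automorphism scale f" and a: "axis a"
  shows "axis (f a)"
proof -
  have lin: "f (x + y) = f x + f y" "f (c *s x) = c *s f x" "f (x * y) = f x * f y" "f 0 = 0" for x y c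
    using f by (auto simp: algebra_automorphism_def linear_iff_module_hom module_hom.add module_hom.scale module_hom.zero)
  have bij: "bij f" using f by (auto simp: algebra_automorphism_def)
  then have inj: "f x = f y \<longleftrightarrow> x = y" for x y by (auto simp: bij_def inj_def)
  have surj: "\<exists>y'. y = f y'" for y using bij by (metis bij_pointE)
  have odd: "f w \<in> odd_part (f a) \<longleftrightarrow> w \<in> odd_part a" for w
    by (auto simp: odd_part_iff inj simp flip: lin)
  have oddE: "\<exists>w'\<in>odd_part a. w = f w'" if "w \<in> odd_part (f a)" for w
    using that surj[of w] odd by metis
  note ax = a[unfolded axis_iff]
  show ?thesis unfolding axis_iff
  proof (intro conjI allI ballI impI)
    show "f a \<noteq> 0" using axis_nonzero[OF a] lin(4) inj by metis
    show "f a * f a = f a" using axis_idem[OF a] lin(3) by metis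
  next
    fix y
    obtain y' where y: "y = f y'" using surj by blast
    obtain c w where "w \<in> odd_part a" "a * y' = c *s a + l *s w" "y' * a = c *s a + d *s w"
      using ax by blast
    then show "\<exists>c w. w \<in> odd_part (f a) \<and> f a * y = c *s f a + l *s w \<and> y * f a = c *s f a + d *s w"
      by (intro exI[of _ c] exI[of _ "f w"]) (auto simp: y odd simp flip: lin)
  next
    fix y z assume "f a * y = y * f a" "f a * z = z * f a"
    moreover obtain y' z' where "y = f y'" "z = f z'" using surj by blast
    moreover have "a * (y' * z') = y' * z' * a" if "a * y' = y' * a" "a * z' = z' * a"
      using ax that by blast
    ultimately show "f a * (y * z) = y * z * f a" by (simp add: inj flip: lin(3))
  next
    fix y w assume "f a * y = y * f a" "w \<in> odd_part (f a)"
    moreover obtain y' where "y = f y'" using surj by blast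
    moreover obtain w' where "w' \<in> odd_part a" "w = f w'" using oddE calculation by blast
    moreover have "y' * w' \<in> odd_part a \<and> w' * y' \<in> odd_part a" if "a * y' = y' * a" "w' \<in> odd_part a"
      using ax that by blast
    ultimately show "y * w \<in> odd_part (f a)" "w * y \<in> odd_part (f a)"
      by (simp_all add: inj odd flip: lin(3))
  next
    fix y w assume "y \<in> odd_part (f a)" "w \<in> odd_part (f a)"
    then obtain y' w' where "y' \<in> odd_part a" "y = f y'" "w' \<in> odd_part a" "w = f w'" using oddE by metis
    moreover have "a * (y' * w') = y' * w' * a" if "y' \<in> odd_part a" "w' \<in> odd_part a"
      using ax that by blast
    ultimately show "f a * (y * w) = y * w * f a" by (simp add: inj flip: lin(3))
  qed
qed

section \<open>Pairs of axes of equal and of opposite type\<close>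

abbreviation axis' :: "'a \<Rightarrow> bool" where
  "axis' b \<equiv> has_axis_type scale UNIV d l b"

abbreviation odd_part' :: "'a \<Rightarrow> 'a set" where
  "odd_part' b \<equiv> eigenspace scale UNIV d l b"

text \<open>Decomposing \<open>a * b\<close> and \<open>b * a\<close> with respect to
  \<open>a\<close> and with respect to \<open>b\<close> gives four equations. Eliminating the two
  odd components leaves the linear system \<open>E1\<close>, \<open>E2\<close> for the two products,
  with determinant \<open>l * l - d * d = l - d\<close>. Hence both products are combinations of
  \<open>a\<close> and \<open>b\<close>, and the eigenvalue equations of the odd component leave
  only two possibilities for the coefficients.\<close>

lemma same_type_cases:
  assumes a: "axis a" and b: "axis b"
  obtains (unlinked) "a * b = 0" "b * a = 0" "coord a b = 0" "odd_proj a b = 0"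
  | (linked) "a * b = d *s a + l *s b" "b * a = l *s a + d *s b" "coord a b = 1" "odd_proj a b = b - a"
proof -
  have key: "a * b = (d * coord a b) *s a + (l * coord b a) *s b \<and>
      b * a = (l * coord a b) *s a + (d * coord b a) *s b \<and>
      odd_proj a b = coord b a *s b - coord a b *s a \<and>
      (coord b a = 1 \<or> a * b = 0 \<and> b * a = 0)" if a: "axis a" and b: "axis b" for a b
  proof -
    have "l * l - d * d = (l - d) * (l + d)" by (simp add: algebra_simps)
    then have sq: "l * l - d * d = l - d" by (simp add: sum_1)
    define p q w v where defs: "p = coord a b" "q = coord b a" "w = odd_proj a b" "v = odd_proj b a"
    have e: "a * b = p *s a + l *s w" "b * a = p *s a + d *s w"
        "b * a = q *s b + l *s v" "a * b = q *s b + d *s v"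
      unfolding defs by (rule axis_mult[OF a] axis_mult[OF b])+
    have E1: "d *s (a * b) - l *s (b * a) = (d - l) *s p *s a"
      unfolding e(1,2) by (simp add: algebra_simps)
    have E2: "l *s (a * b) - d *s (b * a) = (l - d) *s q *s b"
      unfolding e(3,4) by (simp add: algebra_simps)
    have "(l - d) *s (a * b) = l *s (l *s (a * b) - d *s (b * a)) - d *s (d *s (a * b) - l *s (b * a))"
      unfolding sq[symmetric] by (simp add: algebra_simps)
    also have "\<dots> = (l - d) *s ((d * p) *s a + (l * q) *s b)"
      unfolding E1 E2 by (simp add: algebra_simps)
    finally have ab: "a * b = (d * p) *s a + (l * q) *s b" using l_neq_d by simp
    have "(l - d) *s (b * a) = d *s (l *s (a * b) - d *s (b * a)) - l *s (d *s (a * b) - l *s (b * a))"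
      unfolding sq[symmetric] by (simp add: algebra_simps)
    also have "\<dots> = (l - d) *s ((l * p) *s a + (d * q) *s b)"
      unfolding E1 E2 by (simp add: algebra_simps)
    finally have ba: "b * a = (l * p) *s a + (d * q) *s b" using l_neq_d by simp
    have "(l - d) *s w = a * b - b * a" unfolding e(1,2) by (simp add: algebra_simps)
    also have "\<dots> = (l - d) *s (q *s b - p *s a)" unfolding ab ba by (simp add: algebra_simps)
    finally have w: "w = q *s b - p *s a" using l_neq_d by simp
    have "a * w = l *s w" "w * a = d *s w" unfolding defs by (rule odd_proj_mult[OF a])+
    then have "(q - 1) *s (a * b) = 0" "(q - 1) *s (b * a) = 0"
      unfolding w mult_diff_left mult_diff_right mult_scale_left mult_scale_right axis_idem[OF a] ab ba
      by (simp_all add: d_eq algebra_simps)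
    then show ?thesis using ab ba w unfolding defs by auto
  qed
  show thesis
  proof (cases "a * b = 0 \<and> b * a = 0")
    case True
    then show thesis using coord_eqI'[OF a, of b 0 0] unlinked by auto
  next
    case False
    then have "coord a b = 1" "coord b a = 1" using key[OF a b] key[OF b a] by blast+
    moreover from this have "a * b = d *s a + l *s b" "b * a = l *s a + d *s b" "odd_proj a b = b - a"
      using key[OF a b] by simp_all
    ultimately show thesis by (intro linked)
  qed
qed

lemma same_type_mult_eq_0: "axis a \<Longrightarrow> axis b \<Longrightarrow> a * b = 0 \<Longrightarrow> b * a = 0"
proof (rule same_type_cases[of a b])
  assume a: "axis a" and b: "axis b" and z: "a * b = 0"
    and ab: "a * b = d *s a + l *s b" "coord a b = 1"
  have "coord a (d *s a + l *s b) = 0" unfolding ab(1)[symmetric] z by (rule coord_zero[OF a])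
  then have "d + l = 0" using ab(2) by (simp add: coord_add coord_scale a coord_self)
  then show ?thesis using sum_1 by (simp add: add.commute)
qed

lemma linked_sym: "axis a \<Longrightarrow> axis b \<Longrightarrow> a * b = 0 \<longleftrightarrow> b * a = 0"
  using same_type_mult_eq_0 by blast

lemma same_type_unlinked:
  assumes "axis a" "axis b" "a * b = 0"
  shows "b * a = 0" "coord a b = 0" "odd_proj a b = 0"
  using same_type_cases[OF assms(1,2)] assms linked_sym coord_eqI'[OF assms(1), of b 0 0] by fastforce+

lemma same_type_linked:
  assumes "axis a" "axis b" "a * b \<noteq> 0"
  shows "a * b = d *s a + l *s b" "b * a = l *s a + d *s b" "coord a b = 1" "odd_proj a b = b - a"
  using same_type_cases[OF assms(1,2)] assms by metis+

lemma linked_self: "axis a \<Longrightarrow> a * a \<noteq> 0"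
  by (simp add: axis_idem axis_nonzero)

lemma linked_diff_odd: "axis a \<Longrightarrow> axis b \<Longrightarrow> a * b \<noteq> 0 \<Longrightarrow> b - a \<in> odd_part a"
  using axis_mult(3)[of a b] same_type_linked(4)[of a b] by simp

text \<open>If \<open>a * c = 0\<close>, then \<open>c\<close> is even for \<open>a\<close>, so
  \<open>b * c = (b - a) * c\<close> is odd and has coordinate 0. But
  \<open>b * c = d *s b + l *s c\<close> has coordinate \<open>d\<close>, because
  \<open>coord a b = 1\<close> and \<open>coord a c = 0\<close>.\<close>

lemma linked_trans:
  assumes "axis a" "axis b" "axis c" "a * b \<noteq> 0" "b * c \<noteq> 0"
  shows "a * c \<noteq> 0"
proof
  assume ac: "a * c = 0"
  note c = same_type_unlinked[OF assms(1,3) ac]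
  have "coord a (b * c) = 0"
  proof -
    have "b * c = (b - a) * c" using ac by (simp add: bilin)
    also have "\<dots> \<in> odd_part a"
      using assms c by (intro odd_even linked_diff_odd)
    finally show ?thesis using coord_odd assms(1) by blast
  qed
  moreover have "coord a (b * c) = d"
    using same_type_linked[OF assms(2,3,5)] same_type_linked[OF assms(1,2,4)] c(2)
    by (simp add: coord_add coord_scale assms(1))
  ultimately show False using d_neq_0 by simp
qed

lemma linked_odd_part_diff:
  assumes "axis a" "axis b" "axis c" "a * b \<noteq> 0" "a * c \<noteq> 0"
  shows "b - c \<in> odd_part a"
  using subspace_diff[OF subspace_odd_part linked_diff_odd[OF assms(1,2,4)] linked_diff_odd[OF assms(1,3,5)]]
  by simp

text \<open>The combination \<open>d *s (a * b) - l *s (b * a)\<close> eliminates the odd component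
  for \<open>a\<close> and, since the scalars are exchanged, also the one for \<open>b\<close>. This
  gives \<open>p *s a = q *s b\<close> for the two coordinates. If \<open>p\<close> were nonzero,
  \<open>a\<close> and \<open>b\<close> would be proportional idempotents and hence equal.\<close>

lemma mixed_mult:
  assumes a: "axis a" and b: "axis' b" and "a \<noteq> b"
  shows "coord a b = 0" "a * b = l *s odd_proj a b" "b * a = d *s odd_proj a b"
proof -
  interpret sw: axes_of_type_sum_1 scale d l by (rule swapped)
  define p q w v where defs: "p = coord a b" "q = sw.coord b a" "w = odd_proj a b" "v = sw.odd_proj b a"
  have e: "a * b = p *s a + l *s w" "b * a = p *s a + d *s w"
      "b * a = q *s b + d *s v" "a * b = q *s b + l *s v"
    unfolding defs by (rule axis_mult[OF a] sw.axis_mult[OF b])+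
  have "(d - l) *s p *s a = d *s (a * b) - l *s (b * a)"
    unfolding e(1,2) by (simp add: algebra_simps)
  also have "\<dots> = (d - l) *s q *s b" unfolding e(3,4) by (simp add: algebra_simps)
  finally have pq: "p *s a = q *s b" using l_neq_d by (metis right_minus_eq scale_left_imp_eq)
  have "p = 0"
  proof (rule ccontr)
    assume "p \<noteq> 0"
    define c where "c = inverse p * q"
    have "a = inverse p *s p *s a" using \<open>p \<noteq> 0\<close> by simp
    then have ac: "a = c *s b" unfolding pq c_def by simp
    then have "c \<noteq> 0" using axis_nonzero[OF a] by auto
    moreover have "(c * c) *s b = c *s b" using axis_idem[OF a] sw.axis_idem[OF b] unfolding ac by simp
    ultimately have "c = 1" using sw.axis_nonzero[OF b] by simp
    then show False using ac assms(3) by simp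
  qed
  then show "coord a b = 0" "a * b = l *s odd_proj a b" "b * a = d *s odd_proj a b"
    using e defs by auto
qed

lemma mixed_comm:
  assumes "axis a" "axis' b" "a \<noteq> b"
  shows "d *s (a * b) = l *s (b * a)" "a * b = 0 \<longleftrightarrow> b * a = 0"
  using mixed_mult[OF assms] l_neq_0 d_neq_0 by (auto simp: mult.commute)

text \<open>Exchanging the factors reverses the sign of the commutator, exchanging the scalars that
  of \<open>l - d\<close>. As a result the reflection of \<open>a\<close> in \<open>b\<close> is
  expressed by the projection belonging to \<open>a\<close>.\<close>

lemma odd_proj_swap: "axes_of_type_sum_1.odd_proj scale d l b a = odd_proj a b"
proof -
  interpret sw: axes_of_type_sum_1 scale d l by (rule swapped)
  have "inverse (d - l) = - inverse (l - d)" by (metis inverse_minus_eq minus_diff_eq)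
  then show ?thesis unfolding odd_proj_def sw.odd_proj_def
    by (simp add: scale_minus_right[symmetric] del: scale_minus_right)
qed

text \<open>The reflected element is an axis as the image of \<open>a\<close> under the automorphism
  attached to \<open>b\<close>. If it were not linked to \<open>a\<close>, then
  \<open>a = (2 * l) *s odd_proj a b\<close> would be odd for itself, contradicting
  \<open>coord a a = 1\<close>.\<close>

lemma linked_reflection:
  assumes a: "axis a" and b: "axis' b" and ab: "a \<noteq> b"
  shows "axis (a - 2 *s odd_proj a b)" "a * (a - 2 *s odd_proj a b) \<noteq> 0"
proof -
  interpret sw: axes_of_type_sum_1 scale d l by (rule swapped)
  have "axis (sw.involution b a)"
    using sw.automorphism_involution[OF b] axis_automorphism a by blast
  then show "axis (a - 2 *s odd_proj a b)"
    by (simp add: sw.involution_def odd_proj_swap)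
  show "a * (a - 2 *s odd_proj a b) \<noteq> 0"
  proof
    assume "a * (a - 2 *s odd_proj a b) = 0"
    then have "a = (2 * l) *s odd_proj a b"
      using mixed_mult[OF assms] odd_proj_mult[OF a, of b] axis_idem[OF a] by (simp add: bilin)
    then have "a \<in> odd_part a" using subspace_scale[OF subspace_odd_part axis_mult(3)[OF a, of b]] by metis
    then show False using coord_odd[OF a] coord_self[OF a] by simp
  qed
qed

text \<open>\<open>odd_proj a b\<close> is half the difference of \<open>a\<close> and its
  reflection \<open>c\<close>, two linked axes. By transitivity \<open>a'\<close> is linked to both
  or to neither: in the first case the difference is odd for \<open>a'\<close>, in the second it is
  annihilated.\<close>

lemma mixed_proj_linked:
  assumes a: "axis a" and a': "axis a'" and b: "axis' b" and "a \<noteq> b"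
  shows "a * a' \<noteq> 0 \<Longrightarrow> odd_proj a b \<in> odd_part a'"
    and "a * a' = 0 \<Longrightarrow> odd_proj a b \<in> null_part UNIV a'"
proof -
  define c where "c = a - 2 *s odd_proj a b"
  note c = linked_reflection[OF a b \<open>a \<noteq> b\<close>, folded c_def]
  have m: "odd_proj a b = inverse 2 *s (a - c)" using two_neq_0 by (simp add: c_def)
  show "odd_proj a b \<in> odd_part a'" if "a * a' \<noteq> 0"
  proof -
    have "a' * a \<noteq> 0" using that linked_sym a a' by blast
    moreover have "a' * c \<noteq> 0" using linked_trans[OF a' a c(1)] c(2) calculation by blast
    ultimately show ?thesis unfolding m
      using linked_odd_part_diff[OF a' a c(1)] subspace_scale[OF subspace_odd_part] by blast
  qed
  show "odd_proj a b \<in> null_part UNIV a'" if "a * a' = 0"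
  proof -
    have "a' * c = 0"
      using linked_trans[OF a' c(1) a] linked_sym[OF a a'] linked_sym[OF a c(1)] that c(2) by blast
    then show ?thesis unfolding m
      using same_type_unlinked[OF a' c(1)] linked_sym[OF a a'] that by (simp add: null_part_def bilin)
  qed
qed

lemma mixed_prod_linked:
  assumes "axis a" "axis a'" "axis' b" "a \<noteq> b"
  shows "a * a' \<noteq> 0 \<Longrightarrow> a * b \<in> odd_part a' \<and> b * a \<in> odd_part a'"
    and "a * a' = 0 \<Longrightarrow> a * b \<in> null_part UNIV a' \<and> b * a \<in> null_part UNIV a'"
  using mixed_proj_linked[OF assms] mixed_mult[OF assms(1,3,4)] subspace_scale[OF subspace_odd_part]
  by (auto simp: null_part_def)

end

section \<open>The span of the mixed products\<close>

locale mixed_axes = axes_of_type_sum_1 scale l d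
  for scale :: "'k::field \<Rightarrow> 'a::{ab_group_add,times} \<Rightarrow> 'a" (infixr "*s" 75) and l d +
  fixes X Y :: "'a set"
  assumes X_axis: "x \<in> X \<Longrightarrow> axis x" and Y_axis: "y \<in> Y \<Longrightarrow> axis' y" and disjoint: "X \<inter> Y = {}"
begin

definition prods :: "'a set" where
  "prods = {x * y | x y. x \<in> X \<and> y \<in> Y}"

definition mixed :: "'a set" where
  "mixed = span prods"

lemma X_neq_Y: "x \<in> X \<Longrightarrow> y \<in> Y \<Longrightarrow> x \<noteq> y"
  using disjoint by auto

lemma swapped_axes: "mixed_axes scale d l Y X"
  using swapped X_axis Y_axis disjoint by (auto simp: mixed_axes_def mixed_axes_axioms_def)

lemma subspace_mixed [simp]: "subspace mixed"
  by (simp add: mixed_def)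

lemma prods_mixed: "p \<in> prods \<Longrightarrow> p \<in> mixed"
  by (simp add: mixed_def span_base)

lemma prod_in_mixed: "x \<in> X \<Longrightarrow> y \<in> Y \<Longrightarrow> x * y \<in> mixed"
  by (rule prods_mixed) (auto simp: prods_def)

lemma Y_times_X: "x \<in> X \<Longrightarrow> y \<in> Y \<Longrightarrow> y * x = (d / l) *s (x * y)"
  using mixed_mult[OF X_axis Y_axis X_neq_Y] l_neq_0 by simp

lemma prod_in_mixed': "x \<in> X \<Longrightarrow> y \<in> Y \<Longrightarrow> y * x \<in> mixed"
  by (simp add: Y_times_X subspace_scale prod_in_mixed)

lemma mixed_swap: "mixed_axes.mixed scale Y X = mixed"
proof -
  interpret sw: mixed_axes scale d l Y X by (rule swapped_axes)
  have "sw.prods \<subseteq> mixed" by (auto simp: sw.prods_def prod_in_mixed')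
  moreover have "prods \<subseteq> sw.mixed" by (auto simp: prods_def sw.prod_in_mixed')
  ultimately show ?thesis
    unfolding mixed_def sw.mixed_def by (metis span_minimal subspace_span antisym)
qed

text \<open>Every axis of type \<open>(l, d)\<close>, whether or not in \<open>X\<close>, acts
  diagonally on the generators of \<open>mixed\<close>, and the eigenvalues on \<open>x * y\<close>
  depend only on whether the axis is linked to \<open>x\<close>.\<close>

lemma axis_prods:
  assumes a: "axis a" and "x \<in> X" "y \<in> Y"
  shows "coord a (x * y) = 0" and "odd_proj a (x * y) = (if a * x = 0 then 0 else x * y)"
proof -
  note xy = X_axis[OF assms(2)] a Y_axis[OF assms(3)] X_neq_Y[OF assms(2,3)]
  have "x * a = 0 \<longleftrightarrow> a * x = 0" using linked_sym[OF a X_axis[OF assms(2)]] by simp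
  then have "coord a (x * y) = 0 \<and> odd_proj a (x * y) = (if a * x = 0 then 0 else x * y)"
    using mixed_prod_linked[OF xy] null_part_iff[OF a] coord_odd[OF a] odd_proj_odd by auto
  then show "coord a (x * y) = 0" "odd_proj a (x * y) = (if a * x = 0 then 0 else x * y)" by auto
qed

lemma coord_mixed:
  assumes "axis a" "z \<in> mixed"
  shows "coord a z = 0"
  using assms(2)[unfolded mixed_def] assms(1)
  by (induction rule: span_induct_alt) (auto simp: prods_def coord_zero coord_add coord_scale axis_prods)

lemma odd_proj_mixed: "axis a \<Longrightarrow> z \<in> mixed \<Longrightarrow> odd_proj a z \<in> mixed"
  using span_minimal[of prods "{z. odd_proj a z \<in> mixed}"]
    module_hom.subspace_linear_preimage[OF linear_odd_proj[of a, THEN Vector_Spaces.linear.axioms(3)] subspace_mixed]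
    prod_in_mixed subspace_0[OF subspace_mixed]
  unfolding mixed_def[symmetric] by (force simp: axis_prods prods_def)

lemma axis_mult_mixed:
  assumes "axis a" "z \<in> mixed"
  shows "a * z = l *s odd_proj a z" "z * a = d *s odd_proj a z" "a * z \<in> mixed" "z * a \<in> mixed"
  using axis_mult(1,2)[OF assms(1), of z] coord_mixed[OF assms] odd_proj_mixed[OF assms]
  by (auto simp: subspace_scale)

text \<open>Linked axes \<open>a\<close> and \<open>b\<close> are linked to the same members of
  \<open>X\<close>, so \<open>axis_prods\<close> gives them the same eigenvalues on every
  generator.\<close>

lemma linked_mult_mixed:
  assumes "axis a" "axis b" "a * b \<noteq> 0" "z \<in> mixed"
  shows "odd_proj a z = odd_proj b z" "a * z = b * z" "z * a = z * b"
proof -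
  have *: "a * x = 0 \<longleftrightarrow> b * x = 0" if "x \<in> X" for x
    using linked_trans[of a b x] linked_trans[of b a x] linked_sym[of a b] assms X_axis[OF that] by blast
  show "odd_proj a z = odd_proj b z"
    using assms(4) unfolding mixed_def
    by (rule span_eqI[OF linear_odd_proj linear_odd_proj]) (auto simp: prods_def axis_prods assms *)
  then show "a * z = b * z" "z * a = z * b" using axis_mult_mixed assms by auto
qed

text \<open>An axis \<open>x\<close> and its reflection \<open>x - 2 *s m\<close> in
  \<open>y\<close> are linked and hence act identically on \<open>z'\<close>. Therefore
  \<open>2 *s m\<close> annihilates \<open>z'\<close>, and in characteristic other than 2 so does
  \<open>x * y = l *s m\<close>.\<close>

lemma mixed_mult_mixed:
  assumes "z \<in> mixed" "z' \<in> mixed"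
  shows "z * z' = 0"
proof -
  have "(x * y) * z' = 0" if xy: "x \<in> X" "y \<in> Y" for x y
  proof -
    note ax = X_axis[OF xy(1)] Y_axis[OF xy(2)] X_neq_Y[OF xy]
    define m where "m = odd_proj x y"
    have "x * z' = (x - 2 *s m) * z'"
      using linked_mult_mixed(2)[OF ax(1) linked_reflection[OF ax] assms(2)] by (simp add: m_def)
    then have "m * z' = 0" using two_neq_0 by (simp add: bilin)
    then show ?thesis using mixed_mult(2)[OF ax] by (simp add: m_def)
  qed
  with assms(1)[unfolded mixed_def] show ?thesis
    by (induction rule: span_induct_alt) (auto simp: prods_def bilin)
qed

lemma X_mult_X: "x \<in> X \<Longrightarrow> x' \<in> X \<Longrightarrow> x * x' \<in> span X"
  using same_type_cases[OF X_axis X_axis, of x x'] span_zero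
  by (metis span_add span_base span_scale)

lemma Y_mult_Y: "y \<in> Y \<Longrightarrow> y' \<in> Y \<Longrightarrow> y * y' \<in> span Y"
proof -
  interpret sw: mixed_axes scale d l Y X by (rule swapped_axes)
  show "y \<in> Y \<Longrightarrow> y' \<in> Y \<Longrightarrow> y * y' \<in> span Y" by (rule sw.X_mult_X)
qed

lemma generated_X: "generated_subalgebra scale X = span X"
  by (rule generated_eq_span) (rule X_mult_X)

lemma Y_mult_mixed: "y \<in> Y \<Longrightarrow> z \<in> mixed \<Longrightarrow> y * z \<in> mixed" "y \<in> Y \<Longrightarrow> z \<in> mixed \<Longrightarrow> z * y \<in> mixed"
proof -
  interpret sw: mixed_axes scale d l Y X by (rule swapped_axes)
  show "y \<in> Y \<Longrightarrow> z \<in> mixed \<Longrightarrow> y * z \<in> mixed" "y \<in> Y \<Longrightarrow> z \<in> mixed \<Longrightarrow> z * y \<in> mixed"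
    using sw.axis_mult_mixed[OF Y_axis] by (auto simp: mixed_swap)
qed

text \<open>The span of \<open>Y \<union> prods\<close> is an ideal of the algebra generated by \<open>X \<union> Y\<close>.\<close>

lemma X_mult_rest: "x \<in> X \<Longrightarrow> u \<in> Y \<union> prods \<Longrightarrow> x * u \<in> mixed \<and> u * x \<in> mixed"
  using prod_in_mixed prod_in_mixed' axis_mult_mixed[OF X_axis] prods_mixed by blast

lemma span_Y_prods: "span Y \<subseteq> span (Y \<union> prods)" "mixed \<subseteq> span (Y \<union> prods)"
  unfolding mixed_def by (auto intro!: span_mono)

lemma rest_mult_rest: "u \<in> Y \<union> prods \<Longrightarrow> v \<in> Y \<union> prods \<Longrightarrow> u * v \<in> span (Y \<union> prods)"
  using Y_mult_Y Y_mult_mixed prods_mixed mixed_mult_mixed span_Y_prods span_zero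
  by (metis Un_iff subsetD)

lemma generated_eq: "generated_subalgebra scale (X \<union> Y) = span (X \<union> Y \<union> prods)"
proof (rule antisym)
  let ?S = "span (X \<union> Y \<union> prods)"
  have sub: "span X \<subseteq> ?S" "mixed \<subseteq> ?S" "span (Y \<union> prods) \<subseteq> ?S"
    unfolding mixed_def by (auto intro!: span_mono)
  have "u * v \<in> ?S" if "u \<in> X \<union> Y \<union> prods" "v \<in> X \<union> Y \<union> prods" for u v
    using that X_mult_X[of u v] X_mult_rest[of u v] X_mult_rest[of v u] rest_mult_rest[of u v] sub by blast
  then have "subalgebra scale ?S"
    unfolding subalgebra_def using span_mult_in by (metis subspace_span)
  then show "generated_subalgebra scale (X \<union> Y) \<subseteq> ?S"
    by (rule generated_least) (auto simp: span_base)
  show "?S \<subseteq> generated_subalgebra scale (X \<union> Y)"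
    using subalgebra_generated[of "X \<union> Y"] generated_superset[of "X \<union> Y"]
    by (intro span_minimal) (auto simp: subalgebra_def prods_def)
qed

end

section \<open>The algebra generated by axes of both types\<close>

locale generating_axes = mixed_axes scale l d X Y
  for scale :: "'k::field \<Rightarrow> 'a::{ab_group_add,times} \<Rightarrow> 'a" (infixr "*s" 75) and l d X Y +
  assumes generating: "generated_subalgebra scale (X \<union> Y) = UNIV"
begin

lemma swapped_generating: "generating_axes scale d l Y X"
  using swapped_axes generating by (simp add: generating_axes_def generating_axes_axioms_def Un_commute)

lemma span_UNIV: "span (X \<union> Y \<union> prods) = UNIV"
  using generating generated_eq by simp

lemma UNIV_eq: "UNIV = span X + span Y + mixed"
  using span_UNIV unfolding span_Un mixed_def set_plus_def by blast

lemma mixed_ideal: "z \<in> mixed \<Longrightarrow> v * z \<in> mixed \<and> z * v \<in> mixed"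
proof -
  assume z: "z \<in> mixed"
  have "v \<in> span (X \<union> Y \<union> prods)" using span_UNIV by simp
  moreover have "g * z \<in> mixed \<and> z * g \<in> mixed" if "g \<in> X \<union> Y \<union> prods" for g
    using that z axis_mult_mixed[OF X_axis] Y_mult_mixed mixed_mult_mixed prods_mixed subspace_0[OF subspace_mixed]
    by auto
  ultimately show ?thesis
    by (induction rule: span_induct_alt)
      (auto simp: bilin intro!: subspace_0[OF subspace_mixed] subspace_add[OF subspace_mixed] subspace_scale[OF subspace_mixed])
qed

text \<open>\<open>Y\<close> and \<open>prods\<close> share one case because for every
  \<open>r\<close> in \<open>X\<close> the coordinate \<open>coord r\<close> vanishes on their span
  and the map \<open>comp r\<close> defined next sends it into \<open>mixed\<close>.\<close>

lemma generators_induct [case_names X rest]: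
  assumes "\<And>g. g \<in> X \<Longrightarrow> P g" "\<And>g. g \<in> Y \<union> prods \<Longrightarrow> P g"
    and "P 0" "\<And>u v. P u \<Longrightarrow> P v \<Longrightarrow> P (u + v)" "\<And>c u. P u \<Longrightarrow> P (c *s u)"
  shows "P v"
proof -
  have "v \<in> span (X \<union> Y \<union> prods)" using span_UNIV by simp
  then show ?thesis by (induction rule: span_induct_alt) (use assms in blast)+
qed

text \<open>\<open>comp r v\<close> is, modulo \<open>mixed\<close>, the component of \<open>v\<close> in the factor of \<open>span X\<close> that contains \<open>r\<close>.\<close>

definition comp :: "'a \<Rightarrow> 'a \<Rightarrow> 'a" where
  "comp r v = inverse l *s (r * v - (d * coord r v) *s r)"

context
  fixes r assumes r: "r \<in> X"
begin

lemma linear_comp: "Vector_Spaces.linear scale scale (comp r)"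
  unfolding comp_def Vector_Spaces.linear_iff using X_axis[OF r]
  by (auto simp: bilin coord_add coord_scale algebra_simps intro!: vector_space_axioms)

lemma comp_add: "comp r (u + v) = comp r u + comp r v"
  and comp_scale: "comp r (c *s v) = c *s comp r v"
  and comp_zero: "comp r 0 = 0"
  using linear_comp by (auto simp: Vector_Spaces.linear_iff_module_hom module_hom.add module_hom.scale module_hom.zero module_hom.diff)

lemma mult_eq_comp: "r * v = (d * coord r v) *s r + l *s comp r v"
  using l_neq_0 by (simp add: comp_def)

lemma coord_comp: "coord r (comp r v) = coord r v"
proof -
  have "coord r (r * v) = coord r v"
    using axis_mult(1)[OF X_axis[OF r], of v] axis_mult(3)[OF X_axis[OF r], of v] X_axis[OF r]
    by (simp add: coord_add coord_scale coord_self coord_odd)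
  then have "coord r (comp r v) = inverse l * ((1 - d) * coord r v)"
    unfolding comp_def using X_axis[OF r] by (simp add: coord_diff coord_scale coord_self algebra_simps)
  also have "1 - d = l" by (simp add: d_eq)
  finally show ?thesis using l_neq_0 by simp
qed

text \<open>The formula for \<open>comp\<close> originates here: it is
  \<open>r * x = d *s r + l *s x\<close> solved for \<open>x\<close>, where
  \<open>coord r x = 1\<close>.\<close>

lemma comp_linked: "x \<in> X \<Longrightarrow> r * x \<noteq> 0 \<Longrightarrow> comp r x = x"
proof -
  assume "x \<in> X" "r * x \<noteq> 0"
  note e = same_type_linked(1,3)[OF X_axis[OF r] X_axis[OF this(1)] this(2)]
  show "comp r x = x" unfolding comp_def e using l_neq_0 by simp
qed

lemma comp_unlinked: "x \<in> X \<Longrightarrow> r * x = 0 \<Longrightarrow> comp r x = 0"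
  using same_type_unlinked[OF X_axis[OF r] X_axis] by (simp add: comp_def)

lemma coord_X: "x \<in> X \<Longrightarrow> coord r x = (if r * x = 0 then 0 else 1)"
  using same_type_unlinked(2)[OF X_axis[OF r] X_axis] same_type_linked(3)[OF X_axis[OF r] X_axis] by simp

lemma comp_X: "x \<in> X \<Longrightarrow> comp r x = (if r * x = 0 then 0 else x)"
  using comp_linked comp_unlinked by simp

lemma coord_rest: "u \<in> span (Y \<union> prods) \<Longrightarrow> coord r u = 0"
proof (induction rule: span_induct_alt)
  case (step c g v)
  have "coord r g = 0"
    using step(1) coord_mixed[OF X_axis[OF r]] mixed_mult(1)[OF X_axis[OF r] Y_axis X_neq_Y[OF r]] prods_mixed
    by auto
  then show ?case using step by (simp add: coord_add coord_scale X_axis[OF r])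
qed (simp add: coord_zero X_axis[OF r])

lemma comp_rest: "u \<in> span (Y \<union> prods) \<Longrightarrow> comp r u \<in> mixed"
proof (induction rule: span_induct_alt)
  case (step c g v)
  have "comp r g \<in> mixed"
    using step(1) X_mult_rest[OF r] coord_rest[of g] span_base[of g "Y \<union> prods"]
    by (auto simp: comp_def subspace_scale)
  then show ?case using step by (simp add: comp_add comp_scale subspace_add subspace_scale)
qed (simp add: comp_zero subspace_0)

lemma mult_rest: "u \<in> Y \<union> prods \<Longrightarrow> v * u \<in> span (Y \<union> prods) \<and> u * v \<in> span (Y \<union> prods)"
proof (induction v rule: generators_induct)
  case (X g)
  then show ?case using X_mult_rest span_Y_prods by blast
next
  case (rest g)
  then show ?case using rest_mult_rest by blast
qed (auto simp: bilin span_zero span_add span_scale)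

text \<open>This is the product \<open>e * f = d *s e + l *s f\<close> of a copy of
  \<open>U\<close>, extended bilinearly, with \<open>coord r\<close> as the sum of the coefficients.
  Because linking is an equivalence relation, both sides vanish unless \<open>v\<close> and
  \<open>w\<close> are both linked to \<open>r\<close>, and in that case they are linked to each
  other.\<close>

lemma comp_mult_X:
  assumes "v \<in> X" "w \<in> X"
  shows "comp r (v * w) = (d * coord r w) *s comp r v + (l * coord r v) *s comp r w"
    and "coord r (v * w) = coord r v * coord r w"
proof -
  note ax = X_axis[OF r] X_axis[OF assms(1)] X_axis[OF assms(2)]
  have vw: "v * w = 0 \<or> v * w \<noteq> 0 \<and> v * w = d *s v + l *s w"
    using same_type_cases[OF ax(2,3)] by metis
  have "r * v \<noteq> 0 \<longleftrightarrow> r * w \<noteq> 0" if "v * w \<noteq> 0"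
    using that linked_trans[OF ax] linked_trans[OF ax(1) ax(3) ax(2)] linked_sym[OF ax(2,3)] by blast
  moreover have "v * w \<noteq> 0" if "r * v \<noteq> 0" "r * w \<noteq> 0"
    using linked_trans[OF ax(2) ax(1) ax(3)] linked_sym[OF ax(1,2)] that by blast
  moreover have "d + l = 1" using sum_1 by (simp add: add.commute)
  ultimately show "comp r (v * w) = (d * coord r w) *s comp r v + (l * coord r v) *s comp r w"
      "coord r (v * w) = coord r v * coord r w"
    using vw by (auto simp: comp_X coord_X assms comp_add comp_scale comp_zero coord_zero coord_add coord_scale ax)
qed

lemma coord_mult: "coord r (v * w) = coord r v * coord r w"
proof (induction v rule: generators_induct)
  case (X v)
  show ?case
  proof (induction w rule: generators_induct)
    case (X w)
    show ?case by (rule comp_mult_X(2)[OF \<open>v \<in> X\<close> X])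
  next
    case (rest u)
    then show ?case using mult_rest[of u v] coord_rest span_base[of u "Y \<union> prods"] by simp
  qed (auto simp: bilin X_axis[OF r] coord_zero coord_add coord_scale algebra_simps)
next
  case (rest u)
  then show ?case using mult_rest[of u w] coord_rest span_base[of u "Y \<union> prods"] by simp
qed (auto simp: bilin X_axis[OF r] coord_zero coord_add coord_scale algebra_simps)

text \<open>The formula is exact when both factors are in \<open>X\<close>. If one factor comes from
  \<open>Y \<union> prods\<close>, each of the three terms lies in \<open>mixed\<close> by
  itself.\<close>

lemma comp_mult: "comp r (v * w) - ((d * coord r w) *s comp r v + (l * coord r v) *s comp r w) \<in> mixed"
proof -
  have base: "comp r (v * w) - ((d * coord r w) *s comp r v + (l * coord r v) *s comp r w) \<in> mixed"
    if g: "v \<in> X \<union> (Y \<union> prods)" "w \<in> X \<union> (Y \<union> prods)" for v w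
  proof (cases "v \<in> X \<and> w \<in> X")
    case True
    then show ?thesis by (simp add: comp_mult_X subspace_0)
  next
    case False
    then consider "v \<in> Y \<union> prods" | "w \<in> Y \<union> prods" using g by blast
    then have "comp r (v * w) \<in> mixed" "(d * coord r w) *s comp r v \<in> mixed" "(l * coord r v) *s comp r w \<in> mixed"
      by (cases; use mult_rest[of v w] mult_rest[of w v] comp_rest coord_rest span_base[of v "Y \<union> prods"] span_base[of w "Y \<union> prods"] subspace_0[OF subspace_mixed] in \<open>auto simp: subspace_scale\<close>)+
    then show ?thesis by (simp add: subspace_add subspace_diff)
  qed
  show ?thesis
  proof (rule span_bilinear[of v "X \<union> (Y \<union> prods)" w "X \<union> (Y \<union> prods)" mixed
      "\<lambda>v w. comp r (v * w) - ((d * coord r w) *s comp r v + (l * coord r v) *s comp r w)"])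
    show "v \<in> span (X \<union> (Y \<union> prods))" "w \<in> span (X \<union> (Y \<union> prods))"
      using span_UNIV by (simp_all add: Un_assoc)
  qed (auto simp: base Vector_Spaces.linear_iff vector_space_axioms bilin comp_add comp_scale X_axis[OF r] coord_add coord_scale algebra_simps)
qed

text \<open>The exact version inside \<open>span X\<close>, needed to recognize the primitive
  idempotents of that subalgebra, where an error in \<open>mixed\<close> could not be
  absorbed.\<close>

lemma comp_mult_span:
  assumes "v \<in> span X" "w \<in> span X"
  shows "comp r (v * w) = (d * coord r w) *s comp r v + (l * coord r v) *s comp r w"
proof -
  have "comp r (v * w) - ((d * coord r w) *s comp r v + (l * coord r v) *s comp r w) \<in> {0}"
    by (rule span_bilinear[OF assms subspace_single_0])
      (auto simp: comp_mult_X Vector_Spaces.linear_iff vector_space_axioms bilin comp_add comp_scale X_axis[OF r] coord_add coord_scale algebra_simps)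
  then show ?thesis by simp
qed

end

text \<open>Here \<open>b\<close> is any axis of the opposite type outside \<open>X\<close>. As
  \<open>coord x b = 0\<close>, applying \<open>comp_mult\<close> to \<open>b * b = b\<close> makes
  the main terms vanish and puts \<open>comp x b\<close> into \<open>mixed\<close>; moreover
  \<open>x * b = l *s comp x b\<close>.\<close>

lemma X_mult_axis':
  assumes "x \<in> X" "axis' b" "b \<notin> X"
  shows "x * b \<in> mixed" "b * x \<in> mixed"
proof -
  interpret sw: axes_of_type_sum_1 scale d l by (rule swapped)
  have "x \<noteq> b" using assms by auto
  note xb = mixed_mult[OF X_axis[OF assms(1)] assms(2) this]
  have "comp x b \<in> mixed"
    using comp_mult[OF assms(1), of b b] sw.axis_idem[OF assms(2)] xb(1) by simp
  then have "x * b \<in> mixed" 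
    using mult_eq_comp[OF assms(1), of b] xb(1) by (simp add: subspace_scale)
  moreover have "b * x = (d / l) *s (x * b)" using xb l_neq_0 by simp
  ultimately show "x * b \<in> mixed" "b * x \<in> mixed" by (auto simp: subspace_scale)
qed

lemma axis_mult_Y:
  assumes "axis a" "a \<notin> Y" "y \<in> Y"
  shows "a * y \<in> mixed" "y * a \<in> mixed"
proof -
  interpret sw: generating_axes scale d l Y X by (rule swapped_generating)
  show "a * y \<in> mixed" "y * a \<in> mixed" using sw.X_mult_axis'[OF assms(3,1,2)] by (auto simp: mixed_swap)
qed

section \<open>Odd parts as ideals with zero multiplication\<close>

definition linked_diffs :: "'a \<Rightarrow> 'a set" where
  "linked_diffs a = {x - a | x. x \<in> X \<and> a * x \<noteq> 0}"

context
  fixes a assumes a: "axis a" "a \<notin> Y"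
begin

lemma odd_proj_Y: "y \<in> Y \<Longrightarrow> odd_proj a y \<in> mixed"
  unfolding odd_proj_def using axis_mult_Y[OF a] by (simp add: subspace_diff subspace_scale)

text \<open>The odd part is the image of the linear map \<open>odd_proj a\<close>, so a spanning set
  is found by projecting the generators: a linked \<open>x\<close> goes to \<open>x - a\<close>, an
  unlinked one to 0, and all others into \<open>mixed\<close>.\<close>

lemma odd_proj_in: "odd_proj a v \<in> span (linked_diffs a \<union> mixed \<inter> odd_part a)"
proof (induction v rule: generators_induct)
  case (X x)
  then show ?case
    using same_type_linked(4)[OF a(1) X_axis] same_type_unlinked(3)[OF a(1) X_axis]
    by (cases "a * x = 0") (auto simp: linked_diffs_def span_zero intro!: span_base)
next
  case (rest u)
  then have "odd_proj a u \<in> mixed" using odd_proj_Y odd_proj_mixed[OF a(1)] prods_mixed by auto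
  then show ?case using axis_mult(3)[OF a(1)] by (auto intro: span_base)
qed (use odd_proj_add odd_proj_scale in \<open>auto simp: span_zero span_add span_scale odd_proj_scale[of _ 0, simplified]\<close>)

lemma linked_diffs_odd: "linked_diffs a \<subseteq> odd_part a"
  using linked_diff_odd[OF a(1) X_axis] by (auto simp: linked_diffs_def)

lemma odd_part_eq: "odd_part a = span (linked_diffs a \<union> mixed \<inter> odd_part a)"
proof (rule antisym)
  show "odd_part a \<subseteq> span (linked_diffs a \<union> mixed \<inter> odd_part a)"
    using odd_proj_in odd_proj_odd by (metis subsetI)
  show "span (linked_diffs a \<union> mixed \<inter> odd_part a) \<subseteq> odd_part a"
    using linked_diffs_odd by (intro span_minimal subspace_odd_part) auto
qed

lemma odd_part_sum: "odd_part a = span (linked_diffs a) + (mixed \<inter> odd_part a)"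
proof -
  have "span (mixed \<inter> odd_part a) = mixed \<inter> odd_part a"
    using subspace_inter[OF subspace_mixed subspace_odd_part] by simp
  then show ?thesis
    using odd_part_eq unfolding span_Un set_plus_def by blast
qed

text \<open>On the spanning set: linked axes act identically on \<open>mixed\<close>, so their
  differences annihilate it; the products of two differences cancel by the multiplication rule for
  linked axes and \<open>l + d = 1\<close>; and \<open>mixed\<close> multiplies to zero with
  itself.\<close>

lemma odd_mult_odd:
  assumes "w \<in> odd_part a" "w' \<in> odd_part a"
  shows "w * w' = 0"
proof (rule span_mult_zero)
  show "w \<in> span (linked_diffs a \<union> mixed \<inter> odd_part a)" "w' \<in> span (linked_diffs a \<union> mixed \<inter> odd_part a)"
    using assms odd_part_eq by auto
  fix u v assume uv: "u \<in> linked_diffs a \<union> mixed \<inter> odd_part a" "v \<in> linked_diffs a \<union> mixed \<inter> odd_part a"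
  have diff_mixed: "u * v = 0 \<and> v * u = 0" if "u \<in> linked_diffs a" "v \<in> mixed" for u v
    using that linked_mult_mixed[OF a(1) X_axis _ that(2)] by (auto simp: linked_diffs_def bilin)
  have diff_diff: "u * v = 0" if "u \<in> linked_diffs a" "v \<in> linked_diffs a" for u v
  proof -
    obtain x y where x: "u = x - a" "axis x" "a * x \<noteq> 0" and y: "v = y - a" "axis y" "a * y \<noteq> 0"
      using \<open>u \<in> linked_diffs a\<close> \<open>v \<in> linked_diffs a\<close> X_axis by (auto simp: linked_diffs_def)
    have "x * y \<noteq> 0" using linked_trans[OF x(2) a(1) y(2)] linked_sym[OF a(1) x(2)] x y by blast
    note e = same_type_linked(1)[OF x(2) y(2) this] same_type_linked(2)[OF a(1) x(2,3)]
      same_type_linked(1)[OF a(1) y(2,3)] axis_idem[OF a(1)]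
    show ?thesis unfolding x(1) y(1) mult_diff_left mult_diff_right e by (simp add: d_eq algebra_simps)
  qed
  show "u * v = 0" using uv diff_mixed diff_diff mixed_mult_mixed by auto
qed

text \<open>Multiplying by the odd component of \<open>v\<close> gives zero, so \<open>v\<close> may
  be replaced by its even component, for which the grading applies.\<close>

lemma odd_ideal:
  assumes "w \<in> odd_part a"
  shows "v * w \<in> odd_part a" "w * v \<in> odd_part a"
proof -
  have "v * w = (v - odd_proj a v) * w" "w * v = w * (v - odd_proj a v)"
    using odd_mult_odd[OF axis_mult(3)[OF a(1)] assms] odd_mult_odd[OF assms axis_mult(3)[OF a(1)]]
    by (auto simp: bilin)
  then show "v * w \<in> odd_part a" "w * v \<in> odd_part a"
    using even_odd[OF a(1) odd_proj_even[OF a(1)] assms] odd_even[OF a(1) odd_proj_even[OF a(1)] assms]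
    by auto
qed

text \<open>The correction terms in \<open>odd_proj_prod\<close> are products of odd elements and
  vanish. In this form the rule is linear in \<open>a\<close> and survives linear combinations of
  axes, which the grading conditions themselves do not.\<close>

lemma odd_proj_derivation: "odd_proj a (v * w) = v * odd_proj a w + odd_proj a v * w"
  unfolding odd_proj_prod[OF a(1), of v w] bilin
  using odd_mult_odd[OF axis_mult(3)[OF a(1)] axis_mult(3)[OF a(1)]] by simp

end

lemma linked_odd_part_le:
  assumes "axis a" "a \<notin> Y" "axis b" "a * b \<noteq> 0"
  shows "odd_part a \<subseteq> odd_part b"
proof (subst odd_part_eq[OF assms(1,2)], rule span_minimal[OF _ subspace_odd_part], rule Un_least)
  show "linked_diffs a \<subseteq> odd_part b"
  proof
    fix u assume "u \<in> linked_diffs a"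
    then obtain x where x: "u = x - a" "axis x" "a * x \<noteq> 0" using X_axis by (auto simp: linked_diffs_def)
    have "b * a \<noteq> 0" using linked_sym assms by blast
    moreover have "b * x \<noteq> 0" using linked_trans[OF assms(3,1) x(2)] x(3) calculation by blast
    ultimately show "u \<in> odd_part b" using linked_odd_part_diff[OF assms(3) x(2) assms(1)] x by simp
  qed
  show "mixed \<inter> odd_part a \<subseteq> odd_part b"
    using linked_mult_mixed[OF assms(1,3,4)] by (auto simp: odd_part_iff)
qed

lemma linked_odd_part_eq:
  assumes "axis a" "a \<notin> Y" "axis b" "b \<notin> Y" "a * b \<noteq> 0"
  shows "odd_part a = odd_part b"
  using assms linked_odd_part_le linked_sym by blast

end

section \<open>Internal direct products\<close>

context nonassoc_algebra
begin

lemma subalgebra_subspace: "subalgebra scale S \<Longrightarrow> subspace S"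
  by (simp add: subalgebra_def)

lemma algebra_on_simps [simp]:
  "carrier (algebra_on scale S) = S" "mult (algebra_on scale S) = (*)" "zero (algebra_on scale S) = 0"
  "add (algebra_on scale S) = (+)" "smult (algebra_on scale S) = scale"
  by (simp_all add: algebra_on_def)

lemma abelian_monoid_algebra_on: "subspace S \<Longrightarrow> abelian_monoid (algebra_on scale S)"
  by (rule abelian_monoidI) (auto simp: subspace_add subspace_0 add.assoc add.commute)

lemma finsum_algebra_on:
  assumes S: "subspace S" and F: "finite F" "\<And>i. i \<in> F \<Longrightarrow> f i \<in> S"
  shows "finsum (algebra_on scale S) f F = sum f F"
proof -
  interpret abelian_monoid "algebra_on scale S" by (rule abelian_monoid_algebra_on[OF S])
  show ?thesis using F by (induction F rule: finite_induct) (auto simp: Pi_def)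
qed

text \<open>The last hypothesis replaces linear independence of the factors.\<close>

lemma direct_productI:
  assumes B: "subalgebra scale B"
    and S: "\<And>i. i \<in> I \<Longrightarrow> subalgebra scale (S i) \<and> S i \<subseteq> B"
    and zero: "\<And>i j x y. i \<in> I \<Longrightarrow> j \<in> I \<Longrightarrow> i \<noteq> j \<Longrightarrow> x \<in> S i \<Longrightarrow> y \<in> S j \<Longrightarrow> x * y = 0"
    and span: "B \<subseteq> span (\<Union>i\<in>I. S i)"
    and nondeg: "\<And>i v. i \<in> I \<Longrightarrow> v \<in> S i \<Longrightarrow> (\<And>u. u \<in> S i \<Longrightarrow> u * v = 0) \<Longrightarrow> v = 0"
  shows "direct_product_of (algebra_on scale B) I S"
proof -
  let ?B = "algebra_on scale B"
  have sub: "is_subalgebra_of (S i) ?B" if "i \<in> I" for i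
    using S[OF that] by (auto simp: is_subalgebra_of_def subalgebra_def subspace_add subspace_scale subspace_0)
  define dec where "dec f x \<longleftrightarrow> (\<forall>i\<in>I. f i \<in> S i) \<and> (\<forall>i. i \<notin> I \<longrightarrow> f i = 0) \<and>
    finite {i. f i \<noteq> 0} \<and> x = sum f {i. f i \<noteq> 0}" for f x
  have fs: "finsum ?B f {i. f i \<noteq> 0} = sum f {i. f i \<noteq> 0}"
    if "\<forall>i\<in>I. f i \<in> S i" "\<forall>i. i \<notin> I \<longrightarrow> f i = 0" "finite {i. f i \<noteq> 0}" for f
    using that S by (intro finsum_algebra_on subalgebra_subspace[OF B]) fastforce+
  have ex: "\<exists>f. dec f x" if "x \<in> span (\<Union>i\<in>I. S i)" for x
    using that
  proof (induction rule: span_induct_alt)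
    case base
    have "dec (\<lambda>_. 0) 0" using S subspace_0 subalgebra_subspace by (auto simp: dec_def)
    then show ?case by blast
  next
    case (step c x y)
    then obtain i f where i: "i \<in> I" "x \<in> S i" and f: "dec f y" by blast
    define g where "g = f(i := f i + c *s x)"
    \<comment> \<open>The new value at \<open>i\<close> may be zero, so the supports of
      \<open>f\<close> and \<open>g\<close> are compared within one fixed finite set.\<close>
    define F where "F = insert i {i. f i \<noteq> 0}"
    have fin: "finite F" using f by (auto simp: F_def dec_def)
    have supp: "{i. g i \<noteq> 0} \<subseteq> F" by (auto simp: g_def F_def)
    have "sum g {i. g i \<noteq> 0} = sum g F" using supp fin by (intro sum.mono_neutral_left) auto
    also have "\<dots> = c *s x + sum f F"
    proof -
      have "sum g (F - {i}) = sum f (F - {i})" by (intro sum.cong) (auto simp: g_def)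
      moreover have "sum g F = g i + sum g (F - {i})" "sum f F = f i + sum f (F - {i})"
        using fin by (auto intro!: sum.remove) (auto simp: F_def)
      ultimately show ?thesis by (simp add: g_def add_ac)
    qed
    also have "sum f F = sum f {i. f i \<noteq> 0}" using fin by (intro sum.mono_neutral_right) (auto simp: F_def)
    finally have "c *s x + y = sum g {i. g i \<noteq> 0}" using f by (simp add: dec_def)
    moreover have "f i + c *s x \<in> S i"
      using S i f subalgebra_subspace by (simp add: dec_def subspace_add subspace_scale)
    then have "\<forall>j\<in>I. g j \<in> S j" using f by (simp add: dec_def g_def)
    moreover have "\<forall>j. j \<notin> I \<longrightarrow> g j = 0" using f i by (auto simp: dec_def g_def)
    moreover have "finite {i. g i \<noteq> 0}" using fin supp by (rule finite_subset[rotated])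
    ultimately have "dec g (c *s x + y)" unfolding dec_def by blast
    then show ?case by blast
  qed
  have uni: "f = g" if f: "dec f x" and g: "dec g x" for f g x
  proof
    fix i
    show "f i = g i"
    proof (cases "i \<in> I")
      case False then show ?thesis using f g by (auto simp: dec_def)
    next
      case True
      define F where "F = insert i ({i. f i \<noteq> 0} \<union> {i. g i \<noteq> 0})"
      have fin: "finite F" using f g by (auto simp: F_def dec_def)
      have "sum f F = sum f {i. f i \<noteq> 0}" "sum g F = sum g {i. g i \<noteq> 0}"
        using fin by (intro sum.mono_neutral_right; auto simp: F_def)+
      then have "sum f F = x" "sum g F = x" using f g by (simp_all add: dec_def)
      then have 0: "(\<Sum>j\<in>F. f j - g j) = 0" by (simp add: sum_subtractf)
      have h: "f j - g j \<in> S j" if "j \<in> I" for j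
        using that f g S subalgebra_subspace subspace_diff by (auto simp: dec_def)
      have FI: "F \<subseteq> I" using f g True by (auto simp: F_def dec_def)
      \<comment> \<open>The differences of the two decompositions add up to zero. Multiplication by
        an element of the factor \<open>S i\<close> removes all terms but the one at
        \<open>i\<close>.\<close>
      have "u * (f i - g i) = 0" if u: "u \<in> S i" for u
      proof -
        have "0 = u * (\<Sum>j\<in>F. f j - g j)" by (simp add: 0)
        also have "\<dots> = (\<Sum>j\<in>F. u * (f j - g j))" by (rule mult_sum_right)
        also have "\<dots> = u * (f i - g i) + (\<Sum>j\<in>F - {i}. u * (f j - g j))"
          using fin by (intro sum.remove) (auto simp: F_def)
        also have "(\<Sum>j\<in>F - {i}. u * (f j - g j)) = 0"
          using zero[OF True _ _ u h] FI by (intro sum.neutral) blast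
        finally show ?thesis by simp
      qed
      then have "f i - g i = 0" using nondeg[OF True h[OF True]] by blast
      then show ?thesis by simp
    qed
  qed
  have "\<exists>!f. (\<forall>i\<in>I. f i \<in> S i) \<and> (\<forall>i. i \<notin> I \<longrightarrow> f i = 0) \<and> finite {i. f i \<noteq> 0} \<and>
      x = finsum ?B f {i. f i \<noteq> 0}" if "x \<in> B" for x
  proof -
    have eq: "dec f x \<longleftrightarrow> (\<forall>i\<in>I. f i \<in> S i) \<and> (\<forall>i. i \<notin> I \<longrightarrow> f i = 0) \<and> finite {i. f i \<noteq> 0} \<and>
      x = finsum ?B f {i. f i \<noteq> 0}" for f
      unfolding dec_def using fs[of f] by auto
    have "\<exists>f. dec f x" using ex[of x] span that by auto
    then show ?thesis unfolding eq[symmetric] by (rule exE) (rule ex1I, assumption, rule uni)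
  qed
  then show ?thesis
    using sub zero unfolding direct_product_of_def by simp
qed

end

context axes_of_type_sum_1
begin

text \<open>Only an axis with zero odd part can have several types. A nonzero odd \<open>w\<close>
  is decomposed for the second type and multiplied by \<open>a\<close> twice: comparing coordinates
  kills the component along \<open>a\<close>, and what remains forces \<open>p = l\<close> and then
  \<open>q = d\<close>.\<close>

lemma axis_type_unique:
  assumes a: "axis a" and w: "w \<in> odd_part a" "w \<noteq> 0" and a': "has_axis_type scale UNIV p q a"
  shows "p = l \<and> q = d"
proof -
  have pq: "p \<noteq> 0" "p \<noteq> 1" using a' by (auto simp: has_axis_type_def)
  have "\<forall>w\<in>UNIV. \<exists>!t. t \<in> span {a} \<times> null_part UNIV a \<times> eigenspace scale UNIV p q a \<and> w = fst t + fst (snd t) + snd (snd t)"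
    using a' unfolding has_axis_type_def by (elim conjE)
  from this[rule_format, OF UNIV_I, of w, THEN ex1_implies_ex]
  obtain t' where t': "t' \<in> span {a} \<times> null_part UNIV a \<times> eigenspace scale UNIV p q a"
      "w = fst t' + fst (snd t') + snd (snd t')" by (elim exE conjE)
  define u v t where "u = fst t'" and "v = fst (snd t')" and "t = snd (snd t')"
  with t' have t: "u \<in> span {a}" "v \<in> null_part UNIV a" "t \<in> eigenspace scale UNIV p q a" "w = u + v + t"
    by (auto simp: mem_Times_iff)
  obtain c where c: "u = c *s a" using t(1) unfolding span_singleton by blast
  have pt: "a * t = p *s t" "t * a = q *s t" using t(3) by (auto simp: eigenspace_def)
  have aw: "a * w = c *s a + p *s t" "w * a = c *s a + q *s t"
    using t(2) pt c by (auto simp: t(4) bilin null_part_def axis_idem[OF a])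
  then have e: "l *s w = c *s a + p *s t" "d *s w = c *s a + q *s t" using w by (auto simp: odd_part_iff)
  then have "l *s (a * w) = c *s a + (p * p) *s t" by (metis axis_idem[OF a] mult_add_right mult_scale_right pt(1) scale_scale)
  moreover have "(p * p) *s t = p *s (l *s w - c *s a)" by (simp add: e(1))
  moreover have "l *s (a * w) = (l * l) *s w" using w by (simp add: odd_part_iff)
  ultimately have "(l * l) *s w = c *s a + p *s (l *s w - c *s a)" by simp
  then have "coord a ((l * l) *s w) = coord a (c *s a + p *s (l *s w - c *s a))" by simp
  then have "c = p * c" using coord_odd[OF a w(1)]
    by (simp add: coord_add coord_scale coord_diff coord_self a)
  then have c0: "c = 0" using pq by simp
  with \<open>(l * l) *s w = _\<close> have "(l * l) *s w = (p * l) *s w" by simp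
  then have "p = l" using w l_neq_0 by simp
  moreover have "t = w" using e(1) c0 calculation l_neq_0 by simp
  ultimately show ?thesis using e(2) c0 w(2) by simp
qed

end

section \<open>Classes of linked axes\<close>

context generating_axes
begin

definition cls :: "'a \<Rightarrow> 'a set" where
  "cls r = {x \<in> X. r * x \<noteq> 0}"

lemma cls_subset: "cls r \<subseteq> X" and cls_self: "r \<in> X \<Longrightarrow> r \<in> cls r"
  using linked_self X_axis by (auto simp: cls_def)

lemma cls_linked: "r \<in> X \<Longrightarrow> x \<in> cls r \<Longrightarrow> y \<in> cls r \<Longrightarrow> x * y \<noteq> 0"
  using linked_trans[of x r y] linked_sym[of r x] X_axis by (auto simp: cls_def)

lemma cls_eq: "r \<in> X \<Longrightarrow> x \<in> cls r \<Longrightarrow> cls x = cls r"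
  using linked_trans[of r x] linked_trans[of x r] linked_sym[of r x] X_axis unfolding cls_def by blast

lemma cls_disjoint: "r \<in> X \<Longrightarrow> s \<in> X \<Longrightarrow> cls r \<noteq> cls s \<Longrightarrow> x \<in> cls r \<Longrightarrow> y \<in> cls s \<Longrightarrow> x * y = 0"
  by (metis (mono_tags, lifting) cls_def cls_eq mem_Collect_eq)

text \<open>Linking is already reflexive and transitive on axes of one type, so paths in the graph
  add nothing and the components are the classes \<open>cls r\<close>.\<close>

lemma linked_in_X: "linked_in X = {(x, y). x \<in> X \<and> y \<in> X \<and> x * y \<noteq> 0}"
proof -
  let ?R = "{(x, y) \<in> X \<times> X. x * y \<noteq> 0}"
  have "(x, y) \<in> ?R" if "(x, y) \<in> ?R\<^sup>*" "x \<in> X" for x y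
    using that(1)
  proof (induction rule: rtrancl_induct)
    case base then show ?case using linked_self X_axis that(2) by auto
  next
    case (step y z)
    then show ?case using linked_trans X_axis by blast
  qed
  moreover have "(x, y) \<in> ?R\<^sup>*" if "(x, y) \<in> ?R" for x y using that by (rule r_into_rtrancl)
  ultimately show ?thesis unfolding linked_in_def by blast
qed

lemma graph_components_X: "graph_components X = cls ` X"
proof -
  have "linked_in X `` {x} = cls x" if "x \<in> X" for x using that unfolding linked_in_X cls_def by auto
  then show ?thesis unfolding graph_components_def quotient_def by auto
qed

lemma X_notin_Y: "x \<in> X \<Longrightarrow> x \<notin> Y"
  using disjoint by auto

context
  fixes r assumes r: "r \<in> X"
begin

lemma coord_linked: "x \<in> cls r \<Longrightarrow> coord x v = coord r v"
proof (induction v rule: generators_induct)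
  case (X g)
  then have "x * g = 0 \<longleftrightarrow> r * g = 0" using cls_eq[OF r] unfolding cls_def by blast
  then show ?case using X coord_X r by (auto simp: cls_def)
next
  case (rest g)
  then show ?case using coord_rest r span_base[of g "Y \<union> prods"] by (auto simp: cls_def)
qed (use r X_axis in \<open>auto simp: cls_def coord_zero coord_add coord_scale\<close>)

lemma cls_odd_part: "x \<in> cls r \<Longrightarrow> odd_part x = odd_part r"
  using linked_odd_part_eq[of r x] r X_axis X_notin_Y by (auto simp: cls_def)

text \<open>For an axis of the class these are its decomposition rules, with a coordinate and an odd
  part common to the whole class. Every conclusion is linear in \<open>u\<close>, so all five extend
  to the span, whose elements are in general not axes.\<close>

lemma span_cls_mult:
  assumes "u \<in> span (cls r)"
  shows "u * y = coord r y *s u + l *s odd_proj u y"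
    and "y * u = coord r y *s u + d *s odd_proj u y"
    and "odd_proj u y \<in> odd_part r"
    and "odd_proj u (y * z) = y * odd_proj u z + odd_proj u y * z"
    and "u - coord r u *s r \<in> odd_part r"
proof -
  have lin: "odd_proj (c *s x + u) y = c *s odd_proj x y + odd_proj u y" "odd_proj 0 y = 0" for c x u y
    by (simp_all add: odd_proj_def bilin algebra_simps)
  have "(\<forall>y z. u * y = coord r y *s u + l *s odd_proj u y \<and> y * u = coord r y *s u + d *s odd_proj u y \<and>
    odd_proj u y \<in> odd_part r \<and> odd_proj u (y * z) = y * odd_proj u z + odd_proj u y * z) \<and>
    u - coord r u *s r \<in> odd_part r"
    using assms
  proof (induction rule: span_induct_alt)
    case base
    then show ?case using subspace_0[OF subspace_odd_part] X_axis[OF r] by (simp add: lin coord_zero)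
  next
    case (step c x u)
    then have x: "x \<in> X" "r * x \<noteq> 0" by (auto simp: cls_def)
    note ax = X_axis[OF x(1)] X_notin_Y[OF x(1)]
    have "x - coord r x *s r \<in> odd_part r"
      using same_type_linked(3)[OF X_axis[OF r] ax(1) x(2)] linked_diff_odd[OF X_axis[OF r] ax(1) x(2)] by simp
    moreover have "c *s x + u - coord r (c *s x + u) *s r = c *s (x - coord r x *s r) + (u - coord r u *s r)"
      using X_axis[OF r] by (simp add: coord_add coord_scale algebra_simps)
    ultimately have 5: "c *s x + u - coord r (c *s x + u) *s r \<in> odd_part r"
      using step by (simp only:) (intro subspace_add subspace_scale subspace_odd_part; simp)
    have "(c *s x + u) * y = coord r y *s (c *s x + u) + l *s odd_proj (c *s x + u) y \<and>
      y * (c *s x + u) = coord r y *s (c *s x + u) + d *s odd_proj (c *s x + u) y" for y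
      using step axis_mult(1,2)[OF ax(1), of y] coord_linked[OF step(1)]
      unfolding lin by (simp add: bilin algebra_simps)
    moreover have "odd_proj (c *s x + u) y \<in> odd_part r" for y
      using step axis_mult(3)[OF ax(1), of y] cls_odd_part[OF step(1)] subspace_odd_part[of r]
      by (simp add: lin subspace_add subspace_scale)
    moreover have "odd_proj (c *s x + u) (y * z) = y * odd_proj (c *s x + u) z + odd_proj (c *s x + u) y * z" for y z
      using step odd_proj_derivation[OF ax, of y z]
      unfolding lin by (simp add: bilin algebra_simps)
    ultimately show ?case using 5 by blast
  qed
  then show "u * y = coord r y *s u + l *s odd_proj u y"
    "y * u = coord r y *s u + d *s odd_proj u y"
    "odd_proj u y \<in> odd_part r"
    "odd_proj u (y * z) = y * odd_proj u z + odd_proj u y * z"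
    "u - coord r u *s r \<in> odd_part r" by auto
qed

text \<open>An element of coordinate 1 differs from \<open>r\<close> by an odd element, and odd
  elements annihilate each other. So \<open>u\<close> acts on the odd part as \<open>r\<close> does
  and has the same odd part, whose ideal properties are known.\<close>

lemma affine_axis:
  assumes u: "u \<in> span (cls r)" "coord r u = 1"
  shows "axis u"
proof -
  note um = span_cls_mult[OF u(1)]
  note rY = X_axis[OF r] X_notin_Y[OF r]
  have u0: "u - r \<in> odd_part r" using um(5) u(2) by simp
  have "(u - r) * w = 0" "w * (u - r) = 0" if "w \<in> odd_part r" for w
    using odd_mult_odd[OF rY u0 that] odd_mult_odd[OF rY that u0] by auto
  then have "u * w = r * w" "w * u = w * r" if "w \<in> odd_part r" for w using that by (auto simp: bilin)
  then have sub: "w \<in> odd_part u" if "w \<in> odd_part r" for w using that by (auto simp: odd_part_iff)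
  have odd: "odd_part u = odd_part r"   proof
    show "odd_part u \<subseteq> odd_part r"
    proof
      fix w assume "w \<in> odd_part u"
      then have "odd_proj u w = w" by (rule odd_proj_odd)
      then show "w \<in> odd_part r" using um(3)[of w] by simp
    qed
  qed (use sub in blast)
  \<comment> \<open>The even part of \<open>u\<close> is the kernel of this derivation, hence closed
    under products.\<close>
  have der: "odd_proj u (y * z) = y * odd_proj u z + odd_proj u y * z" for y z by (rule um(4))
  show ?thesis
    unfolding axis_iff
  proof (intro conjI allI ballI impI)
    show "u \<noteq> 0" using u(2) coord_zero[OF rY(1)] by auto
    show "u * u = u" using um(1)[of u] u(2) odd_proj_self[of u] by simp
    fix y
    show "\<exists>c w. w \<in> odd_part u \<and> u * y = c *s u + l *s w \<and> y * u = c *s u + d *s w"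
      using um(1,2,3) odd by blast
    show "u * (y * z) = y * z * u" if "u * y = y * u" "u * z = z * u" for z
      using der[of y z] that by (simp flip: odd_proj_eq_0_iff)
  qed (use odd odd_ideal[OF rY] odd_mult_odd[OF rY] in auto)
qed

lemma comp_span_cls: "v \<in> span X \<Longrightarrow> comp r v \<in> span (cls r)"
proof (induction rule: span_induct_alt)
  case (step c x v)
  then have "comp r x \<in> span (cls r)" by (auto simp: comp_X r cls_def span_zero intro: span_base)
  then show ?case using step by (simp add: comp_add comp_scale r span_add span_scale)
qed (simp add: comp_zero r span_zero)

lemma comp_id: "u \<in> span (cls r) \<Longrightarrow> comp r u = u"
  by (induction rule: span_induct_alt) (auto simp: comp_zero comp_add comp_scale r comp_X cls_def)

lemma span_X_mult_cls:
  assumes "v \<in> span X" "u \<in> span (cls r)"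
  shows "v * u = (d * coord r u) *s comp r v + (l * coord r v) *s u"
proof -
  have base: "v * u - ((d * coord r u) *s comp r v + (l * coord r v) *s u) \<in> {0}" if "v \<in> X" "u \<in> cls r" for v u
  proof -
    have u: "u \<in> X" "r * u \<noteq> 0" using that by (auto simp: cls_def)
    show ?thesis
    proof (cases "r * v = 0")
      case True
      then have "cls v \<noteq> cls u" using cls_eq[OF r that(2)] cls_self[OF that(1)] by (auto simp: cls_def)
      then have "v * u = 0" using cls_disjoint[OF that(1) u(1)] cls_self that u by blast
      then show ?thesis using True comp_X[OF r that(1)] coord_X[OF r that(1)] by simp
    next
      case False
      then have "v * u \<noteq> 0" using cls_linked[OF r _ that(2)] that by (auto simp: cls_def)
      then have "v * u = d *s v + l *s u" using same_type_linked(1) X_axis that u by blast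
      then show ?thesis using False comp_X[OF r that(1)] coord_X[OF r that(1)] coord_X[OF r u(1)] u(2) by simp
    qed
  qed
  have "v * u - ((d * coord r u) *s comp r v + (l * coord r v) *s u) \<in> {0}"
    by (rule span_bilinear[OF assms subspace_single_0, where f = "\<lambda>v u. v * u - ((d * coord r u) *s comp r v + (l * coord r v) *s u)"])
      (use base in \<open>auto simp: Vector_Spaces.linear_iff vector_space_axioms bilin comp_add comp_scale r X_axis[OF r] coord_add coord_scale algebra_simps\<close>)
  then show ?thesis by simp
qed

text \<open>In the class of \<open>r\<close>, \<open>r * v = 0\<close> makes \<open>v\<close> a
  multiple of the idempotent \<open>r\<close>, and then \<open>r * v = v\<close>. This supplies the
  nondegeneracy hypothesis of \<open>direct_productI\<close>.\<close>

lemma span_cls_nondegenerate: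
  assumes "v \<in> span (cls r)" "r * v = 0"
  shows "v = 0"
proof -
  have "l *s v = (- d * coord r v) *s r"
    using mult_eq_comp[OF r, of v] assms comp_id[OF assms(1)] by (simp add: eq_neg_iff_add_eq_0 add.commute)
  then have "inverse l *s l *s v = inverse l *s (- d * coord r v) *s r" by metis
  then have v: "v = (inverse l * (- d * coord r v)) *s r" using l_neq_0 by simp
  have "r * v = v" by (subst (1 2) v) (simp add: axis_idem[OF X_axis[OF r]])
  then show ?thesis using assms by simp
qed

end

text \<open>Some \<open>r\<close> does not annihilate \<open>a\<close>. Its component
  \<open>p = comp r a\<close> is nonzero, and \<open>a * a = a\<close> yields
  \<open>p = coord r a *s p\<close>, so the coordinate is 1. Then \<open>a * p = p\<close>,
  primitivity makes \<open>p\<close> a multiple of \<open>a\<close>, and comparing coordinates gives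
  \<open>p = a\<close>: a primitive idempotent is an affine combination within one class.\<close>

lemma primitive_span_X:
  assumes a: "a \<in> span X" "a \<noteq> 0" "a * a = a" and prim: "{y \<in> span X. a * y = y} = span {a}"
  obtains r where "r \<in> X" "a \<in> span (cls r)" "coord r a = 1"
proof -
  have "\<exists>r\<in>X. r * a \<noteq> 0"
  proof (rule ccontr)
    assume "\<not> ?thesis"
    then have "a * a = 0" using span_mult_zero[of a X a "{a}"] a(1) by (auto simp: span_base)
    then show False using a by simp
  qed
  then obtain r where r: "r \<in> X" "r * a \<noteq> 0" by blast
  define p where "p = comp r a"
  have p: "p \<in> span (cls r)" "p \<in> span X"
    using comp_span_cls[OF r(1) a(1)] span_mono[OF cls_subset[of r]] by (auto simp: p_def)
  have cp: "coord r p = coord r a" unfolding p_def by (rule coord_comp[OF r(1)])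
  have "p \<noteq> 0"
  proof
    assume "p = 0"
    then have "coord r a = 0" using cp coord_zero X_axis[OF r(1)] by simp
    then show False using mult_eq_comp[OF r(1), of a] \<open>p = 0\<close> r(2) by (simp add: p_def)
  qed
  have one: "d * c + l * c = c" for c using sum_1 by (simp add: add.commute flip: distrib_right)
  have "p = (d * coord r a) *s p + (l * coord r a) *s p"
    using comp_mult_span[OF r(1) a(1) a(1)] a(3) by (simp add: p_def)
  then have "p = coord r a *s p" by (simp add: one flip: scale_left_distrib)
  then have ca: "coord r a = 1" using \<open>p \<noteq> 0\<close> by (metis scale_right_imp_eq scale_one)
  have "a * p = p"
    using span_X_mult_cls[OF r(1) a(1) p(1)] cp one[of 1] ca by (simp flip: p_def scale_left_distrib)
  then obtain c where c: "p = c *s a" using prim p(2) unfolding span_singleton by blast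
  have "coord r p = c * coord r a" unfolding c by (rule coord_scale[OF X_axis[OF r(1)]])
  then have "c = 1" using cp ca by simp
  then show thesis using that[OF r(1)] p(1) c ca by simp
qed

lemma primitive_in_span_X:
  assumes "primitive_axis scale (span X) a"
  shows "axis a"
proof -
  obtain p q where "has_axis_type scale (span X) p q a"
    using assms unfolding primitive_axis_def by blast
  then have "a \<in> span X \<and> a \<noteq> 0 \<and> a * a = a \<and> {y \<in> span X. a * y = y} = span {a}"
    unfolding has_axis_type_def by (elim conjE) (intro conjI)
  then obtain r where "r \<in> X" "a \<in> span (cls r)" "coord r a = 1"
    using primitive_span_X[of a] by blast
  then show ?thesis using affine_axis by blast
qed

lemma direct_product_span_X:
  "\<exists>\<E>. (\<forall>E\<in>\<E>. is_U scale l E) \<and> direct_product_of (algebra_on scale (span X)) \<E> span"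
proof -
  \<comment> \<open>A class of linked axes may be linearly dependent, so the basis \<open>E\<close>
    of \<open>U\<close> is a maximal independent subset of it.\<close>
  define basis where "basis C = (SOME B. B \<subseteq> C \<and> independent B \<and> C \<subseteq> span B)" for C
  have basis: "basis C \<subseteq> C \<and> independent (basis C) \<and> C \<subseteq> span (basis C)" for C
    unfolding basis_def by (rule someI_ex) (metis maximal_independent_subset)
  have sp: "span (basis C) = span C" for C
    using basis[of C] by (metis span_mono span_minimal subspace_span antisym)
  have U: "is_U scale l (basis (cls r))" if r: "r \<in> X" for r
  proof -
    have "basis (cls r) \<noteq> {}"
      using basis[of "cls r"] cls_self[OF r] axis_nonzero[OF X_axis[OF r]] by auto
    moreover have "e * f = (1 - l) *s e + l *s f" if "e \<in> cls r" "f \<in> cls r" for e f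
      using same_type_linked(1)[OF X_axis X_axis cls_linked[OF r that]] that cls_subset[of r] d_eq by auto
    ultimately show ?thesis using basis[of "cls r"] unfolding is_U_def by blast
  qed
  have "direct_product_of (algebra_on scale (span X)) ((\<lambda>r. basis (cls r)) ` X) span"
  proof (rule direct_productI)
    show "subalgebra scale (span X)" using subalgebra_generated[of X] by (simp add: generated_X)
  next
    fix E assume "E \<in> (\<lambda>r. basis (cls r)) ` X"
    then obtain r where r: "r \<in> X" "E = basis (cls r)" by auto
    have "x * y \<in> span (cls r)" if xy: "x \<in> cls r" "y \<in> cls r" for x y
    proof -
      have "x * y = d *s x + l *s y"
        using same_type_linked(1)[OF X_axis X_axis cls_linked[OF r(1) xy]] xy cls_subset[of r] by blast
      then show ?thesis using xy by (simp add: span_add span_scale span_base)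
    qed
    then have "subalgebra scale (span (cls r))"
      unfolding subalgebra_def using span_mult_in[of _ "cls r" _ "cls r" "span (cls r)"] by auto
    then show "subalgebra scale (span E) \<and> span E \<subseteq> span X"
      using span_mono[OF cls_subset[of r]] by (simp add: r sp)
    fix v assume "v \<in> span E" "\<And>u. u \<in> span E \<Longrightarrow> u * v = 0"
    then show "v = 0"
      using span_cls_nondegenerate[OF r(1), of v] span_base[OF cls_self[OF r(1)]] by (simp add: r sp)
  next
    fix E F x y
    assume "E \<in> (\<lambda>r. basis (cls r)) ` X" "F \<in> (\<lambda>r. basis (cls r)) ` X" "E \<noteq> F"
    then obtain r s where rs: "r \<in> X" "E = basis (cls r)" "s \<in> X" "F = basis (cls s)" by (elim imageE)
    with \<open>E \<noteq> F\<close> have neq: "cls r \<noteq> cls s" by metis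
    assume "x \<in> span E" "y \<in> span F"
    then show "x * y = 0"
      using span_mult_zero[of x "cls r" y "cls s"] cls_disjoint[OF rs(1,3) neq] by (simp add: rs(2,4) sp)
  next
    have "X \<subseteq> span (\<Union>E\<in>(\<lambda>r. basis (cls r)) ` X. span E)"
    proof
      fix x assume x: "x \<in> X"
      then have "x \<in> span (basis (cls x))" using span_base[OF cls_self] by (simp add: sp)
      then show "x \<in> span (\<Union>E\<in>(\<lambda>r. basis (cls r)) ` X. span E)" using x by (blast intro: span_base)
    qed
    then show "span X \<subseteq> span (\<Union>E\<in>(\<lambda>r. basis (cls r)) ` X. span E)"
      by (rule span_minimal) simp
  qed
  with U show ?thesis by (intro exI[of _ "(\<lambda>r. basis (cls r)) ` X"] conjI) (simp_all add: ball_simps)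
qed

section \<open>Reconstruction from components and absence of annihilating elements\<close>

lemma transversal_exists: "\<exists>R\<subseteq>X. \<forall>x\<in>X. \<exists>!r. r \<in> R \<and> r * x \<noteq> 0"
proof -
  define rep where "rep x = (SOME y. y \<in> cls x)" for x
  have rep: "rep x \<in> cls x" if "x \<in> X" for x unfolding rep_def using cls_self[OF that] by (rule someI)
  have inX: "rep x \<in> X" if "x \<in> X" for x using rep[OF that] by (auto simp: cls_def)
  have ceq: "cls (rep x) = cls x" if "x \<in> X" for x using cls_eq rep that by blast
  show ?thesis
  proof (intro exI[of _ "rep ` X"] conjI ballI)
    show "rep ` X \<subseteq> X" using inX by auto
    fix x assume x: "x \<in> X"
    show "\<exists>!r. r \<in> rep ` X \<and> r * x \<noteq> 0"
    proof (rule ex1I[of _ "rep x"])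
      show "rep x \<in> rep ` X \<and> rep x * x \<noteq> 0"
        using x cls_linked[OF x rep cls_self] by auto
      fix r assume "r \<in> rep ` X \<and> r * x \<noteq> 0"
      then obtain y where y: "y \<in> X" "r = rep y" "rep y * x \<noteq> 0" by auto
      then have "x \<in> cls y" using ceq[OF y(1)] x by (auto simp: cls_def)
      then show "r = rep x" using cls_eq[OF y(1)] y(2) by (simp add: rep_def)
    qed
  qed
qed

text \<open>Each generator survives in exactly one component, that of \<open>x\<close> for both
  \<open>x\<close> and \<open>x * y\<close>. The claim is made for all larger finite sets of
  representatives, so that in the induction the sets belonging to two summands can be
  merged.\<close>

lemma sum_comp:
  assumes R: "R \<subseteq> X" "\<forall>x\<in>X. \<exists>!r. r \<in> R \<and> r * x \<noteq> 0" and "v \<in> span (X \<union> prods)"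
  shows "\<exists>T. finite T \<and> T \<subseteq> R \<and> (\<forall>T'. finite T' \<longrightarrow> T \<subseteq> T' \<longrightarrow> T' \<subseteq> R \<longrightarrow> v = (\<Sum>r\<in>T'. comp r v))"
  using assms(3)
proof (induction rule: span_induct_alt)
  case base
  have "(\<Sum>r\<in>T'. comp r 0) = 0" if "T' \<subseteq> R" for T' using that R(1) comp_zero by (intro sum.neutral) blast
  then show ?case by (intro exI[of _ "{}"]) auto
next
  case (step c g v)
  then obtain T where T: "finite T" "T \<subseteq> R"
    "\<And>T'. finite T' \<Longrightarrow> T \<subseteq> T' \<Longrightarrow> T' \<subseteq> R \<Longrightarrow> v = (\<Sum>r\<in>T'. comp r v)" by blast
  have "\<exists>r0\<in>R. \<forall>r\<in>R. comp r g = (if r = r0 then g else 0)"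
  proof -
    obtain x where x: "x \<in> X" "g = x \<or> (\<exists>y\<in>Y. g = x * y)" using step(1) by (auto simp: prods_def)
    obtain r0 where r0: "r0 \<in> R" "r0 * x \<noteq> 0" "\<And>r. r \<in> R \<Longrightarrow> r * x \<noteq> 0 \<Longrightarrow> r = r0"
      using R(2) x(1) by metis
    have "comp r g = (if r * x \<noteq> 0 then g else 0)" if "r \<in> X" for r
    proof (cases "g = x")
      case True then show ?thesis using comp_X[OF that x(1)] by simp
    next
      case False
      then obtain y where y: "y \<in> Y" "g = x * y" using x by blast
      show ?thesis
        using axis_prods[OF X_axis[OF that] x(1) y(1)] axis_mult_mixed(1)[OF X_axis[OF that] prod_in_mixed[OF x(1) y(1)]] l_neq_0
        by (simp add: comp_def y)
    qed
    then have "comp r g = (if r = r0 then g else 0)" if "r \<in> R" for r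
      using r0(2) r0(3)[OF that] subsetD[OF R(1) that] by (cases "r = r0") auto
    then show ?thesis using r0(1) by blast
  qed
  then obtain r0 where r0: "r0 \<in> R" "\<And>r. r \<in> R \<Longrightarrow> comp r g = (if r = r0 then g else 0)" by blast
  have "c *s g + v = (\<Sum>r\<in>T'. comp r (c *s g + v))" if T': "finite T'" "insert r0 T \<subseteq> T'" "T' \<subseteq> R" for T'
  proof -
    have "(\<Sum>r\<in>T'. comp r (c *s g + v)) = (\<Sum>r\<in>T'. c *s (if r = r0 then g else 0) + comp r v)"
    proof (rule sum.cong[OF refl])
      fix r assume "r \<in> T'"
      then have "r \<in> R" "r \<in> X" using T'(3) R(1) by auto
      then show "comp r (c *s g + v) = c *s (if r = r0 then g else 0) + comp r v"
        using r0(2) by (simp add: comp_add comp_scale)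
    qed
    also have "\<dots> = c *s (\<Sum>r\<in>T'. if r = r0 then g else 0) + v"
      using T(3)[of T'] T' by (simp add: sum.distrib scale_sum_right[symmetric] del: sum.delta sum.delta')
    also have "(\<Sum>r\<in>T'. if r = r0 then g else 0) = g" using T' by simp
    finally show ?thesis by simp
  qed
  then show ?case using T r0(1) by (intro exI[of _ "insert r0 T"]) auto
qed

text \<open>Applied with \<open>W = mixed\<close> and with \<open>W = {0}\<close>.\<close>

lemma comp_all_mixed:
  assumes "v \<in> span (X \<union> prods)" "\<And>r. r \<in> X \<Longrightarrow> comp r v \<in> W" "subspace W"
  shows "v \<in> W"
proof -
  obtain R where R: "R \<subseteq> X" "\<forall>x\<in>X. \<exists>!r. r \<in> R \<and> r * x \<noteq> 0" using transversal_exists by blast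
  obtain T where "finite T" "T \<subseteq> R" "v = (\<Sum>r\<in>T. comp r v)" using sum_comp[OF R assms(1)] by blast
  then show ?thesis using R(1) assms(2) subspace_sum[OF assms(3), of T "\<lambda>r. comp r v"] by auto
qed

lemma comp_annihilated:
  assumes "r \<in> X" "r * v = 0"
  shows "comp r v = 0"
proof -
  have "coord r (r * v) = coord r v" using coord_mult[OF assms(1)] coord_self[OF X_axis[OF assms(1)]] by simp
  then show ?thesis using assms coord_zero[OF X_axis[OF assms(1)]] by (simp add: comp_def)
qed

text \<open>The components of the whole sum vanish, and those of \<open>w\<close> lie in
  \<open>mixed\<close>. Hence all components of \<open>u + z\<close> lie in \<open>mixed\<close>,
  and \<open>u + z\<close> is the sum of its components.\<close>

lemma annihilated_mixed:
  assumes "\<And>x. x \<in> X \<Longrightarrow> x * (u + w + z) = 0" "u \<in> span X" "w \<in> span Y" "z \<in> mixed"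
  shows "u \<in> mixed"
proof -
  have uz: "u + z \<in> span (X \<union> prods)"
    using assms(2,4) span_mono[of X "X \<union> prods"] span_mono[of prods "X \<union> prods"]
    unfolding mixed_def by (intro span_add) auto
  have "comp r (u + z) \<in> mixed" if r: "r \<in> X" for r
  proof -
    have "comp r (u + w + z) = 0" using comp_annihilated[OF r] assms(1)[OF r] by blast
    moreover have "u + w + z = (u + z) + w" by (simp add: add_ac)
    ultimately have "comp r (u + z) + comp r w = 0" using comp_add[OF r, of "u + z" w] by simp
    then have "comp r (u + z) = - comp r w" by (simp add: eq_neg_iff_add_eq_0)
    then show ?thesis using comp_rest[OF r] span_Y_prods(1) assms(3) subspace_neg[OF subspace_mixed] by auto
  qed
  then have "u + z \<in> mixed" using comp_all_mixed[OF uz] by simp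
  then show ?thesis using assms(4) subspace_diff[OF subspace_mixed, of "u + z" z] by simp
qed

text \<open>Two rounds are needed. The components for one type see the other type only up to
  \<open>mixed\<close>, so the first round, made for both types, merely places \<open>v\<close> in
  \<open>mixed\<close>. There the components reconstruct \<open>v\<close> exactly, and they are all
  zero.\<close>

lemma no_annihilating:
  fixes v :: 'a
  assumes "annihilating v"
  shows "v = 0"
proof -
  interpret sw: generating_axes scale d l Y X by (rule swapped_generating)
  have ann: "x * v = 0" for x using assms by (auto simp: annihilating_def)
  have "v \<in> span X + span Y + mixed" using UNIV_eq by blast
  then obtain u w z where v: "v = u + w + z" "u \<in> span X" "w \<in> span Y" "z \<in> mixed"
    unfolding set_plus_def by blast
  have "u \<in> mixed" using annihilated_mixed[of u w z] ann v by simp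
  moreover have "w \<in> mixed" using sw.annihilated_mixed[of w u z] ann v by (simp add: mixed_swap add.commute)
  ultimately have "v \<in> mixed" using v by (simp add: subspace_add)
  then have "v \<in> span (X \<union> prods)" unfolding mixed_def using span_mono[of prods "X \<union> prods"] by auto
  then have "v \<in> {0}" using comp_all_mixed[of v "{0}"] comp_annihilated ann by simp
  then show ?thesis by simp
qed

end

section \<open>Quotients by ideals\<close>

context nonassoc_algebra
begin

abbreviation algebra_UNIV :: "('k, 'a) module" where
  "algebra_UNIV \<equiv> algebra_on scale UNIV"

abbreviation coset :: "'a set \<Rightarrow> 'a \<Rightarrow> 'a set" where
  "coset J x \<equiv> J +>\<^bsub>algebra_UNIV\<^esub> x"

abbreviation quotient :: "'a set \<Rightarrow> ('k, 'a set) module" where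
  "quotient J \<equiv> quotient_algebra algebra_UNIV J"

lemma mem_coset: "y \<in> coset J x \<longleftrightarrow> y - x \<in> J"
  unfolding a_r_coset_def' by (force simp: algebra_simps)

lemma coset_eq_iff: "subspace J \<Longrightarrow> coset J x = coset J y \<longleftrightarrow> x - y \<in> J"
proof
  assume J: "subspace J" and "coset J x = coset J y"
  moreover have "x \<in> coset J x" using subspace_0[OF J] by (simp add: mem_coset)
  ultimately show "x - y \<in> J" using mem_coset by blast
next
  assume J: "subspace J" and xy: "x - y \<in> J"
  have "z - x \<in> J \<longleftrightarrow> z - y \<in> J" for z
    using subspace_add[OF J _ xy, of "z - x"] subspace_diff[OF J _ xy, of "z - y"] by auto
  then show "coset J x = coset J y" by (auto simp: mem_coset)
qed

lemma coset_0: "coset J 0 = J"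
  by (auto simp: mem_coset)

lemma ideal_mult_cong:
  assumes "algebra_ideal scale J" "x - x' \<in> J" "y - y' \<in> J"
  shows "x * y - x' * y' \<in> J"
proof -
  have "x * (y - y') \<in> J" "(x - x') * y' \<in> J" "subspace J"
    using assms by (auto simp: algebra_ideal_def)
  then have "x * (y - y') + (x - x') * y' \<in> J" by (simp add: subspace_add)
  then show ?thesis by (simp add: bilin)
qed

lemma carrier_quotient: "carrier (quotient J) = range (coset J)"
  by (auto simp: quotient_algebra_def A_RCOSETS_def')

lemma zero_quotient: "zero (quotient J) = J"
  by (simp add: quotient_algebra_def)

lemma coset_nonempty: "subspace J \<Longrightarrow> coset J x \<noteq> {}"
  using mem_coset[of x J x] subspace_0[of J] by auto

lemma mult_quotient:
  assumes "algebra_ideal scale J"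
  shows "coset J x \<otimes>\<^bsub>quotient J\<^esub> coset J y = coset J (x * y)"
proof -
  have J: "subspace J" using assms by (simp add: algebra_ideal_def)
  have eq: "coset J (a * b) = coset J (x * y)" if "a \<in> coset J x" "b \<in> coset J y" for a b
    using ideal_mult_cong[OF assms] that by (simp add: coset_eq_iff[OF J] mem_coset)
  have "coset J x \<otimes>\<^bsub>quotient J\<^esub> coset J y = (\<Union>a\<in>coset J x. \<Union>b\<in>coset J y. coset J (a * b))"
    by (simp add: quotient_algebra_def rcoset_mult_def)
  also have "\<dots> = coset J (x * y)"
    by (intro SUP_eq_const coset_nonempty J) (rule eq)
  finally show ?thesis .
qed

lemma add_quotient:
  assumes J: "subspace J"
  shows "coset J x \<oplus>\<^bsub>quotient J\<^esub> coset J y = coset J (x + y)"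
proof -
  have "z \<in> coset J x \<oplus>\<^bsub>quotient J\<^esub> coset J y \<longleftrightarrow> (\<exists>a\<in>coset J x. \<exists>b\<in>coset J y. z = a + b)" for z
    unfolding quotient_algebra_def by (auto simp: set_add_def')
  moreover have "(\<exists>a\<in>coset J x. \<exists>b\<in>coset J y. z = a + b) \<longleftrightarrow> z \<in> coset J (x + y)" for z
  proof
    assume "\<exists>a\<in>coset J x. \<exists>b\<in>coset J y. z = a + b"
    then obtain a b where "a - x \<in> J" "b - y \<in> J" "z = a + b" by (auto simp: mem_coset)
    then have "z - (x + y) = (a - x) + (b - y)" by (simp add: algebra_simps)
    then show "z \<in> coset J (x + y)" using subspace_add[OF J \<open>a - x \<in> J\<close> \<open>b - y \<in> J\<close>] by (simp only: mem_coset)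
  next
    assume "z \<in> coset J (x + y)"
    then have "z - y \<in> coset J x" "y \<in> coset J y" "z = (z - y) + y"
      using subspace_0[OF J] by (auto simp: mem_coset diff_diff_eq add.commute)
    then show "\<exists>a\<in>coset J x. \<exists>b\<in>coset J y. z = a + b" by blast
  qed
  ultimately show ?thesis by blast
qed

lemma smult_quotient:
  assumes J: "subspace J"
  shows "c \<odot>\<^bsub>quotient J\<^esub> coset J x = coset J (c *s x)"
proof -
  have eq: "coset J (c *s a) = coset J (c *s x)" if "a \<in> coset J x" for a
    using that subspace_scale[OF J, of "a - x" c]
    by (simp add: coset_eq_iff[OF J] mem_coset scale_right_diff_distrib)
  have "c \<odot>\<^bsub>quotient J\<^esub> coset J x = (\<Union>a\<in>coset J x. coset J (c *s a))"
    by (simp add: quotient_algebra_def)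
  also have "\<dots> = coset J (c *s x)"
    by (intro SUP_eq_const coset_nonempty J) (rule eq)
  finally show ?thesis .
qed

lemma quotient_isomorphicI:
  assumes J: "algebra_ideal scale J"
    and h: "\<And>x y. h x = h y \<longleftrightarrow> x - y \<in> J" "range h = carrier C"
      "\<And>x y. h (x + y) = h x \<oplus>\<^bsub>C\<^esub> h y" "\<And>x y. h (x * y) = h x \<otimes>\<^bsub>C\<^esub> h y" "\<And>c x. h (c *s x) = c \<odot>\<^bsub>C\<^esub> h x"
  shows "algebra_isomorphic (quotient J) C"
proof -
  have sJ: "subspace J" using J by (simp add: algebra_ideal_def)
  define f where "f K = h (SOME x. x \<in> K)" for K
  have f: "f (coset J x) = h x" for x
  proof -
    have "x \<in> coset J x" using subspace_0[OF sJ] by (simp add: mem_coset)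
    then have "(SOME y. y \<in> coset J x) \<in> coset J x" by (rule someI)
    then show ?thesis unfolding f_def h(1) by (simp add: mem_coset)
  qed
  have "bij_betw f (carrier (quotient J)) (carrier C)"
    unfolding bij_betw_def carrier_quotient
  proof
    show "inj_on f (range (coset J))" by (auto simp: inj_on_def f h(1) coset_eq_iff[OF sJ])
    show "f ` range (coset J) = carrier C" unfolding h(2)[symmetric] by (auto simp: f image_image)
  qed
  then show ?thesis
    unfolding algebra_isomorphic_def
    by (intro exI[of _ f]) (auto simp: carrier_quotient add_quotient[OF sJ] mult_quotient[OF J] smult_quotient[OF sJ] f h)
qed

lemma abelian_monoid_quotient: "subspace J \<Longrightarrow> abelian_monoid (quotient J)"
proof -
  assume J: "subspace J"
  have z: "zero (quotient J) = coset J 0" by (simp add: zero_quotient coset_0)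
  show ?thesis
    by (rule abelian_monoidI) (auto simp only: carrier_quotient add_quotient[OF J] z add_ac add_0_left add_0_right rangeI)
qed

lemma finsum_quotient:
  assumes J: "subspace J" and "finite F"
  shows "finsum (quotient J) (\<lambda>i. coset J (g i)) F = coset J (sum g F)"
proof -
  have z: "zero (quotient J) = coset J 0" by (simp add: zero_quotient coset_0)
  interpret abelian_monoid "quotient J" by (rule abelian_monoid_quotient[OF J])
  show ?thesis
    using assms(2)
  proof (induction F rule: finite_induct)
    case (insert i F)
    have "(\<lambda>i. coset J (g i)) \<in> F \<rightarrow> carrier (quotient J)" by (auto simp: carrier_quotient)
    then show ?case
      using insert by (subst finsum_insert) (auto simp: carrier_quotient add_quotient[OF J])
  qed (simp add: z)
qed

end

lemma field_base_field_algebra: "field (base_field_algebra :: ('k::field, 'k) module)"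
proof -
  have "cring (base_field_algebra :: ('k, 'k) module)"
  proof (rule cringI)
    show "abelian_group (base_field_algebra :: ('k, 'k) module)"
    proof (rule abelian_groupI)
      fix x :: 'k
      show "\<exists>y\<in>carrier base_field_algebra. y \<oplus>\<^bsub>base_field_algebra\<^esub> x = \<zero>\<^bsub>base_field_algebra\<^esub>"
        by (rule bexI[of _ "- x"]) (auto simp: base_field_algebra_def)
    qed (auto simp: base_field_algebra_def add_ac)
    show "comm_monoid (base_field_algebra :: ('k, 'k) module)"
      by (rule comm_monoidI) (auto simp: base_field_algebra_def mult_ac)
  qed (auto simp: base_field_algebra_def distrib_right)
  then show ?thesis
  proof (rule cring.cring_fieldI)
    have "x \<in> Units (base_field_algebra :: ('k, 'k) module)" if "x \<noteq> 0" for x :: 'k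
      using that by (auto simp: Units_def base_field_algebra_def intro!: exI[of _ "inverse x"])
    then show "Units (base_field_algebra :: ('k, 'k) module) = carrier base_field_algebra - {\<zero>\<^bsub>base_field_algebra\<^esub>}"
      by (auto simp: base_field_algebra_def Units_def)
  qed
qed

section \<open>Quotients spanned by orthogonal idempotents\<close>

context nonassoc_algebra
begin

text \<open>Modulo \<open>J\<close> the set \<open>R\<close> consists of orthogonal idempotents
  spanning the quotient. The functionals \<open>\<chi> r\<close> factor through the quotient and are
  dual to \<open>R\<close>, so coordinates are unique; each line \<open>K r\<close> is a copy of the
  ground field with unit \<open>r\<close>.\<close>

lemma quotient_product_of_fields:
  assumes J: "algebra_ideal scale J" and span: "span (R \<union> J) = UNIV"
    and idem: "\<And>r. r \<in> R \<Longrightarrow> r * r = r" and orth: "\<And>r s. r \<in> R \<Longrightarrow> s \<in> R \<Longrightarrow> r \<noteq> s \<Longrightarrow> r * s \<in> J"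
    and lin: "\<And>r. r \<in> R \<Longrightarrow> Vector_Spaces.linear scale (*) (\<chi> r)"
    and \<chi>J: "\<And>r j. r \<in> R \<Longrightarrow> j \<in> J \<Longrightarrow> \<chi> r j = 0"
    and \<chi>R: "\<And>r s. r \<in> R \<Longrightarrow> s \<in> R \<Longrightarrow> \<chi> r s = (if r = s then 1 else 0)"
  shows "\<exists>\<K>. (\<forall>K\<in>\<K>. is_field_algebra ((quotient J)\<lparr>carrier := K\<rparr>)) \<and> direct_product_of (quotient J) \<K> (\<lambda>K. K)"
proof -
  have sJ: "subspace J" using J by (simp add: algebra_ideal_def)
  note q = carrier_quotient add_quotient[OF sJ] mult_quotient[OF J] smult_quotient[OF sJ]
  have z: "zero (quotient J) = J" "coset J 0 = J" by (simp_all add: zero_quotient coset_0)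
  have \<chi>: "\<chi> r (x + y) = \<chi> r x + \<chi> r y" "\<chi> r (x - y) = \<chi> r x - \<chi> r y" "\<chi> r (c *s x) = c * \<chi> r x"
     "\<chi> r (sum f F) = (\<Sum>i\<in>F. \<chi> r (f i))" if "r \<in> R" for r x y c and f :: "'a \<Rightarrow> 'a" and F
    using lin[OF that] by (auto simp: Vector_Spaces.linear_iff_module_hom module_hom.add module_hom.diff module_hom.scale module_hom.sum)
  have coset_\<chi>: "\<chi> r x = \<chi> r y" if "coset J x = coset J y" "r \<in> R" for x y r
    using that \<chi>J[of r "x - y"] \<chi>(2)[of r x y] by (simp add: coset_eq_iff[OF sJ])
  define K where "K r = range (\<lambda>c. coset J (c *s r))" for r
  have coset_scale_inj: "c = e" if "coset J (c *s r) = coset J (e *s r)" "r \<in> R" for c e r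
    using coset_\<chi>[OF that] \<chi>(3) \<chi>R that by simp
  have K_inj: "r = s" if "K r = K s" "r \<in> R" "s \<in> R" for r s
  proof (rule ccontr)
    assume "r \<noteq> s"
    have "coset J (1 *s r) \<in> K s" by (subst that(1)[symmetric], subst K_def) (rule rangeI)
    then obtain c where "coset J (1 *s r) = coset J (c *s s)" unfolding K_def by blast
    then show False using coset_\<chi>[of "1 *s r" "c *s s" r] \<chi>(3) \<chi>R that \<open>r \<noteq> s\<close> by simp
  qed
  have field: "is_field_algebra ((quotient J)\<lparr>carrier := K r\<rparr>)" if r: "r \<in> R" for r
  proof -
    let ?Q = "(quotient J)\<lparr>carrier := K r, one := coset J r\<rparr>"
    have "(\<lambda>c. coset J (c *s r)) \<in> ring_iso base_field_algebra ?Q"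
      unfolding ring_iso_def ring_hom_def
      using coset_scale_inj[OF _ r]
      by (auto simp: base_field_algebra_def K_def q idem[OF r] scale_left_distrib bij_betw_def inj_on_def mult.commute)
    from field.ring_iso_imp_img_field[OF field_base_field_algebra this]
    \<comment> \<open>The transfer along the isomorphism installs the image of 0 as zero, which is
      the zero already present.\<close>
    have "field (?Q\<lparr>zero := coset J (\<zero>\<^bsub>base_field_algebra\<^esub> *s r)\<rparr>)" .
    moreover have "coset J (\<zero>\<^bsub>base_field_algebra\<^esub> *s r) = zero ?Q" by (simp add: base_field_algebra_def z)
    ultimately have "field ?Q" by simp
    then show ?thesis unfolding is_field_algebra_def by (intro exI[of _ "coset J r"]) simp
  qed
  \<comment> \<open>The product is indexed by the lines themselves; since \<open>K\<close> is
    injective on \<open>R\<close>, the choice recovers the idempotent of a line.\<close>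
  define \<rho> where "\<rho> C = (SOME r. r \<in> R \<and> K r = C)" for C
  have \<rho>: "\<rho> C \<in> R" "K (\<rho> C) = C" if "C \<in> K ` R" for C
    using someI_ex[of "\<lambda>r. r \<in> R \<and> K r = C"] that unfolding \<rho>_def by blast+
  have \<rho>_inj: "inj_on \<rho> (K ` R)" using \<rho>(2) by (metis inj_onI)
  have decomp: "\<exists>F c. finite F \<and> F \<subseteq> R \<and> v - (\<Sum>r\<in>F. c r *s r) \<in> J" for v
  proof -
    have "v \<in> span (R \<union> J)" using span by simp
    then show ?thesis
    proof (induction rule: span_induct_alt)
      case base
      show ?case using subspace_0[OF sJ] by (intro exI[of _ "{}"]) auto
    next
      case (step e g v)
      then obtain F c where F: "finite F" "F \<subseteq> R" "v - (\<Sum>r\<in>F. c r *s r) \<in> J" by blast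
      show ?case
      proof (cases "g \<in> J")
        case True
        have "e *s g + (v - (\<Sum>r\<in>F. c r *s r)) \<in> J" using True F by (intro subspace_add subspace_scale sJ)
        then show ?thesis using F by (intro exI[of _ F] exI[of _ c]) (simp add: add_diff_eq)
      next
        case False
        then have g: "g \<in> R" using step by auto
        define c' where "c' r = (if r \<in> F then c r else 0) + (if r = g then e else 0)" for r
        have "(\<Sum>r\<in>insert g F. c' r *s r) = (\<Sum>r\<in>insert g F. (if r \<in> F then c r else 0) *s r) +
            (\<Sum>r\<in>insert g F. (if r = g then e else 0) *s r)"
          by (simp add: c'_def scale_left_distrib sum.distrib)
        also have "(\<Sum>r\<in>insert g F. (if r \<in> F then c r else 0) *s r) = (\<Sum>r\<in>F. c r *s r)"
          using F(1) by (intro sum.mono_neutral_cong_right) auto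
        also have "(\<Sum>r\<in>insert g F. (if r = g then e else 0) *s r) = (\<Sum>r\<in>{g}. e *s r)"
          using F(1) by (intro sum.mono_neutral_cong_right) auto
        finally have "e *s g + v - (\<Sum>r\<in>insert g F. c' r *s r) \<in> J" using F(3) by (simp add: algebra_simps)
        then show ?thesis using F g by (intro exI[of _ "insert g F"] exI[of _ c']) simp
      qed
    qed
  qed
  have sub: "is_subalgebra_of C (quotient J)" if "C \<in> K ` R" for C
  proof -
    from that obtain r where r: "C = K r" "r \<in> R" by (rule imageE)
    have "J \<in> K r" unfolding K_def using z(2) by (intro image_eqI[of _ _ 0]) auto
    then show ?thesis unfolding is_subalgebra_of_def r(1)
      by (auto simp: K_def q z(1) idem[OF r(2)] simp flip: scale_left_distrib)
  qed
  have zero: "x \<otimes>\<^bsub>quotient J\<^esub> y = J" if "C \<in> K ` R" "C' \<in> K ` R" "C \<noteq> C'" "x \<in> C" "y \<in> C'" for C C' x y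
  proof -
    from that(1,2) obtain r s where rs: "r \<in> R" "s \<in> R" "C = K r" "C' = K s"
      by (elim imageE)
    then have "r \<noteq> s" using that(3) by metis
    from that(4,5) obtain c e where "x = coset J (c *s r)" "y = coset J (e *s s)"
      unfolding rs(3,4) K_def by (elim rangeE)
    then have "x \<otimes>\<^bsub>quotient J\<^esub> y = coset J ((e * c) *s (r * s))" by (simp add: q)
    also have "\<dots> = coset J 0" using orth[OF rs(1,2) \<open>r \<noteq> s\<close>] by (simp add: coset_eq_iff[OF sJ] subspace_scale[OF sJ])
    finally show ?thesis by (simp add: z)
  qed
  have uni: "\<exists>!f. (\<forall>C\<in>K ` R. f C \<in> C) \<and> (\<forall>C. C \<notin> K ` R \<longrightarrow> f C = J) \<and> finite {C. f C \<noteq> J} \<and>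
      coset J v = finsum (quotient J) f {C. f C \<noteq> J}" for v
  proof -
    \<comment> \<open>The dual functionals read off the coordinates of \<open>v\<close>. The default
      \<open>J\<close> is the zero of the quotient.\<close>
    define f where "f C = (if C \<in> K ` R then coset J (\<chi> (\<rho> C) v *s \<rho> C) else J)" for C
    obtain F c where F: "finite F" "F \<subseteq> R" "v - (\<Sum>r\<in>F. c r *s r) \<in> J" using decomp by blast
    have \<chi>v: "\<chi> s v = (if s \<in> F then c s else 0)" if "s \<in> R" for s
    proof -
      have "\<chi> s v = \<chi> s (\<Sum>r\<in>F. c r *s r)" using coset_\<chi>[of v "\<Sum>r\<in>F. c r *s r" s] F(3) that by (simp add: coset_eq_iff[OF sJ])
      also have "\<dots> = (\<Sum>r\<in>F. if r = s then c r else 0)"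
        unfolding \<chi>(4)[OF that] using F(2) that \<chi>R by (intro sum.cong) (auto simp: \<chi>(3))
      finally show ?thesis using F(1) by simp
    qed
    have supp: "{C. f C \<noteq> J} \<subseteq> K ` F"
    proof
      fix C assume "C \<in> {C. f C \<noteq> J}"
      then have C: "C \<in> K ` R" "coset J (\<chi> (\<rho> C) v *s \<rho> C) \<noteq> J" by (auto simp: f_def split: if_splits)
      then have "\<rho> C \<in> F" using \<chi>v[OF \<rho>(1)[OF C(1)]] z(2) by (auto split: if_splits)
      then show "C \<in> K ` F" using \<rho>(2)[OF C(1)] by (metis imageI)
    qed
    have fin: "finite {C. f C \<noteq> J}" by (rule finite_subset[OF supp finite_imageI[OF F(1)]])
    have suppR: "{C. f C \<noteq> J} \<subseteq> K ` R" using supp F(2) by blast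
    interpret abelian_monoid "quotient J" by (rule abelian_monoid_quotient[OF sJ])
    have "finsum (quotient J) f {C. f C \<noteq> J} =
        finsum (quotient J) (\<lambda>C. coset J (\<chi> (\<rho> C) v *s \<rho> C)) {C. f C \<noteq> J}"
    proof (rule finsum_cong'[OF refl])
      show "(\<lambda>C. coset J (\<chi> (\<rho> C) v *s \<rho> C)) \<in> {C. f C \<noteq> J} \<rightarrow> carrier (quotient J)" by (simp add: q)
      fix C assume "C \<in> {C. f C \<noteq> J}"
      then have "C \<in> K ` R" by (rule subsetD[OF suppR])
      then show "f C = coset J (\<chi> (\<rho> C) v *s \<rho> C)" unfolding f_def by (rule if_P)
    qed
    also have "\<dots> = coset J (\<Sum>C\<in>{C. f C \<noteq> J}. \<chi> (\<rho> C) v *s \<rho> C)"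
      by (rule finsum_quotient[OF sJ fin])
    also have "\<dots> = coset J v"
    proof -
      \<comment> \<open>Lines coming from \<open>F\<close> but outside the support contribute only
        elements of \<open>J\<close>, so the sum over the support has the right coset.\<close>
      have J0: "\<chi> (\<rho> C) v *s \<rho> C \<in> J" if "C \<in> K ` F" "f C = J" for C
      proof -
        have "coset J (\<chi> (\<rho> C) v *s \<rho> C) = coset J 0" using that F(2) z unfolding f_def by auto
        then show ?thesis by (simp add: coset_eq_iff[OF sJ])
      qed
      have "(\<Sum>r\<in>F. c r *s r) = (\<Sum>C\<in>K ` F. \<chi> (\<rho> C) v *s \<rho> C)"
      proof -
        have inj: "inj_on K F" using K_inj F(2) by (meson inj_onI subsetD)
        have "\<rho> (K r) = r" if "r \<in> F" for r using \<rho>[of "K r"] K_inj that F(2) by blast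
        then show ?thesis unfolding sum.reindex[OF inj] using \<chi>v F(2) by (intro sum.cong) auto
      qed
      also have "\<dots> = (\<Sum>C\<in>{C. f C \<noteq> J}. \<chi> (\<rho> C) v *s \<rho> C) + (\<Sum>C\<in>K ` F - {C. f C \<noteq> J}. \<chi> (\<rho> C) v *s \<rho> C)"
        using F(1) supp by (subst sum.subset_diff[OF supp]) (auto simp: add.commute)
      finally have e: "(\<Sum>r\<in>F. c r *s r) - (\<Sum>C\<in>{C. f C \<noteq> J}. \<chi> (\<rho> C) v *s \<rho> C) \<in> J"
        using J0 by (auto intro!: subspace_sum[OF sJ])
      have "v - (\<Sum>C\<in>{C. f C \<noteq> J}. \<chi> (\<rho> C) v *s \<rho> C) \<in> J"
        using subspace_add[OF sJ F(3) e] by simp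
      then have "coset J v = coset J (\<Sum>C\<in>{C. f C \<noteq> J}. \<chi> (\<rho> C) v *s \<rho> C)"
        unfolding coset_eq_iff[OF sJ] .
      then show ?thesis by (rule sym)
    qed
    finally have fsum: "finsum (quotient J) f {C. f C \<noteq> J} = coset J v" .
    show ?thesis
    proof (rule ex1I[of _ f])
      have "\<forall>C\<in>K ` R. f C \<in> C"
      proof
        fix C assume C: "C \<in> K ` R"
        then have "f C \<in> K (\<rho> C)" unfolding f_def K_def by auto
        then show "f C \<in> C" using \<rho>(2)[OF C] by simp
      qed
      then show "(\<forall>C\<in>K ` R. f C \<in> C) \<and> (\<forall>C. C \<notin> K ` R \<longrightarrow> f C = J) \<and> finite {C. f C \<noteq> J} \<and>
        coset J v = finsum (quotient J) f {C. f C \<noteq> J}"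
        using fin fsum by (simp add: f_def)
    next
      fix g assume g: "(\<forall>C\<in>K ` R. g C \<in> C) \<and> (\<forall>C. C \<notin> K ` R \<longrightarrow> g C = J) \<and> finite {C. g C \<noteq> J} \<and>
        coset J v = finsum (quotient J) g {C. g C \<noteq> J}"
      have "\<exists>e. g C = coset J (e *s \<rho> C)" if "C \<in> K ` R" for C
      proof -
        have "g C \<in> K (\<rho> C)" using g that \<rho>(2) by auto
        then show ?thesis unfolding K_def by blast
      qed
      then obtain e where e: "\<And>C. C \<in> K ` R \<Longrightarrow> g C = coset J (e C *s \<rho> C)" by metis
      have gR: "{C. g C \<noteq> J} \<subseteq> K ` R" using g by blast
      have "coset J v = finsum (quotient J) g {C. g C \<noteq> J}" using g by (elim conjE)
      also have "\<dots> = finsum (quotient J) (\<lambda>C. coset J (e C *s \<rho> C)) {C. g C \<noteq> J}"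
      proof (rule finsum_cong'[OF refl])
        show "(\<lambda>C. coset J (e C *s \<rho> C)) \<in> {C. g C \<noteq> J} \<rightarrow> carrier (quotient J)" by (simp add: q)
      qed (rule e, erule subsetD[OF gR])
      also have "\<dots> = coset J (\<Sum>C\<in>{C. g C \<noteq> J}. e C *s \<rho> C)" using g by (intro finsum_quotient sJ) blast
      finally have cv: "coset J v = coset J (\<Sum>C\<in>{C. g C \<noteq> J}. e C *s \<rho> C)" .
      show "g = f"
      proof
        fix C
        show "g C = f C"
        proof (cases "C \<in> K ` R")
          case True
          have "\<chi> (\<rho> C) v = (\<Sum>D\<in>{C. g C \<noteq> J}. e D * \<chi> (\<rho> C) (\<rho> D))"
            using coset_\<chi>[OF cv \<rho>(1)[OF True]] \<chi>(3)[OF \<rho>(1)[OF True]]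
            by (simp add: module_hom.sum[OF lin[OF \<rho>(1)[OF True], unfolded Vector_Spaces.linear_iff_module_hom]])
          also have "\<dots> = (\<Sum>D\<in>{C. g C \<noteq> J}. if D = C then e D else 0)"
          proof (rule sum.cong[OF refl])
            fix D assume "D \<in> {C. g C \<noteq> J}"
            then have D: "D \<in> K ` R" using gR by blast
            have "\<rho> C = \<rho> D \<longleftrightarrow> D = C" using inj_onD[OF \<rho>_inj _ True D] by auto
            then show "e D * \<chi> (\<rho> C) (\<rho> D) = (if D = C then e D else 0)"
              using \<chi>R[OF \<rho>(1)[OF True] \<rho>(1)[OF D]] by simp
          qed
          also have "\<dots> = (if g C \<noteq> J then e C else 0)" using g by (simp add: sum.delta')
          finally have "\<chi> (\<rho> C) v = (if g C \<noteq> J then e C else 0)" .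
          then show ?thesis using e[OF True] True z(2) by (cases "g C = J") (simp_all add: f_def)
        next
          case False
          then show ?thesis using g by (simp add: f_def)
        qed
      qed
    qed
  qed
  have "direct_product_of (quotient J) (K ` R) (\<lambda>C. C)"
    unfolding direct_product_of_def z(1)
  proof (intro conjI ballI impI)
    fix x assume "x \<in> carrier (quotient J)"
    then obtain v where "x = coset J v" by (auto simp: q)
    then show "\<exists>!f. (\<forall>C\<in>K ` R. f C \<in> C) \<and> (\<forall>C. C \<notin> K ` R \<longrightarrow> f C = J) \<and> finite {C. f C \<noteq> J} \<and>
      x = finsum (quotient J) f {C. f C \<noteq> J}" using uni by simp
  qed (use sub zero in blast)+
  moreover have "\<forall>C\<in>K ` R. is_field_algebra ((quotient J)\<lparr>carrier := C\<rparr>)" using field by simp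
  ultimately show ?thesis by (intro exI[of _ "K ` R"] conjI)
qed

end

section \<open>Transversals and components\<close>

context generating_axes
begin

lemma component_transversalD:
  assumes "component_transversal X T"
  shows "T \<subseteq> X" and "\<And>x. x \<in> X \<Longrightarrow> \<exists>!a. a \<in> T \<and> a * x \<noteq> 0"
proof -
  show T: "T \<subseteq> X" using assms by (simp add: component_transversal_def)
  fix x assume x: "x \<in> X"
  then have "\<exists>!a. a \<in> T \<inter> cls x" using assms by (simp add: component_transversal_def graph_components_X)
  moreover have "a \<in> T \<inter> cls x \<longleftrightarrow> a \<in> T \<and> a * x \<noteq> 0" for a
    using T linked_sym[OF X_axis X_axis[OF x], of a] by (auto simp: cls_def)
  ultimately show "\<exists>!a. a \<in> T \<and> a * x \<noteq> 0" by simp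
qed

lemma transversal_self:
  assumes "component_transversal X T" "a \<in> T" "b \<in> T" "a * b \<noteq> 0"
  shows "a = b"
proof -
  note T = component_transversalD[OF assms(1)]
  have b: "b \<in> X" using T(1) assms by auto
  then have "b * b \<noteq> 0" using linked_self X_axis by blast
  then show ?thesis using T(2)[OF b] assms by blast
qed

lemma eigenspace_span_X: "eigenspace scale (span X) l d a = odd_part a \<inter> span X"
  by (auto simp: eigenspace_def)

lemma linked_diffs_subset: "a \<in> X \<Longrightarrow> linked_diffs a \<subseteq> eigenspace scale (span X) l d a"
  unfolding eigenspace_span_X using linked_diffs_odd[OF X_axis X_notin_Y]
  by (auto simp: linked_diffs_def intro: span_diff span_base)

lemma odd_part_eq_X:
  assumes a: "a \<in> X"
  shows "odd_part a = eigenspace scale (span X) l d a + (mixed \<inter> odd_part a)"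
proof (rule antisym)
  have sub: "subspace (eigenspace scale (span X) l d a)"
    unfolding eigenspace_span_X by (intro subspace_inter subspace_odd_part subspace_span)
  have "span (linked_diffs a) \<subseteq> eigenspace scale (span X) l d a"
    by (rule span_minimal[OF linked_diffs_subset[OF a] sub])
  then show "odd_part a \<subseteq> eigenspace scale (span X) l d a + (mixed \<inter> odd_part a)"
    using odd_part_sum[OF X_axis[OF a] X_notin_Y[OF a]] by (metis set_plus_mono2 order_refl)
  show "eigenspace scale (span X) l d a + (mixed \<inter> odd_part a) \<subseteq> odd_part a"
    by (auto simp: set_plus_def eigenspace_span_X intro: subspace_add[OF subspace_odd_part])
qed

text \<open>\<open>a\<close> need not belong to \<open>X\<close>, and then the differences
  \<open>x - a\<close> need not lie in \<open>span X\<close>; this is the reason for the summand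
  \<open>span {a}\<close>.\<close>

lemma odd_part_decomp:
  assumes a: "axis a" "a \<notin> Y" and w: "w \<in> odd_part a"
  shows "\<exists>v'\<in>(span {a} + span X) \<inter> odd_part a. \<exists>z'\<in>mixed \<inter> odd_part a. w = v' + z'"
proof -
  obtain v' z' where vz: "w = v' + z'" "v' \<in> span (linked_diffs a)" "z' \<in> mixed \<inter> odd_part a"
    using w odd_part_sum[OF a] unfolding set_plus_def by blast
  have "linked_diffs a \<subseteq> span ({a} \<union> X)"
    by (auto simp: linked_diffs_def intro!: span_diff intro: span_base)
  then have "v' \<in> span ({a} \<union> X)" using vz(2) by (metis span_minimal subspace_span subsetD)
  then have "v' \<in> span {a} + span X" unfolding span_Un set_plus_def by blast
  moreover have "v' \<in> odd_part a"
    using vz(2) span_minimal[OF linked_diffs_odd[OF a] subspace_odd_part] by auto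
  ultimately show ?thesis using vz by blast
qed

text \<open>\<open>X\<close> contains the reflections of its members in the axes of \<open>Y\<close>, so \<open>x * y\<close> is a multiple of a
  difference of linked members of \<open>X\<close>.\<close>

lemma mixed_subset_odd_parts:
  assumes closed: "\<And>x y. x \<in> X \<Longrightarrow> y \<in> Y \<Longrightarrow> x * y \<noteq> 0 \<Longrightarrow> x - 2 *s odd_proj x y \<in> X"
    and T: "component_transversal X T"
  shows "mixed \<subseteq> span (\<Union>a\<in>T. eigenspace scale (span X) l d a)"
  unfolding mixed_def
proof (rule span_minimal[OF _ subspace_span], rule subsetI)
  note T = component_transversalD[OF T]
  fix p assume "p \<in> prods"
  then obtain x y where xy: "x \<in> X" "y \<in> Y" "p = x * y" by (auto simp: prods_def)
  show "p \<in> span (\<Union>a\<in>T. eigenspace scale (span X) l d a)"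
  proof (cases "p = 0")
    case False
    define c where "c = x - 2 *s odd_proj x y"
    note ax = X_axis[OF xy(1)] Y_axis[OF xy(2)] X_neq_Y[OF xy(1,2)]
    have c: "c \<in> X" "x * c \<noteq> 0"
      using closed[OF xy(1,2)] False xy(3) linked_reflection(2)[OF ax] by (auto simp: c_def)
    obtain a where a: "a \<in> T" "a * x \<noteq> 0" using T(2)[OF xy(1)] by blast
    then have aX: "axis a" using T(1) X_axis by auto
    have "a * c \<noteq> 0" using linked_trans[OF aX ax(1) X_axis[OF c(1)]] a c by blast
    then have "x - c \<in> odd_part a" using linked_odd_part_diff[OF aX ax(1) X_axis[OF c(1)]] a by blast
    then have "x - c \<in> eigenspace scale (span X) l d a"
      using xy(1) c(1) by (simp add: eigenspace_span_X span_diff span_base)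
    then have "x - c \<in> span (\<Union>a\<in>T. eigenspace scale (span X) l d a)" using a(1) by (blast intro: span_base)
    \<comment> \<open>With \<open>m = odd_proj x y\<close>, one has \<open>x * y = l *s m\<close>
      and \<open>x - c = 2 *s m\<close>.\<close>
    moreover have "p = (l * inverse 2) *s (x - c)"
      using mixed_mult(2)[OF ax] xy(3) two_neq_0 by (simp add: c_def)
    ultimately show ?thesis by (simp add: span_scale)
  qed (simp add: span_zero)
qed

text \<open>Since \<open>a\<close> is linked to every member of \<open>X\<close>, all mixed products
  are odd for it, and \<open>mixed\<close> is contained in the odd part.\<close>

lemma odd_part_connected:
  assumes conn: "\<And>x y. x \<in> X \<Longrightarrow> y \<in> X \<Longrightarrow> x * y \<noteq> 0" and a: "a \<in> X"
  shows "odd_part a = span {x - a | x. x \<in> X} + mixed"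
proof -
  have "linked_diffs a = {x - a | x. x \<in> X}" using conn a by (auto simp: linked_diffs_def)
  moreover have "mixed \<subseteq> odd_part a"
    unfolding mixed_def
  proof (rule span_minimal[OF _ subspace_odd_part], rule subsetI)
    fix p assume "p \<in> prods"
    then obtain x y where xy: "x \<in> X" "y \<in> Y" "p = x * y" by (auto simp: prods_def)
    then show "p \<in> odd_part a"
      using mixed_prod_linked(1)[OF X_axis X_axis[OF a] Y_axis X_neq_Y] conn a by blast
  qed
  then have "mixed \<inter> odd_part a = mixed" by blast
  ultimately show ?thesis using odd_part_sum[OF X_axis[OF a] X_notin_Y[OF a]] by simp
qed

section \<open>Quotients by odd parts\<close>

lemma odd_part_ideal: "axis a \<Longrightarrow> a \<notin> Y \<Longrightarrow> algebra_ideal scale (odd_part a)"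
  using odd_ideal subspace_odd_part by (auto simp: algebra_ideal_def)

lemma mixed_algebra_ideal: "algebra_ideal scale mixed"
  using mixed_ideal by (auto simp: algebra_ideal_def)

text \<open>Modulo the odd part every \<open>v\<close> is \<open>coord a v *s a + w\<close> with
  \<open>w\<close> in \<open>span Y\<close>. The element \<open>w\<close> is not unique, but its
  coset modulo \<open>mixed\<close> is, and the isomorphism sends \<open>v\<close> to the pair of
  these two data.\<close>

lemma quotient_odd_part_connected:
  assumes conn: "\<And>x y. x \<in> X \<Longrightarrow> y \<in> X \<Longrightarrow> x * y \<noteq> 0" and a: "a \<in> X"
  shows "algebra_isomorphic (quotient (odd_part a))
    (product_algebra base_field_algebra ((quotient mixed)\<lparr>carrier := coset mixed ` span Y\<rparr>))"
proof -
  note ax = X_axis[OF a] X_notin_Y[OF a]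
  let ?D = "odd_part a"
  have D: "subspace ?D" by (rule subspace_odd_part)
  have ideal: "algebra_ideal scale ?D" by (rule odd_part_ideal[OF ax])
  have mD: "mixed \<subseteq> ?D"
    using odd_part_connected[OF conn a] span_zero by (force simp: set_plus_def)
  have clsX: "cls a = X" using conn a by (auto simp: cls_def)
  have coordY: "coord a w = 0" if "w \<in> span Y" for w
    using coord_rest[OF a] span_Y_prods(1) that by blast
  have aY: "a * w \<in> mixed \<and> w * a \<in> mixed" if "w \<in> span Y" for w
    using that
    by (induction rule: span_induct_alt)
      (auto simp: bilin prod_in_mixed[OF a] prod_in_mixed'[OF a] subspace_0 subspace_add subspace_scale)
  \<comment> \<open>\<open>a * w\<close> is in \<open>mixed\<close> because \<open>w\<close> is in
    \<open>span Y\<close>, and equals \<open>l *s w\<close> because \<open>w\<close> is odd.\<close>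
  have uniq: "w \<in> mixed" if "w \<in> span Y" "w \<in> ?D" for w
  proof -
    have "l *s w \<in> mixed" using aY[OF that(1)] that(2) by (simp add: odd_part_iff)
    then show ?thesis using subspace_scale[OF subspace_mixed, of "l *s w" "inverse l"] l_neq_0 by simp
  qed
  have ex: "\<exists>w. w \<in> span Y \<and> v - coord a v *s a - w \<in> ?D" for v
  proof -
    have "v \<in> span X + span Y + mixed" using UNIV_eq by blast
    then obtain u w z where v: "v = u + w + z" "u \<in> span X" "w \<in> span Y" "z \<in> mixed"
      unfolding set_plus_def by blast
    have "coord a v = coord a u" using v coordY coord_mixed[OF ax(1)] by (simp add: coord_add ax)
    moreover have "u - coord a u *s a \<in> ?D" using span_cls_mult(5)[OF a] v(2) clsX by simp
    then have "u - coord a u *s a + z \<in> ?D" using v(4) mD subspace_add[OF D] by blast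
    ultimately have "v - coord a v *s a - w \<in> ?D" by (simp add: v(1) algebra_simps)
    then show ?thesis using v(3) by blast
  qed
  define q where "q v = (SOME w. w \<in> span Y \<and> v - coord a v *s a - w \<in> ?D)" for v
  have q: "q v \<in> span Y" "v - (coord a v *s a + q v) \<in> ?D" for v
    using someI_ex[OF ex[of v]] by (auto simp: q_def diff_diff_eq)
  have qI: "coset mixed (q v) = coset mixed w" if "w \<in> span Y" "v - (coord a v *s a + w) \<in> ?D" for v w
  proof -
    have "q v - w = (v - (coord a v *s a + w)) - (v - (coord a v *s a + q v))" by simp
    also have "\<dots> \<in> ?D" using that q subspace_diff[OF D] by blast
    finally have "q v - w \<in> mixed" using uniq q(1) that(1) span_diff by blast
    then show ?thesis by (simp add: coset_eq_iff)
  qed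
  define h where "h v = (coord a v, coset mixed (q v))" for v
  show ?thesis
  proof (rule quotient_isomorphicI[OF ideal, where h = h])
    fix x y
    show "h x = h y \<longleftrightarrow> x - y \<in> ?D"
    proof
      assume "h x = h y"
      then have c: "coord a x = coord a y" and "q x - q y \<in> ?D"
        using mD by (auto simp: h_def coset_eq_iff)
      then have "(x - (coord a x *s a + q x)) - (y - (coord a y *s a + q y)) + (q x - q y) \<in> ?D"
        using q subspace_add[OF D] subspace_diff[OF D] by blast
      then show "x - y \<in> ?D" using c by simp
    next
      assume xy: "x - y \<in> ?D"
      then have c: "coord a x = coord a y" using coord_odd[OF ax(1) xy] by (simp add: coord_diff ax)
      have "x - (coord a x *s a + q y) = (x - y) + (y - (coord a y *s a + q y))" using c by simp
      then have "x - (coord a x *s a + q y) \<in> ?D" using xy q(2) subspace_add[OF D] by metis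
      then show "h x = h y" using c qI[OF q(1)] by (simp add: h_def)
    qed
    show "h (x + y) = h x \<oplus>\<^bsub>product_algebra base_field_algebra (quotient mixed\<lparr>carrier := coset mixed ` span Y\<rparr>)\<^esub> h y"
    proof -
      have "x + y - (coord a (x + y) *s a + (q x + q y)) = (x - (coord a x *s a + q x)) + (y - (coord a y *s a + q y))"
        by (simp add: coord_add ax algebra_simps)
      then have "coset mixed (q (x + y)) = coset mixed (q x + q y)"
        using q subspace_add[OF D] span_add by (intro qI) metis+
      then show ?thesis
        by (simp add: h_def product_algebra_def base_field_algebra_def coord_add ax add_quotient)
    qed
    show "h (x * y) = h x \<otimes>\<^bsub>product_algebra base_field_algebra (quotient mixed\<lparr>carrier := coset mixed ` span Y\<rparr>)\<^esub> h y"
    proof -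
      have qq: "q x * q y \<in> span Y"
        by (rule span_mult_in[OF q(1) q(1)]) (auto intro: Y_mult_Y)
      have 1: "x * y - (coord a x *s a + q x) * (coord a y *s a + q y) \<in> ?D"
        by (rule ideal_mult_cong[OF ideal q(2) q(2)])
      \<comment> \<open>The cross terms between the two factors lie in \<open>mixed\<close> and
        disappear modulo the odd part.\<close>
      have "coord a x *s (a * q y) + coord a y *s (q x * a) \<in> ?D"
        using aY[OF q(1)] mD by (intro subspace_add[OF D] subspace_scale[OF D]) auto
      with 1 have "x * y - (coord a x *s a + q x) * (coord a y *s a + q y) +
          (coord a x *s (a * q y) + coord a y *s (q x * a)) \<in> ?D" by (rule subspace_add[OF D])
      moreover have "(coord a x *s a + q x) * (coord a y *s a + q y) =
          (coord a x * coord a y) *s a + q x * q y + (coord a x *s (a * q y) + coord a y *s (q x * a))"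
        by (simp add: bilin axis_idem[OF ax(1)] algebra_simps)
      ultimately have "x * y - (coord a (x * y) *s a + q x * q y) \<in> ?D"
        by (simp add: coord_mult[OF a] diff_diff_eq)
      then have "coset mixed (q (x * y)) = coset mixed (q x * q y)" by (rule qI[OF qq])
      then show ?thesis
        by (simp add: h_def product_algebra_def base_field_algebra_def coord_mult[OF a] mult_quotient[OF mixed_algebra_ideal])
    qed
  next
    fix c x
    have "c *s x - (coord a (c *s x) *s a + c *s q x) = c *s (x - (coord a x *s a + q x))"
      by (simp add: coord_scale ax algebra_simps)
    then have "coset mixed (q (c *s x)) = coset mixed (c *s q x)"
      using q subspace_scale[OF D] span_scale by (intro qI) metis+
    then show "h (c *s x) = c \<odot>\<^bsub>product_algebra base_field_algebra (quotient mixed\<lparr>carrier := coset mixed ` span Y\<rparr>)\<^esub> h x"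
      by (simp add: h_def product_algebra_def base_field_algebra_def coord_scale ax smult_quotient)
  next
    have "(c, coset mixed w) \<in> range h" if "w \<in> span Y" for c w
    proof -
      have "coord a (c *s a + w) = c" using coordY[OF that] by (simp add: coord_add coord_scale coord_self ax)
      moreover from this have "coset mixed (q (c *s a + w)) = coset mixed w"
        using that subspace_0[OF D] by (intro qI) auto
      ultimately have "h (c *s a + w) = (c, coset mixed w)" by (simp add: h_def)
      then show ?thesis by (metis rangeI)
    qed
    then show "range h = carrier (product_algebra base_field_algebra (quotient mixed\<lparr>carrier := coset mixed ` span Y\<rparr>))"
      using q(1) by (auto simp: h_def product_algebra_def base_field_algebra_def)
  qed
qed

text \<open>Closure under reflections puts \<open>mixed\<close> into \<open>J\<close>, so
  \<open>J\<close> contains the odd parts computed in the whole algebra, which are ideals. Modulo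
  \<open>J\<close> linked axes coincide and axes of opposite types are orthogonal; the
  representatives in \<open>T\<close> and \<open>S\<close> serve as the idempotents and their
  coordinates as the dual functionals.\<close>

lemma quotient_fields:
  assumes closedX: "\<And>x y. x \<in> X \<Longrightarrow> y \<in> Y \<Longrightarrow> x * y \<noteq> 0 \<Longrightarrow> x - 2 *s odd_proj x y \<in> X"
    and T: "component_transversal X T" and S: "component_transversal Y S"
    and J: "J = span ((\<Union>a\<in>T. eigenspace scale (span X) l d a) \<union> (\<Union>b\<in>S. eigenspace scale (span Y) d l b))"
  shows "algebra_ideal scale J"
    and "\<exists>\<K>. (\<forall>K\<in>\<K>. is_field_algebra ((quotient J)\<lparr>carrier := K\<rparr>)) \<and> direct_product_of (quotient J) \<K> (\<lambda>K. K)"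
proof -
  interpret sw: generating_axes scale d l Y X by (rule swapped_generating)
  note TD = component_transversalD[OF T] and SD = sw.component_transversalD[OF S]
  have sJ: "subspace J" by (simp add: J)
  have mixedJ: "mixed \<subseteq> J"
    using mixed_subset_odd_parts[OF closedX T] unfolding J by (meson span_mono Un_upper1 order_trans)
  have "odd_part a \<subseteq> J" if "a \<in> T" for a
  proof -
    have "eigenspace scale (span X) l d a \<subseteq> J" unfolding J using that by (blast intro: span_base)
    then have "eigenspace scale (span X) l d a + (mixed \<inter> odd_part a) \<subseteq> J"
      using mixedJ subspace_add[OF sJ] unfolding set_plus_def by blast
    then show ?thesis using odd_part_eq_X[of a] TD(1) that by blast
  qed
  moreover have "odd_part' b \<subseteq> J" if "b \<in> S" for b
  proof -
    have "eigenspace scale (span Y) d l b \<subseteq> J" unfolding J using that by (blast intro: span_base)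
    then have "eigenspace scale (span Y) d l b + (sw.mixed \<inter> odd_part' b) \<subseteq> J"
      using mixedJ subspace_add[OF sJ] unfolding set_plus_def mixed_swap by blast
    then show ?thesis using sw.odd_part_eq_X[of b] SD(1) that by blast
  qed
  ultimately have oddJ: "a \<in> T \<Longrightarrow> odd_part a \<subseteq> J" "b \<in> S \<Longrightarrow> odd_part' b \<subseteq> J" for a b by auto
  have gen: "v * g \<in> J \<and> g * v \<in> J"
    if "g \<in> (\<Union>a\<in>T. eigenspace scale (span X) l d a) \<union> (\<Union>b\<in>S. eigenspace scale (span Y) d l b)" for g v
    using that
  proof
    assume "g \<in> (\<Union>a\<in>T. eigenspace scale (span X) l d a)"
    then obtain a where a: "a \<in> T" "g \<in> odd_part a" by (auto simp: eigenspace_span_X)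
    then have "a \<in> X" using TD(1) by auto
    then show ?thesis using odd_ideal[OF X_axis X_notin_Y a(2)] oddJ(1)[OF a(1)] by blast
  next
    assume "g \<in> (\<Union>b\<in>S. eigenspace scale (span Y) d l b)"
    then obtain b where b: "b \<in> S" "g \<in> odd_part' b" by (auto simp: sw.eigenspace_span_X)
    then have "b \<in> Y" using SD(1) by auto
    then show ?thesis using sw.odd_ideal[OF sw.X_axis sw.X_notin_Y b(2)] oddJ(2)[OF b(1)] by blast
  qed
  have "v * g \<in> J \<and> g * v \<in> J" if "g \<in> J" for g v
    using that[unfolded J]
    by (induction rule: span_induct_alt) (auto simp: bilin gen subspace_0[OF sJ] subspace_add[OF sJ] subspace_scale[OF sJ])
  then show ideal: "algebra_ideal scale J" using sJ by (auto simp: algebra_ideal_def)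
  define \<chi> where "\<chi> r = (if r \<in> T then coord r else sw.coord r)" for r
  have TS: "a \<noteq> b" if "a \<in> T" "b \<in> S" for a b using that TD(1) SD(1) disjoint by blast
  show "\<exists>\<K>. (\<forall>K\<in>\<K>. is_field_algebra ((quotient J)\<lparr>carrier := K\<rparr>)) \<and> direct_product_of (quotient J) \<K> (\<lambda>K. K)"
  proof (rule quotient_product_of_fields[OF ideal, of "T \<union> S" \<chi>])
    show "span (T \<union> S \<union> J) = UNIV"
    proof -
      have JS: "J \<subseteq> span (T \<union> S \<union> J)" using span_superset by blast
      have "X \<subseteq> span (T \<union> S \<union> J)"
      proof
        fix x assume x: "x \<in> X"
        obtain a where a: "a \<in> T" "a * x \<noteq> 0" using TD(2)[OF x] by blast
        then have "x - a \<in> J" using linked_diff_odd[OF X_axis X_axis[OF x]] TD(1) oddJ by blast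
        then have "(x - a) + a \<in> span (T \<union> S \<union> J)" using a(1) by (intro span_add) (auto intro: span_base)
        then show "x \<in> span (T \<union> S \<union> J)" by simp
      qed
      moreover have "Y \<subseteq> span (T \<union> S \<union> J)"
      proof
        fix x assume x: "x \<in> Y"
        obtain a where a: "a \<in> S" "a * x \<noteq> 0" using SD(2)[OF x] by blast
        then have "x - a \<in> J" using sw.linked_diff_odd[OF sw.X_axis sw.X_axis[OF x]] SD(1) oddJ by blast
        then have "(x - a) + a \<in> span (T \<union> S \<union> J)" using a(1) by (intro span_add) (auto intro: span_base)
        then show "x \<in> span (T \<union> S \<union> J)" by simp
      qed
      moreover have "prods \<subseteq> span (T \<union> S \<union> J)" using prods_mixed mixedJ JS by blast
      ultimately have "span (X \<union> Y \<union> prods) \<subseteq> span (T \<union> S \<union> J)" by (intro span_minimal) auto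
      then show ?thesis using span_UNIV by auto
    qed
    fix r assume r: "r \<in> T \<union> S"
    show "r * r = r" using r TD(1) SD(1) axis_idem[OF X_axis] sw.axis_idem[OF Y_axis] by blast
    show "Vector_Spaces.linear scale (*) (\<chi> r)"
      using r linear_coord[OF X_axis] sw.linear_coord[OF Y_axis] TD(1) SD(1) by (auto simp: \<chi>_def)
    fix s assume s: "s \<in> T \<union> S"
    show "r * s \<in> J" if "r \<noteq> s"
    proof -
      consider "r \<in> T" "s \<in> T" | "r \<in> S" "s \<in> S" | "r \<in> T" "s \<in> S" | "r \<in> S" "s \<in> T" using r s by blast
      then show ?thesis
      proof cases
        case 1 then show ?thesis using transversal_self[OF T] that subspace_0[OF sJ] by metis
      next
        case 2 then show ?thesis using sw.transversal_self[OF S] that subspace_0[OF sJ] by metis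
      next
        case 3 then show ?thesis using prod_in_mixed mixedJ TD(1) SD(1) by blast
      next
        case 4 then show ?thesis using prod_in_mixed' mixedJ TD(1) SD(1) by blast
      qed
    qed
    show "\<chi> r s = (if r = s then 1 else 0)"
    proof -
      consider "r \<in> T" "s \<in> T" | "r \<in> S" "s \<in> S" | "r \<in> T" "s \<in> S" | "r \<in> S" "s \<in> T" using r s by blast
      then show ?thesis
      proof cases
        case 1
        then have "r \<in> X" "s \<in> X" using TD(1) by auto
        then show ?thesis using 1 coord_X[of r s] transversal_self[OF T 1] linked_self[OF X_axis] by (auto simp: \<chi>_def)
      next
        case 2
        then have "r \<in> Y" "s \<in> Y" "r \<notin> T" using SD(1) TS by auto
        then show ?thesis using 2 sw.coord_X[of r s] sw.transversal_self[OF S 2] sw.linked_self[OF Y_axis] by (auto simp: \<chi>_def)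
      next
        case 3
        then have "r \<in> X" "s \<in> Y" using TD(1) SD(1) by auto
        then show ?thesis using 3 TS[OF 3] mixed_mult(1)[OF X_axis Y_axis] by (auto simp: \<chi>_def)
      next
        case 4
        then have "s \<in> X" "r \<in> Y" "r \<notin> T" "r \<noteq> s" using TD(1) SD(1) TS by auto
        then show ?thesis using 4 sw.mixed_mult(1)[OF sw.X_axis sw.Y_axis] by (auto simp: \<chi>_def)
      qed
    qed
  next
    fix r j assume r: "r \<in> T \<union> S" and j: "j \<in> J"
    have lin: "Vector_Spaces.linear scale (*) (\<chi> r)"
      using r linear_coord[OF X_axis] sw.linear_coord[OF Y_axis] TD(1) SD(1) by (auto simp: \<chi>_def)
    \<comment> \<open>A multiplicative functional into a field kills every element of square zero,
      in particular all odd elements.\<close>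
    have odd0: "\<chi> r g = 0" if rX: "r \<in> X" "r \<in> T" and g: "g * g = 0" for g
      using coord_mult[OF rX(1), of g g] g coord_zero[OF X_axis[OF rX(1)]] rX by (simp add: \<chi>_def)
    have odd0': "\<chi> r g = 0" if rX: "r \<in> Y" "r \<notin> T" and g: "g * g = 0" for g
      using sw.coord_mult[OF rX(1), of g g] g sw.coord_zero[OF Y_axis[OF rX(1)]] rX by (simp add: \<chi>_def)
    have odd00: "\<chi> r g = 0" if "g * g = 0" for g
      using odd0 odd0' r TD(1) SD(1) TS that by blast
    have g0: "\<chi> r g = 0"
      if "g \<in> (\<Union>a\<in>T. eigenspace scale (span X) l d a) \<union> (\<Union>b\<in>S. eigenspace scale (span Y) d l b)" for g
      using that
    proof
      assume "g \<in> (\<Union>a\<in>T. eigenspace scale (span X) l d a)"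
      then obtain a where a: "a \<in> T" "g \<in> odd_part a" by (auto simp: eigenspace_span_X)
      then show ?thesis using odd_mult_odd[OF X_axis X_notin_Y a(2) a(2)] TD(1) odd00 by blast
    next
      assume "g \<in> (\<Union>b\<in>S. eigenspace scale (span Y) d l b)"
      then obtain b where b: "b \<in> S" "g \<in> odd_part' b" by (auto simp: sw.eigenspace_span_X)
      then show ?thesis using sw.odd_mult_odd[OF sw.X_axis sw.X_notin_Y b(2) b(2)] SD(1) odd00 by blast
    qed
    have "\<chi> r 0 = 0" "\<chi> r (c *s x + y) = c * \<chi> r x + \<chi> r y" for c x y
      using lin by (simp_all add: Vector_Spaces.linear_iff_module_hom module_hom.add module_hom.scale module_hom.zero)
    with j[unfolded J] show "\<chi> r j = 0"
      by (induction rule: span_induct_alt) (simp_all only: g0 mult_zero_right add_0_left mult_zero_class.mult_zero_right)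
  qed
qed

text \<open>A component generates the span of its axes and of their mixed products, so different
  components multiply to zero by a check on these generators. An element annihilated by its own
  factor is annihilated by all factors, hence zero by \<open>no_annihilating\<close>.\<close>

lemma direct_product_components:
  "direct_product_of algebra_UNIV (graph_components (X \<union> Y)) (generated_subalgebra scale)"
proof -
  let ?V = "X \<union> Y"
  let ?R = "{(x, y) \<in> ?V \<times> ?V. x * y \<noteq> 0}"
  interpret sw: generating_axes scale d l Y X by (rule swapped_generating)
  have comm0: "x * y = 0 \<longleftrightarrow> y * x = 0" if "x \<in> ?V" "y \<in> ?V" for x y
  proof -
    from that consider "x \<in> X" "y \<in> X" | "x \<in> Y" "y \<in> Y" | "x \<in> X" "y \<in> Y" | "x \<in> Y" "y \<in> X" by blast
    then show ?thesis
    proof cases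
      case 1 then show ?thesis by (intro linked_sym X_axis)
    next
      case 2 then show ?thesis by (intro sw.linked_sym Y_axis)
    next
      case 3 then show ?thesis by (intro mixed_comm(2) X_axis Y_axis X_neq_Y)
    next
      case 4 then show ?thesis by (intro sw.mixed_comm(2) X_axis Y_axis sw.X_neq_Y)
    qed
  qed
  have "sym ?R" using comm0 by (auto simp: sym_def)
  then have "sym (?R\<^sup>*)" by (rule sym_rtrancl)
  then have equiv: "equiv ?V (linked_in ?V)"
    unfolding linked_in_def by (auto simp: equiv_def refl_on_def sym_def trans_def)
  have comp_sub: "C \<subseteq> ?V" if "C \<in> graph_components ?V" for C
    using that in_quotient_imp_subset[OF equiv] by (simp add: graph_components_def)
  have unlinked: "x * y = 0" if "C \<in> graph_components ?V" "C' \<in> graph_components ?V" "C \<noteq> C'" "x \<in> C" "y \<in> C'" for C C' x y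
  proof (rule ccontr)
    assume xy: "x * y \<noteq> 0"
    have "x \<in> ?V" "y \<in> ?V" using that comp_sub by blast+
    then have "(x, y) \<in> linked_in ?V" using xy unfolding linked_in_def by auto
    then show False using quotient_eqI[OF equiv _ _ that(4,5)] that unfolding graph_components_def by blast
  qed
  have sub_axes: "mixed_axes scale d' l' (X' \<inter> C) (Y' \<inter> C)" if "mixed_axes scale d' l' X' Y'" for d' l' X' Y' C
    using that by (auto simp: mixed_axes_def mixed_axes_axioms_def)
  have genC: "generated_subalgebra scale C = span (C \<union> {x * y | x y. x \<in> X \<inter> C \<and> y \<in> Y \<inter> C})"
    if "C \<in> graph_components ?V" for C
  proof -
    interpret c: mixed_axes scale l d "X \<inter> C" "Y \<inter> C" by (rule sub_axes[OF mixed_axes_axioms])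
    have "C = X \<inter> C \<union> Y \<inter> C" using comp_sub[OF that] by blast
    then show ?thesis using c.generated_eq unfolding c.prods_def by simp
  qed
  have zero: "u * v = 0" if C: "C \<in> graph_components ?V" "C' \<in> graph_components ?V" "C \<noteq> C'"
      and u: "u \<in> generated_subalgebra scale C" and v: "v \<in> generated_subalgebra scale C'" for C C' u v
  proof -
    \<comment> \<open>An axis \<open>g\<close> from another component is unlinked to both
      \<open>x\<close> and \<open>y\<close>. Comparing it with whichever of them has the same type,
      \<open>mixed_prod_linked\<close> shows that it annihilates \<open>x * y\<close>.\<close>
    have cross: "g * (x * y) = 0 \<and> (x * y) * g = 0"
      if D: "D \<in> graph_components ?V" "D' \<in> graph_components ?V" "D \<noteq> D'" and g: "g \<in> D"
        and xy: "x \<in> X \<inter> D'" "y \<in> Y \<inter> D'" for D D' g x y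
    proof -
      have gV: "g \<in> X \<or> g \<in> Y" using g comp_sub[OF D(1)] by blast
      have u: "x * g = 0" "y * g = 0" using unlinked[OF D(2,1)] D(3) g xy by auto
      show ?thesis
        using gV mixed_prod_linked(2)[OF X_axis X_axis Y_axis X_neq_Y, of x g y]
          sw.mixed_prod_linked(2)[OF Y_axis Y_axis X_axis sw.X_neq_Y, of y g x] xy u
        by (auto simp: null_part_def)
    qed
    have "g * h = 0" if g: "g \<in> C \<union> {x * y | x y. x \<in> X \<inter> C \<and> y \<in> Y \<inter> C}"
      and h: "h \<in> C' \<union> {x * y | x y. x \<in> X \<inter> C' \<and> y \<in> Y \<inter> C'}" for g h
    proof -
      consider "g \<in> C" "h \<in> C'" | "g \<in> C" "h \<notin> C'" | "g \<notin> C" "h \<in> C'" | "g \<notin> C" "h \<notin> C'" by blast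
      then show ?thesis
      proof cases
        case 1 then show ?thesis using unlinked[OF C] by blast
      next
        case 2
        then obtain x y where "h = x * y" "x \<in> X \<inter> C'" "y \<in> Y \<inter> C'" using h by blast
        then show ?thesis using cross[OF C 2(1)] by blast
      next
        case 3
        then obtain x y where "g = x * y" "x \<in> X \<inter> C" "y \<in> Y \<inter> C" using g by blast
        then show ?thesis using cross[OF C(2,1) C(3)[symmetric] 3(2)] by blast
      next
        case 4
        then have "g \<in> mixed" "h \<in> mixed" using g h prod_in_mixed by auto
        then show ?thesis by (rule mixed_mult_mixed)
      qed
    qed
    then show ?thesis using span_mult_zero u v unfolding genC[OF C(1)] genC[OF C(2)] by blast
  qed
  define W where "W = span (\<Union>C\<in>graph_components ?V. generated_subalgebra scale C)"
  have WU: "W = UNIV"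
  proof -
    have "subalgebra scale W"
      unfolding subalgebra_def
    proof (intro conjI ballI)
      show "subspace W" by (simp add: W_def)
      fix u v assume "u \<in> W" "v \<in> W"
      then show "u * v \<in> W"
        unfolding W_def
      proof (rule span_mult_in[OF _ _ subspace_span])
        fix u v
        assume "u \<in> (\<Union>C\<in>graph_components ?V. generated_subalgebra scale C)" "v \<in> (\<Union>C\<in>graph_components ?V. generated_subalgebra scale C)"
        then obtain C C' where C: "C \<in> graph_components ?V" "u \<in> generated_subalgebra scale C"
          "C' \<in> graph_components ?V" "v \<in> generated_subalgebra scale C'" by (elim UN_E)
        show "u * v \<in> span (\<Union>C\<in>graph_components ?V. generated_subalgebra scale C)"
        proof (cases "C = C'")
          case True
          then have "u * v \<in> generated_subalgebra scale C" using C subalgebra_generated[of C] by (simp add: subalgebra_def)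
          then show ?thesis using C(1) by (intro span_base) (rule UN_I)
        next
          case False
          then show ?thesis using zero[OF C(1,3) False C(2,4)] by (simp add: span_zero)
        qed
      qed
    qed
    moreover have "?V \<subseteq> W"
    proof
      fix x assume x: "x \<in> ?V"
      then have "x \<in> \<Union>(graph_components ?V)" using Union_quotient[OF equiv] by (simp add: graph_components_def)
      then obtain C where "C \<in> graph_components ?V" "x \<in> C" by (rule UnionE)
      then have "x \<in> (\<Union>C\<in>graph_components ?V. generated_subalgebra scale C)" using generated_superset by (intro UN_I) auto
      then show "x \<in> W" unfolding W_def by (rule span_base)
    qed
    ultimately show ?thesis using generated_least[of W ?V] generating by auto
  qed
  show ?thesis
  proof (rule direct_productI)
    show "subalgebra scale UNIV" by (simp add: subalgebra_def)
    show "UNIV \<subseteq> span (\<Union>C\<in>graph_components ?V. generated_subalgebra scale C)" using WU by (simp add: W_def)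
  next
    fix C v assume C: "C \<in> graph_components ?V" "v \<in> generated_subalgebra scale C"
      and ann: "\<And>u. u \<in> generated_subalgebra scale C \<Longrightarrow> u * v = 0"
    have ann': "u * v = 0" if "u \<in> (\<Union>C\<in>graph_components ?V. generated_subalgebra scale C)" for u
    proof -
      from that obtain C' where C': "C' \<in> graph_components ?V" "u \<in> generated_subalgebra scale C'" by (rule UN_E)
      then show ?thesis using ann zero[OF C'(1) C(1) _ C'(2) C(2)] by (cases "C = C'") auto
    qed
    have "u * v = 0" if "u \<in> W" for u
      by (rule span_mult_zero[OF that[unfolded W_def] span_base[OF singletonI]]) (use ann' in blast)
    then show "v = 0" using no_annihilating WU by (auto simp: annihilating_def)
  qed (use subalgebra_generated zero in auto)
qed

end

section \<open>Miyamoto involutions\<close>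

lemma mult_BijGroup_UNIV: "f \<otimes>\<^bsub>BijGroup UNIV\<^esub> g = f \<circ> g" if "bij f" "bij g"
  using that by (auto simp: BijGroup_def Bij_def compose_def fun_eq_iff)

context axes_of_type_sum_1
begin

lemma miyamoto_eq:
  assumes a: "axis a" and ty: "ty a = (l, d)"
  shows "miyamoto scale ty a = involution a"
  unfolding miyamoto_def ty fst_conv snd_conv
proof (rule the_equality)
  have fix_even: "odd_proj a y = 0" if "y \<in> even_part scale UNIV a" for y
  proof -
    from that obtain u v where "u \<in> span {a}" "v \<in> null_part UNIV a" "y = u + v"
      unfolding even_part_def by (rule set_plus_elim)
    moreover from this(1) obtain c where "u = c *s a" unfolding span_singleton by blast
    ultimately show ?thesis using null_part_iff[OF a] by (simp add: odd_proj_add odd_proj_scale odd_proj_self)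
  qed
  show "algebra_automorphism scale (involution a) \<and> (\<forall>y\<in>even_part scale UNIV a. involution a y = y) \<and>
      (\<forall>y\<in>odd_part a. involution a y = - y)"
  proof (intro conjI ballI)
    show "algebra_automorphism scale (involution a)" by (rule automorphism_involution[OF a])
    show "involution a y = y" if "y \<in> even_part scale UNIV a" for y
      using fix_even[OF that] by (simp add: involution_def)
    show "involution a y = - y" if "y \<in> odd_part a" for y
    proof -
      have "(2::'k) *s y = y + y" by (metis one_add_one scale_left_distrib scale_one)
      then show ?thesis using odd_proj_odd[OF that] by (simp add: involution_def)
    qed
  qed
  fix f assume f: "algebra_automorphism scale f \<and> (\<forall>y\<in>even_part scale UNIV a. f y = y) \<and> (\<forall>y\<in>odd_part a. f y = - y)"
  show "f = involution a"
  proof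
    fix y
    have "y - odd_proj a y - coord a y *s a \<in> null_part UNIV a"
      by (simp add: null_part_iff[OF a] odd_proj_diff odd_proj_scale odd_proj_self odd_proj_odd axis_mult(3)[OF a]
        coord_diff[OF a] coord_scale[OF a] coord_self[OF a] coord_odd[OF a])
    then have "coord a y *s a + (y - odd_proj a y - coord a y *s a) \<in> even_part scale UNIV a"
      unfolding even_part_def by (intro set_plus_intro) (auto simp: span_singleton)
    then have e: "y - odd_proj a y \<in> even_part scale UNIV a" by simp
    have "f ((y - odd_proj a y) + odd_proj a y) = f (y - odd_proj a y) + f (odd_proj a y)"
      using f by (simp only: algebra_automorphism_def Vector_Spaces.linear_iff)
    then have "f y = (y - odd_proj a y) - odd_proj a y" using f e axis_mult(3)[OF a, of y] by simp
    also have "\<dots> = involution a y"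
      unfolding involution_def by (metis diff_diff_eq one_add_one scale_left_distrib scale_one)
    finally show "f y = involution a y" .
  qed
qed

end

context generating_axes
begin

text \<open>The generators are involutions, so in the case of an inverse the inverse is the
  generator itself.\<close>

lemma miyamoto_group_automorphism:
  assumes ty: "\<And>x. x \<in> X \<Longrightarrow> ty x = (l, d)" "\<And>y. y \<in> Y \<Longrightarrow> ty y = (d, l)"
    and g: "g \<in> miyamoto_group scale ty (X \<union> Y)"
  shows "algebra_automorphism scale g"
proof -
  interpret sw: generating_axes scale d l Y X by (rule swapped_generating)
  have invol: "algebra_automorphism scale f \<and> f \<circ> f = id" if "f \<in> miyamoto scale ty ` (X \<union> Y)" for f
  proof -
    from that obtain v where v: "v \<in> X \<union> Y" "f = miyamoto scale ty v" by blast
    show ?thesis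
    proof (cases "v \<in> X")
      case True
      then show ?thesis
        unfolding v(2) miyamoto_eq[OF X_axis[OF True], of ty, OF ty(1)[OF True]]
        using automorphism_involution[OF X_axis] involution_involution[OF X_axis]
        by (auto simp: fun_eq_iff)
    next
      case False
      then have vY: "v \<in> Y" using v by blast
      show ?thesis
        unfolding v(2) sw.miyamoto_eq[OF Y_axis[OF vY], of ty, OF ty(2)[OF vY]]
        using sw.automorphism_involution[OF Y_axis[OF vY]] sw.involution_involution[OF Y_axis[OF vY]]
        by (auto simp: fun_eq_iff)
    qed
  qed
  interpret G: group "BijGroup (UNIV :: 'a set)" by (rule group_BijGroup)
  have carrier: "carrier (BijGroup (UNIV :: 'a set)) = {f. bij f}" by (auto simp: BijGroup_def Bij_def)
  have one: "one (BijGroup (UNIV :: 'a set)) = id" by (auto simp: BijGroup_def)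
  have aut_bij: "bij f" if "algebra_automorphism scale f" for f
    using that by (simp add: algebra_automorphism_def)
  show ?thesis
    using g unfolding miyamoto_group_def
  proof (induction rule: generate.induct)
    case one
    then show ?case
      unfolding \<open>one (BijGroup (UNIV :: 'a set)) = id\<close>
      unfolding algebra_automorphism_def
      by (intro conjI bij_id) (auto simp: Vector_Spaces.linear_iff vector_space_axioms)
  next
    case (incl h)
    then show ?case using invol by blast
  next
    case (inv h)
    then have h: "algebra_automorphism scale h" "h \<circ> h = id" using invol by blast+
    then have "inv\<^bsub>BijGroup UNIV\<^esub> h = h"
      by (intro G.inv_equality) (auto simp: mult_BijGroup_UNIV aut_bij one carrier)
    then show ?case using h by simp
  next
    case (eng f h)
    then have b: "bij f" "bij h" using aut_bij by auto
    have "algebra_automorphism scale (f \<circ> h)"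
      using eng.IH bij_comp[OF b(2,1)] by (auto simp: algebra_automorphism_def Vector_Spaces.linear_iff)
    then show ?case unfolding mult_BijGroup_UNIV[OF b] .
  qed
qed

text \<open>Automorphisms preserve the axis conditions for both types, so the closure is again a
  generating set made of axes of the two types, and \<open>direct_product_components\<close> applies
  to it.\<close>

lemma axis_closure_axes:
  assumes ty: "\<And>x. x \<in> X \<Longrightarrow> ty x = (l, d)" "\<And>y. y \<in> Y \<Longrightarrow> ty y = (d, l)"
  shows "direct_product_of algebra_UNIV (graph_components (axis_closure scale ty (X \<union> Y))) (generated_subalgebra scale)"
proof -
  interpret sw: generating_axes scale d l Y X by (rule swapped_generating)
  define V where "V = axis_closure scale ty (X \<union> Y)"
  have ax: "axis v \<or> axis' v" if "v \<in> V" for v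
  proof -
    from that obtain g x where g: "g \<in> miyamoto_group scale ty (X \<union> Y)" "x \<in> X \<union> Y" "v = g x"
      unfolding V_def axis_closure_def by blast
    have "algebra_automorphism scale g" using ty g(1) by (rule miyamoto_group_automorphism)
    then show ?thesis using g(2,3) axis_automorphism[OF _ X_axis] sw.axis_automorphism[OF _ Y_axis] by blast
  qed
  have sub: "X \<union> Y \<subseteq> V"
  proof
    fix x assume x: "x \<in> X \<union> Y"
    have "one (BijGroup UNIV) \<in> miyamoto_group scale ty (X \<union> Y)"
      unfolding miyamoto_group_def by (rule generate.one)
    moreover have "x = one (BijGroup UNIV) x" by (simp add: BijGroup_def)
    ultimately show "x \<in> V" using x unfolding V_def axis_closure_def by blast
  qed
  \<comment> \<open>An axis with zero odd part satisfies the conditions of both types; assigning all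
    such axes to \<open>V1\<close> keeps the two sets disjoint.\<close>
  define V1 where "V1 = {v \<in> V. axis v}"
  have V12: "V1 \<union> (V - V1) = V" by (auto simp: V1_def)
  interpret v: generating_axes scale l d V1 "V - V1"
  proof unfold_locales
    have "X \<union> Y \<subseteq> generated_subalgebra scale V" using sub generated_superset[of V] by blast
    then show "generated_subalgebra scale (V1 \<union> (V - V1)) = UNIV"
      using generated_least[OF subalgebra_generated] generating unfolding V12 by blast
  qed (use ax in \<open>auto simp: V1_def\<close>)
  show ?thesis using v.direct_product_components unfolding V12 unfolding V_def .
qed

text \<open>The typing could a priori give the reflection \<open>c\<close> another type. But
  \<open>odd_proj x y\<close> is a nonzero odd element for \<open>c\<close>, so
  \<open>axis_type_unique\<close> forces \<open>(l, d)\<close>, and \<open>X\<close> contains all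
  axes of that type.\<close>

lemma closed_of_maximal:
  assumes typing: "axis_typing scale ty" and X: "X = axes_of_type scale ty l d"
    and xy: "x \<in> X" "y \<in> Y" "x * y \<noteq> 0"
  shows "x - 2 *s odd_proj x y \<in> X"
proof -
  note ax = X_axis[OF xy(1)] Y_axis[OF xy(2)] X_neq_Y[OF xy(1,2)]
  define c where "c = x - 2 *s odd_proj x y"
  have c: "axis c" "x * c \<noteq> 0" using linked_reflection[OF ax] by (simp_all add: c_def)
  have "odd_proj x y \<in> odd_part c" using mixed_proj_linked(1)[OF ax(1) c(1) ax(2,3) c(2)] .
  moreover have "odd_proj x y \<noteq> 0" using mixed_mult(2)[OF ax] xy(3) by auto
  moreover have prim: "primitive_axis scale UNIV c" using c(1) by (auto simp: primitive_axis_def)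
  then have "has_axis_type scale UNIV (fst (ty c)) (snd (ty c)) c" using typing by (simp add: axis_typing_def)
  ultimately have "fst (ty c) = l \<and> snd (ty c) = d" using axis_type_unique[OF c(1)] by blast
  then have "ty c = (l, d)" by (metis prod.collapse)
  then show ?thesis using prim X by (simp add: axes_of_type_def primitive_axes_def c_def)
qed

end

theorem theoremC:
  fixes scale :: "'k::field \<Rightarrow> 'a::{ab_group_add,times} \<Rightarrow> 'a"
    and ty :: "'a \<Rightarrow> 'k \<times> 'k"
    and l d :: 'k
    and X X' X'' A' A'' Z :: "'a set"
  assumes algebra: "nonassoc_algebra scale"
    and char: "(2::'k) \<noteq> 0"
    and typing: "axis_typing scale ty"
    and scalars: "l \<notin> {0, 1}" "d \<notin> {0, 1}" "l + d = 1" "l \<noteq> d"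
    and axes: "X \<subseteq> primitive_axes scale" "X = X' \<union> X''"
    and X': "X' = X \<inter> axes_of_type scale ty l d"
    and X'': "X'' = X \<inter> axes_of_type scale ty d l"
    and generates: "generated_subalgebra scale X = UNIV"
    and A': "A' = generated_subalgebra scale X'"
    and A'': "A'' = generated_subalgebra scale X''"
    and Z: "Z = module.span scale {x' * x'' | x' x''. x' \<in> X' \<and> x'' \<in> X''}"
  shows
    "\<comment> \<open>(i)\<close>
     ((\<exists>\<E>. (\<forall>E\<in>\<E>. is_U scale l E) \<and>
            direct_product_of (algebra_on scale A') \<E> (module.span scale)) \<and>
      (\<exists>\<E>. (\<forall>E\<in>\<E>. is_U scale d E) \<and>
            direct_product_of (algebra_on scale A'') \<E> (module.span scale))) \<and>
     \<comment> \<open>(ii)\<close>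
     ((\<forall>a\<in>axes_of_type scale ty l d. \<forall>a'\<in>axes_of_type scale ty l d.
       \<forall>b\<in>axes_of_type scale ty d l.
         (a * a' \<noteq> 0 \<longrightarrow> a * b \<in> eigenspace scale UNIV l d a' \<and>
                        b * a \<in> eigenspace scale UNIV l d a') \<and>
         (a * a' = 0 \<longrightarrow> a * b \<in> null_part UNIV a' \<and> b * a \<in> null_part UNIV a')) \<and>
      (\<forall>a'\<in>axes_of_type scale ty l d. \<forall>x'\<in>axes_of_type scale ty l d. a' * x' \<noteq> 0 \<longrightarrow>
         null_part UNIV a' \<inter> Z = null_part UNIV x' \<inter> Z \<and>
         eigenspace scale UNIV l d a' \<inter> Z = eigenspace scale UNIV l d x' \<inter> Z)) \<and>
     \<comment> \<open>(iii)\<close>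
     (algebra_ideal scale Z \<and> (\<forall>x\<in>Z. \<forall>y\<in>Z. x * y = 0) \<and>
      UNIV = A' + A'' + Z \<and>
      (finite X \<longrightarrow> (\<exists>B. finite B \<and> module.span scale B = (UNIV :: 'a set)))) \<and>
     \<comment> \<open>(iv)\<close>
     ((\<forall>a\<in>axes_of_type scale ty l d. \<forall>w\<in>eigenspace scale UNIV l d a.
         \<exists>v'\<in>(module.span scale {a} + A') \<inter> eigenspace scale UNIV l d a.
         \<exists>z'\<in>Z \<inter> eigenspace scale UNIV l d a. w = v' + z') \<and>
      (\<forall>a\<in>X'. eigenspace scale UNIV l d a =
               eigenspace scale A' l d a + (Z \<inter> eigenspace scale UNIV l d a)) \<and>
      (\<forall>C\<in>graph_components X'. \<forall>a\<^sub>1\<in>C. \<forall>a\<^sub>2\<in>C.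
         eigenspace scale UNIV l d a\<^sub>1 = eigenspace scale UNIV l d a\<^sub>2) \<and>
      (\<forall>a\<in>axes_of_type scale ty l d.
         \<forall>x\<in>eigenspace scale UNIV l d a. \<forall>y\<in>eigenspace scale UNIV l d a. x * y = 0)) \<and>
     \<comment> \<open>(v)\<close>
     ((\<forall>a. primitive_axis scale A' a \<longrightarrow> primitive_axis scale UNIV a) \<and>
      (\<forall>a. primitive_axis scale A'' a \<longrightarrow> primitive_axis scale UNIV a)) \<and>
     \<comment> \<open>(vi)\<close>
     ((X' = axes_of_type scale ty l d \<longrightarrow>
         (\<forall>T. component_transversal X' T \<longrightarrow>
            Z \<subseteq> module.span scale (\<Union>a\<in>T. eigenspace scale A' l d a))) \<and>
      (X'' = axes_of_type scale ty d l \<longrightarrow>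
         (\<forall>T. component_transversal X'' T \<longrightarrow>
            Z \<subseteq> module.span scale (\<Union>a\<in>T. eigenspace scale A'' d l a)))) \<and>
     \<comment> \<open>(vii)\<close>
     (graph_connected X' \<longrightarrow>
        (\<forall>a\<in>X'.
           eigenspace scale UNIV l d a = module.span scale {x' - a | x'. x' \<in> X'} + Z \<and>
           algebra_ideal scale (eigenspace scale UNIV l d a) \<and>
           algebra_isomorphic
             (quotient_algebra (algebra_on scale UNIV) (eigenspace scale UNIV l d a))
             (product_algebra base_field_algebra
                ((quotient_algebra (algebra_on scale UNIV) Z)
                   \<lparr>carrier := (\<lambda>x. Z +>\<^bsub>algebra_on scale UNIV\<^esub> x) ` A''\<rparr>)))) \<and>
     \<comment> \<open>(viii)\<close>
     (X = primitive_axes scale \<longrightarrow>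
        (\<forall>T' T'' J. component_transversal X' T' \<longrightarrow> component_transversal X'' T'' \<longrightarrow>
           J = module.span scale ((\<Union>a\<in>T'. eigenspace scale A' l d a) \<union>
                                  (\<Union>a\<in>T''. eigenspace scale A'' d l a)) \<longrightarrow>
           algebra_ideal scale J \<and>
           (\<exists>\<K>. (\<forall>K\<in>\<K>. is_field_algebra
                     ((quotient_algebra (algebra_on scale UNIV) J)\<lparr>carrier := K\<rparr>)) \<and>
                 direct_product_of (quotient_algebra (algebra_on scale UNIV) J) \<K> (\<lambda>K. K)))) \<and>
     \<comment> \<open>(ix)\<close>
     ((\<forall>y::'a. annihilating y \<longrightarrow> y = 0) \<and>
      direct_product_of (algebra_on scale UNIV)
        (graph_components (axis_closure scale ty X)) (generated_subalgebra scale))"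
proof -
  have axL: "has_axis_type scale UNIV p q a" if "a \<in> axes_of_type scale ty p q" for a p q
    using that typing by (auto simp: axes_of_type_def primitive_axes_def axis_typing_def)
  have tyL: "ty a = (p, q)" if "a \<in> axes_of_type scale ty p q" for a p q
    using that by (simp add: axes_of_type_def)
  have sub: "X' \<subseteq> axes_of_type scale ty l d" "X'' \<subseteq> axes_of_type scale ty d l" using X' X'' by auto
  have types_disjoint: "a \<notin> axes_of_type scale ty d l" if "a \<in> axes_of_type scale ty l d" for a
    using that scalars(4) by (auto simp: axes_of_type_def)
  interpret P: generating_axes scale l d X' X''
  proof (intro generating_axes.intro mixed_axes.intro axes_of_type_sum_1.intro algebra
      axes_of_type_sum_1_axioms.intro mixed_axes_axioms.intro generating_axes_axioms.intro)
    show "X' \<inter> X'' = {}" using sub types_disjoint by blast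
    show "generated_subalgebra scale (X' \<union> X'') = UNIV" using generates axes(2) by simp
  qed (use char scalars sub axL in auto)
  \<comment> \<open>The instance with exchanged types yields the assertions about
    \<open>A''\<close>.\<close>
  interpret Q: generating_axes scale d l X'' X' by (rule P.swapped_generating)
  have notin: "a \<notin> X''" if "a \<in> axes_of_type scale ty l d" for a
    using that sub(2) types_disjoint by blast
  have A: "A' = P.span X'" "A'' = P.span X''"
    using A' A'' P.generated_X Q.generated_X by auto
  have Zm: "Z = P.mixed" using Z unfolding P.mixed_def P.prods_def .
  have maximal: "X' = axes_of_type scale ty l d" "X'' = axes_of_type scale ty d l" if "X = primitive_axes scale"
    using that X' X'' by (auto simp: axes_of_type_def)
  note closedX = P.closed_of_maximal[OF typing] and closedY = Q.closed_of_maximal[OF typing]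
  have i: "(\<exists>\<E>. (\<forall>E\<in>\<E>. is_U scale l E) \<and> direct_product_of (algebra_on scale A') \<E> P.span) \<and>
      (\<exists>\<E>. (\<forall>E\<in>\<E>. is_U scale d E) \<and> direct_product_of (algebra_on scale A'') \<E> P.span)"
    unfolding A using P.direct_product_span_X Q.direct_product_span_X by blast
  have ii: "(\<forall>a\<in>axes_of_type scale ty l d. \<forall>a'\<in>axes_of_type scale ty l d.
       \<forall>b\<in>axes_of_type scale ty d l.
         (a * a' \<noteq> 0 \<longrightarrow> a * b \<in> eigenspace scale UNIV l d a' \<and>
                        b * a \<in> eigenspace scale UNIV l d a') \<and>
         (a * a' = 0 \<longrightarrow> a * b \<in> null_part UNIV a' \<and> b * a \<in> null_part UNIV a'))"
  proof (intro ballI)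
    fix a a' b
    assume ab: "a \<in> axes_of_type scale ty l d" "a' \<in> axes_of_type scale ty l d" "b \<in> axes_of_type scale ty d l"
    then have "a \<noteq> b" using types_disjoint by blast
    from P.mixed_prod_linked[OF axL[OF ab(1)] axL[OF ab(2)] axL[OF ab(3)] this]
    show "(a * a' \<noteq> 0 \<longrightarrow> a * b \<in> eigenspace scale UNIV l d a' \<and> b * a \<in> eigenspace scale UNIV l d a') \<and>
         (a * a' = 0 \<longrightarrow> a * b \<in> null_part UNIV a' \<and> b * a \<in> null_part UNIV a')" by blast
  qed
  have ii': "\<forall>a'\<in>axes_of_type scale ty l d. \<forall>x'\<in>axes_of_type scale ty l d. a' * x' \<noteq> 0 \<longrightarrow>
         null_part UNIV a' \<inter> Z = null_part UNIV x' \<inter> Z \<and>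
         eigenspace scale UNIV l d a' \<inter> Z = eigenspace scale UNIV l d x' \<inter> Z"
    (is "\<forall>a\<in>_. \<forall>x\<in>_. _ \<longrightarrow> ?P a x")
  proof (intro ballI impI)
    fix a x assume "a \<in> axes_of_type scale ty l d" "x \<in> axes_of_type scale ty l d" "a * x \<noteq> 0"
    then have "a * z = x * z" "z * a = z * x" if "z \<in> Z" for z
      using P.linked_mult_mixed(2,3)[OF axL axL] that unfolding Zm by blast+
    then show "?P a x" by (simp add: null_part_def eigenspace_def set_eq_iff conj_commute cong: conj_cong)
  qed
  have iii: "algebra_ideal scale Z \<and> (\<forall>x\<in>Z. \<forall>y\<in>Z. x * y = 0) \<and> UNIV = A' + A'' + Z \<and>
      (finite X \<longrightarrow> (\<exists>B. finite B \<and> P.span B = (UNIV :: 'a set)))"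
  proof (intro conjI impI)
    assume "finite X"
    then have "finite X'" "finite X''" using axes(2) by auto
    moreover have "P.prods \<subseteq> (\<lambda>(x, y). x * y) ` (X' \<times> X'')" by (auto simp: P.prods_def)
    ultimately have "finite (X' \<union> X'' \<union> P.prods)" by (auto intro: finite_subset)
    then show "\<exists>B. finite B \<and> P.span B = (UNIV :: 'a set)"
      using P.span_UNIV by (intro exI[of _ "X' \<union> X'' \<union> P.prods"] conjI)
  next
    show "algebra_ideal scale Z" unfolding Zm by (rule P.mixed_algebra_ideal)
    show "\<forall>x\<in>Z. \<forall>y\<in>Z. x * y = 0" unfolding Zm by (intro ballI P.mixed_mult_mixed)
    show "UNIV = A' + A'' + Z" unfolding Zm A by (rule P.UNIV_eq)
  qed
  have iv1: "\<forall>a\<in>axes_of_type scale ty l d. \<forall>w\<in>eigenspace scale UNIV l d a.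
         \<exists>v'\<in>(P.span {a} + A') \<inter> eigenspace scale UNIV l d a.
         \<exists>z'\<in>Z \<inter> eigenspace scale UNIV l d a. w = v' + z'"
    unfolding A Zm by (intro ballI P.odd_part_decomp axL notin)
  have iv2: "\<forall>a\<in>X'. eigenspace scale UNIV l d a =
               eigenspace scale A' l d a + (Z \<inter> eigenspace scale UNIV l d a)"
    unfolding A Zm by (intro ballI P.odd_part_eq_X)
  have iv3: "\<forall>C\<in>graph_components X'. \<forall>a\<^sub>1\<in>C. \<forall>a\<^sub>2\<in>C.
         eigenspace scale UNIV l d a\<^sub>1 = eigenspace scale UNIV l d a\<^sub>2"
    unfolding P.graph_components_X using P.cls_odd_part by blast
  have iv4: "\<forall>a\<in>axes_of_type scale ty l d.
         \<forall>x\<in>eigenspace scale UNIV l d a. \<forall>y\<in>eigenspace scale UNIV l d a. x * y = 0"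
    by (intro ballI P.odd_mult_odd) (use axL notin in blast)+
  have v: "(\<forall>a. primitive_axis scale A' a \<longrightarrow> primitive_axis scale UNIV a) \<and>
      (\<forall>a. primitive_axis scale A'' a \<longrightarrow> primitive_axis scale UNIV a)"
  proof (intro conjI allI impI)
    fix a
    show "primitive_axis scale UNIV a" if "primitive_axis scale A' a"
      using P.primitive_in_span_X that unfolding A primitive_axis_def[of scale UNIV] by blast
    show "primitive_axis scale UNIV a" if "primitive_axis scale A'' a"
      using Q.primitive_in_span_X that unfolding A primitive_axis_def[of scale UNIV] by blast
  qed
  have vi: "(X' = axes_of_type scale ty l d \<longrightarrow>
         (\<forall>T. component_transversal X' T \<longrightarrow>
            Z \<subseteq> P.span (\<Union>a\<in>T. eigenspace scale A' l d a))) \<and>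
      (X'' = axes_of_type scale ty d l \<longrightarrow>
         (\<forall>T. component_transversal X'' T \<longrightarrow>
            Z \<subseteq> P.span (\<Union>a\<in>T. eigenspace scale A'' d l a)))"
    unfolding A
  proof (intro conjI impI allI)
    fix T
    show "Z \<subseteq> P.span (\<Union>a\<in>T. eigenspace scale (P.span X') l d a)"
      if "X' = axes_of_type scale ty l d" "component_transversal X' T"
      unfolding Zm by (rule P.mixed_subset_odd_parts[OF closedX[OF that(1)] that(2)])
    show "Z \<subseteq> P.span (\<Union>a\<in>T. eigenspace scale (P.span X'') d l a)"
      if "X'' = axes_of_type scale ty d l" "component_transversal X'' T"
      unfolding Zm P.mixed_swap[symmetric] by (rule Q.mixed_subset_odd_parts[OF closedY[OF that(1)] that(2)])
  qed
  have vii: "graph_connected X' \<longrightarrow>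
        (\<forall>a\<in>X'.
           eigenspace scale UNIV l d a = P.span {x' - a | x'. x' \<in> X'} + Z \<and>
           algebra_ideal scale (eigenspace scale UNIV l d a) \<and>
           algebra_isomorphic
             (quotient_algebra (algebra_on scale UNIV) (eigenspace scale UNIV l d a))
             (product_algebra base_field_algebra
                ((quotient_algebra (algebra_on scale UNIV) Z)
                   \<lparr>carrier := (\<lambda>x. Z +>\<^bsub>algebra_on scale UNIV\<^esub> x) ` A''\<rparr>)))"
  proof (intro impI ballI)
    fix a assume "graph_connected X'" and a: "a \<in> X'"
    then have conn: "x * y \<noteq> 0" if "x \<in> X'" "y \<in> X'" for x y
      using that unfolding graph_connected_def P.linked_in_X by blast
    show "eigenspace scale UNIV l d a = P.span {x' - a | x'. x' \<in> X'} + Z \<and>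
           algebra_ideal scale (eigenspace scale UNIV l d a) \<and>
           algebra_isomorphic
             (quotient_algebra (algebra_on scale UNIV) (eigenspace scale UNIV l d a))
             (product_algebra base_field_algebra
                ((quotient_algebra (algebra_on scale UNIV) Z)
                   \<lparr>carrier := (\<lambda>x. Z +>\<^bsub>algebra_on scale UNIV\<^esub> x) ` A''\<rparr>))"
      unfolding Zm A
      by (intro conjI P.odd_part_connected P.odd_part_ideal P.quotient_odd_part_connected conn a P.X_axis P.X_notin_Y)
  qed
  have viii: "X = primitive_axes scale \<longrightarrow>
        (\<forall>T' T'' J. component_transversal X' T' \<longrightarrow> component_transversal X'' T'' \<longrightarrow>
           J = P.span ((\<Union>a\<in>T'. eigenspace scale A' l d a) \<union>
                                  (\<Union>a\<in>T''. eigenspace scale A'' d l a)) \<longrightarrow>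
           algebra_ideal scale J \<and>
           (\<exists>\<K>. (\<forall>K\<in>\<K>. is_field_algebra
                     ((quotient_algebra (algebra_on scale UNIV) J)\<lparr>carrier := K\<rparr>)) \<and>
                 direct_product_of (quotient_algebra (algebra_on scale UNIV) J) \<K> (\<lambda>K. K)))"
    unfolding A
  proof (intro impI allI)
    fix T' T'' J
    assume "X = primitive_axes scale"
    note X'_max = maximal(1)[OF this]
    assume "component_transversal X' T'" "component_transversal X'' T''"
      "J = P.span ((\<Union>a\<in>T'. eigenspace scale (P.span X') l d a) \<union> (\<Union>a\<in>T''. eigenspace scale (P.span X'') d l a))"
    from P.quotient_fields[OF closedX[OF X'_max] this]
    show "algebra_ideal scale J \<and>
           (\<exists>\<K>. (\<forall>K\<in>\<K>. is_field_algebra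
                     ((quotient_algebra (algebra_on scale UNIV) J)\<lparr>carrier := K\<rparr>)) \<and>
                 direct_product_of (quotient_algebra (algebra_on scale UNIV) J) \<K> (\<lambda>K. K))" by (rule conjI)
  qed
  have ix: "(\<forall>y::'a. annihilating y \<longrightarrow> y = 0) \<and>
      direct_product_of (algebra_on scale UNIV)
        (graph_components (axis_closure scale ty X)) (generated_subalgebra scale)"
    using P.no_annihilating P.axis_closure_axes[of ty] sub tyL unfolding axes(2) by blast
  show ?thesis
    by (intro conjI i[THEN conjunct1] i[THEN conjunct2] ii ii' iii[THEN conjunct1] iii[THEN conjunct2, THEN conjunct1]
      iii[THEN conjunct2, THEN conjunct2, THEN conjunct1] iii[THEN conjunct2, THEN conjunct2, THEN conjunct2]
      iv1 iv2 iv3 iv4 v[THEN conjunct1] v[THEN conjunct2] vi[THEN conjunct1] vi[THEN conjunct2] vii viii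
      ix[THEN conjunct1] ix[THEN conjunct2])
qed

end
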